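(* Let $q>7+\sqrt{33}$ and $p=4-\frac{8}{q}$. Let $F:\mathbb{R}^3\to[0,\infty)$, $f_0:\mathbb{R}^3\times\mathbb{R}^3\to[0,\infty)$ and $A:[0,\infty)\times\mathbb{R}^3\to\mathbb{R}^3$ be given. Assume the following. (i) $F(v)=F_R(|v|)$ is nonnegative and $C^2$ with $F_R''(0)<0$, and there is $W\in(0,\infty)$ such that $F_R'(u)<0$ for $u\in(0,W)$ and $F_R(u)=0$ for $u\ge W$. (ii) $f_0$ is $C^1$ with compact $v$-support and nonnegative, and there is $N>0$ such that $f_0(x,v)=F(v)$ whenever $|x|>N$. (iii) $A$ is $C^1$ and there is $C>0$ such that for all $t\ge0$ and $x\in\mathbb{R}^3$, $$|A(t,x)|\le C R^{-2}(x),\qquad |\partial_xA(t,x)|\le C R^{-3}(x),\qquad |\nabla_x\cdot A(t,x)|=0.$$ Let $T>0$ and let $f$ be the $C^1$ solution on $[0,T)\times\mathbb{R}^3\times\mathbb{R}^3$ (with values in $[0,\infty)$) of $$\partial_tf+v\cdot\nabla_xf-(E+A)\cdot\nabla_vf=0,$$ $$\rho(t,x)=\int_{\mathbb{R}^3}(F(v)-f(t,x,v))\,dv,$$ $$E(t,x)=\int_{\mathbb{R}^3}\rho(t,y)\frac{x-y}{|x-y|^3}\,dy,$$ $$f(0,x,v)=f_0(x,v),$$ with $|||(F-f)(t)|||<\infty$ for every $t\in[0,T)$. Then $$\|\rho(t)\|_6\le C_{p,t}$$ for any $t\in[0,T)$, where the constant $C_{p,t}$ depends upon $\sup_{\ta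u\in[0,t]}\|\rho(\tau)\|_p$.
   Context: Write $R(x)=R(|x|)=(1+|x|^2)^{1/2}$ for $x\in\mathbb{R}^3$. For a function $\rho$ on $\mathbb{R}^3$ and an exponent $s$ (here $s=p$ or $s=6$), $\|\rho\|_s=\sup_{x}|\rho(x)|R^s(x)$ (not an $L^s$ norm); $\rho(t)$ denotes the function $x\mapsto\rho(t,x)$. For a function $g$ on $\mathbb{R}^3\times\mathbb{R}^3$, $\|g\|_q=\|g\,(1+|x|^2+|v|^q)\|_{L^\infty(\mathbb{R}^6)}$ (not an $L^q$ norm), and $$|||g|||=\|g\|_q+\|\nabla g\|_q+\left\|\int g\,dv\right\|_p,$$ where $\nabla g$ is the gradient in $(x,v)$. Here $(F-f)(t)$ denotes the function $(x,v)\mapsto F(v)-f(t,x,v)$. Convention on constants: besides the indicated dependence on $\sup_{\tau\in[0,t]}\|\rho(\tau)\|_p$ and on $t$, constants may depend on $f_0$, $A$, $F$ and $T$, but not on $x$ or $v$. *)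

theory Defs
  imports "HOL-Analysis.Analysis" "HOL-Probability.Essential_Supremum"
begin

text \<open>Continuous differentiability on a set, with derivatives taken within the set, so that the
  time derivative is one-sided at the initial time.\<close>

definition C1_on :: "'a::real_normed_vector set \<Rightarrow> ('a \<Rightarrow> 'b::real_normed_vector) \<Rightarrow> bool" where
  "C1_on S g \<longleftrightarrow> (\<exists>g' :: 'a \<Rightarrow> 'a \<Rightarrow>\<^sub>L 'b.
     (\<forall>z\<in>S. (g has_derivative blinfun_apply (g' z)) (at z within S)) \<and> continuous_on S g')"

definition C2_on :: "'a::real_normed_vector set \<Rightarrow> ('a \<Rightarrow> 'b::real_normed_vector) \<Rightarrow> bool" where
  "C2_on S g \<longleftrightarrow> (\<exists>g' :: 'a \<Rightarrow> 'a \<Rightarrow>\<^sub>L 'b.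
     (\<forall>z\<in>S. (g has_derivative blinfun_apply (g' z)) (at z within S)) \<and> C1_on S g')"

definition grad :: "('a::euclidean_space \<Rightarrow> real) \<Rightarrow> 'a \<Rightarrow> 'a" where
  "grad g z = (\<Sum>b\<in>Basis. frechet_derivative g (at z) b *\<^sub>R b)"

text \<open>Derivative of a function of the radial variable \<open>u \<ge> 0\<close>, one-sided at \<open>u = 0\<close>.\<close>

definition radial_deriv :: "(real \<Rightarrow> real) \<Rightarrow> real \<Rightarrow> real" where
  "radial_deriv g u = vector_derivative g (at u within {0..})"

definition R :: "real^3 \<Rightarrow> real" where
  "R x = sqrt (1 + (norm x)\<^sup>2)"

text \<open>The norms take values in \<^typ>\<open>ennreal\<close>, so that an infinite norm is \<open>\<infinity>\<close> and not an arbitrary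
  real number.\<close>

definition decay_norm :: "real \<Rightarrow> (real^3 \<Rightarrow> real) \<Rightarrow> ennreal" where
  "decay_norm s r = (SUP x. ennreal (\<bar>r x\<bar> * R x powr s))"

definition phase_norm :: "real \<Rightarrow> ((real^3) \<times> (real^3) \<Rightarrow> 'b::real_normed_vector) \<Rightarrow> ennreal" where
  "phase_norm q g =
     esssup lborel (\<lambda>(x, v). ennreal (norm (g (x, v)) * (1 + (norm x)\<^sup>2 + norm v powr q)))"

definition triple_norm :: "real \<Rightarrow> real \<Rightarrow> ((real^3) \<times> (real^3) \<Rightarrow> real) \<Rightarrow> ennreal" where
  "triple_norm p q g =
     phase_norm q g + phase_norm q (grad g) + decay_norm p (\<lambda>x. \<integral>v. g (x, v) \<partial>lborel)"

text \<open>For differentiable \<open>F - f(t)\<close> of finite \<^const>\<open>triple_norm\<close> with \<open>q > 3\<close> and \<open>p > 3\<close>, the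
  integrands of the following two Bochner integrals are integrable for every \<open>x\<close>, so the default
  value \<open>0\<close> for non-integrable functions plays no role.\<close>

definition charge_density ::
    "(real^3 \<Rightarrow> real) \<Rightarrow> (real \<Rightarrow> real^3 \<Rightarrow> real^3 \<Rightarrow> real) \<Rightarrow> real \<Rightarrow> real^3 \<Rightarrow> real" where
  "charge_density F f t x = (\<integral>v. (F v - f t x v) \<partial>lborel)"

definition electric_field ::
    "(real^3 \<Rightarrow> real) \<Rightarrow> (real \<Rightarrow> real^3 \<Rightarrow> real^3 \<Rightarrow> real) \<Rightarrow> real \<Rightarrow> real^3 \<Rightarrow> real^3" where
  "electric_field F f t x =
     (\<integral>y. (charge_density F f t y / norm (x - y) ^ 3) *\<^sub>R (x - y) \<partial>lborel)"

text \<open>Functions of time are total in HOL; only their values on \<open>[0, T)\<close> are constrained.\<close>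

definition VP_solution ::
    "(real^3 \<Rightarrow> real) \<Rightarrow> (real \<Rightarrow> real^3 \<Rightarrow> real^3) \<Rightarrow> (real^3 \<Rightarrow> real^3 \<Rightarrow> real) \<Rightarrow> real
      \<Rightarrow> (real \<Rightarrow> real^3 \<Rightarrow> real^3 \<Rightarrow> real) \<Rightarrow> bool" where
  "VP_solution F A f0 T f \<longleftrightarrow>
     C1_on ({0..<T} \<times> UNIV \<times> UNIV) (\<lambda>(t, x, v). f t x v) \<and>
     (\<forall>t\<in>{0..<T}. \<forall>x v. 0 \<le> f t x v) \<and>
     (\<forall>t\<in>{0..<T}. \<forall>x v.
        vector_derivative (\<lambda>s. f s x v) (at t within {0..<T})
        + v \<bullet> grad (\<lambda>y. f t y v) x
        - (electric_field F f t x + A t x) \<bullet> grad (f t x) v = 0) \<and>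
     (\<forall>x v. f 0 x v = f0 x v)"

end

theory Submission
  imports Defs
begin

text \<open>For a point \<open>x\<close> far away, every characteristic that reaches \<open>(t, x, v)\<close> starts where \<open>f0 = F\<close>, so
  that \<open>\<rho>(t, x) = \<integral> (F(v) - F(w(v))) dv\<close>, where \<open>w(v)\<close> is the velocity at time \<open>0\<close> of the
  characteristic that ends in \<open>(x, v)\<close> at time \<open>t\<close>. If \<open>w\<close> preserved volume, this would vanish.
  In general, substituting \<open>w\<close> in \<open>\<integral> F\<close> gives \<open>\<rho>(t, x) = \<integral> F(w(v)) (det Dw(v) - 1) dv\<close>.
  The force \<open>E + A\<close> has a spatial derivative of size \<open>R\<close> to the power \<open>-3\<close>, hence
  \<open>Dw = I + M\<close> with \<open>M\<close> of this size, and \<open>det Dw - 1 = tr M\<close> up to quadratic terms, which have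
  size \<open>R\<close> to the power \<open>-6\<close>. Up to terms of that size again, \<open>tr M\<close> is the time integral, along
  the characteristic, of the divergence of the force times the elapsed time. Since \<open>A\<close> is divergence
  free and \<open>div E = 4 \<pi> \<rho>\<close>, the density is bounded by a multiple of \<open>R\<close> to the power \<open>-6\<close> plus a multiple of
  the time integral of its own supremum near \<open>x\<close>; a Gronwall argument with the weight
  \<open>R^6\<close> finishes the proof.

  Two devices turn this into a proof whose constants see the solution only through
  \<open>S = sup \<parallel>\<rho>\<parallel>\<^sub>p\<close>. First, the characteristic flow is replaced by Euler polygons. A \<open>C\<^sup>1\<close> solution
  changes by \<open>o(\<delta>)\<close> along one step of size \<open>\<delta>\<close>, provided only that the force is bounded, so \<open>f\<close> is the uniform
  limit of \<open>f0\<close> at the end points of the polygons (\<open>transport_along_polygon\<close>). The derivative of a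
  polygon with respect to the velocity is an explicit recursion.

  Second, \<open>S\<close> does not control the derivative of \<open>E\<close>. Therefore the Coulomb kernel is
  softened at a length \<open>\<epsilon>\<close> that depends on the point \<open>x\<close> under study, namely \<open>\<epsilon> = R(x)\<close> to the
  power \<open>-6\<close>. The field changes by \<open>O(\<epsilon>)\<close>, which is affordable. The softened
  field has a derivative that grows at most like a small negative power of \<open>\<epsilon>\<close> times the local
  size of the density, and the surplus decay \<open>p > 3\<close> absorbs that power (\<open>soft_force_deriv_le\<close>).
  The divergence of the softened field is an average of \<open>\<rho>\<close> against an approximate identity, so it is
  bounded by the density near \<open>x\<close> up to \<open>O(\<epsilon>\<^sup>2)\<close> (\<open>trace_soft_field_deriv_le\<close>). The
  determinant estimate \<open>integral_diff_near_identity_le\<close>, applied to polygons of the softened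
  field, then yields \<open>local_estimate\<close>, and \<open>decay_propagation\<close> is the Gronwall step.\<close>

section \<open>Integrals of radial weights on three-space\<close>

lemma nn_integral_even_le:
  fixes g :: "real \<Rightarrow> ennreal"
  assumes [measurable]: "g \<in> borel_measurable borel" and even: "\<And>u. g (- u) = g u"
  shows "(\<integral>\<^sup>+u. g u \<partial>lborel) \<le> 2 * (\<integral>\<^sup>+u. g u * indicator {0..} u \<partial>lborel)"
proof -
  have "(\<integral>\<^sup>+u. g u \<partial>lborel) \<le> (\<integral>\<^sup>+u. g u * indicator {0..} u + g u * indicator {..0} u \<partial>lborel)"
    by (intro nn_integral_mono) (auto simp: indicator_def)
  also have "\<dots> = (\<integral>\<^sup>+u. g u * indicator {0..} u \<partial>lborel) + (\<integral>\<^sup>+u. g u * indicator {..0} u \<partial>lborel)"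
    by (intro nn_integral_add) auto
  also have "(\<integral>\<^sup>+u. g u * indicator {..0} u \<partial>lborel) = (\<integral>\<^sup>+u. g u * indicator {0..} u \<partial>lborel)"
    by (subst nn_integral_real_affine[where c="-1" and t=0])
       (auto simp: even indicator_def intro!: nn_integral_cong)
  finally show ?thesis by (simp add: mult_2)
qed

lemma nn_integral_weight_real_finite:
  fixes \<alpha> \<gamma> :: real
  assumes "0 \<le> \<alpha>" "\<alpha> < 1" "0 \<le> \<gamma>" "\<alpha> + 2 * \<gamma> > 1"
  shows "(\<integral>\<^sup>+u. ennreal (\<bar>u\<bar> powr - \<alpha> * (1 + u\<^sup>2) powr - \<gamma>) \<partial>lborel) < \<infinity>"
proof -
  let ?g = "\<lambda>u::real. ennreal (\<bar>u\<bar> powr - \<alpha> * (1 + u\<^sup>2) powr - \<gamma>)"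
  have 1: "(\<integral>\<^sup>+u. ennreal (u powr - \<alpha>) * indicator {0..1} u \<partial>lborel) < \<infinity>"
    using nn_integral_has_integral_lebesgue'[OF _ has_integral_powr_from_0[of "-\<alpha>" 1]] assms
    by simp
  have 2: "(\<integral>\<^sup>+u. ennreal (u powr - (\<alpha> + 2 * \<gamma>)) * indicator {1..} u \<partial>lborel) < \<infinity>"
    using nn_integral_has_integral_lebesgue'[OF _ has_integral_powr_to_inf[of "- (\<alpha> + 2 * \<gamma>)" 1]] assms
    by simp
  have "(\<integral>\<^sup>+u. ?g u * indicator {0..} u \<partial>lborel)
     \<le> (\<integral>\<^sup>+u. ennreal (u powr - \<alpha>) * indicator {0..1} u
          + ennreal (u powr - (\<alpha> + 2 * \<gamma>)) * indicator {1..} u \<partial>lborel)"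
  proof (rule nn_integral_mono)
    fix u :: real
    consider "u < 0" | "0 \<le> u" "u \<le> 1" | "1 < u" by linarith
    then show "?g u * indicator {0..} u \<le> ennreal (u powr - \<alpha>) * indicator {0..1} u
          + ennreal (u powr - (\<alpha> + 2 * \<gamma>)) * indicator {1..} u"
    proof cases
      case 2
      have "(1 + u\<^sup>2) powr - \<gamma> \<le> 1 powr - \<gamma>"
        using assms by (intro powr_mono2') auto
      then have "?g u \<le> ennreal (u powr - \<alpha>)"
        using 2 mult_left_le[of "(1 + u\<^sup>2) powr - \<gamma>" "u powr - \<alpha>"] by (intro ennreal_leI) auto
      then show ?thesis using 2 by (auto simp: indicator_def add_increasing2)
    next
      case 3
      have "(1 + u\<^sup>2) powr - \<gamma> \<le> (u\<^sup>2) powr - \<gamma>"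
        using assms 3 by (intro powr_mono2') auto
      also have "(u\<^sup>2) powr - \<gamma> = u powr (- 2 * \<gamma>)"
        using 3 by (simp add: powr_powr flip: powr_numeral)
      finally have "u powr - \<alpha> * (1 + u\<^sup>2) powr - \<gamma> \<le> u powr - \<alpha> * u powr (- 2 * \<gamma>)"
        by (intro mult_left_mono) auto
      then show ?thesis using 3 by (auto simp: indicator_def powr_add[symmetric] intro!: ennreal_leI)
    qed (auto simp: indicator_def)
  qed
  also have "\<dots> = (\<integral>\<^sup>+u. ennreal (u powr - \<alpha>) * indicator {0..1} u \<partial>lborel)
          + (\<integral>\<^sup>+u. ennreal (u powr - (\<alpha> + 2 * \<gamma>)) * indicator {1..} u \<partial>lborel)"
    by (intro nn_integral_add) auto
  also have "\<dots> < \<infinity>" using 1 2 by simp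
  finally have "2 * (\<integral>\<^sup>+u. ?g u * indicator {0..} u \<partial>lborel) < \<infinity>"
    by (simp add: ennreal_mult_less_top)
  then show ?thesis by (intro le_less_trans[OF nn_integral_even_le]) auto
qed

text \<open>Since \<open>norm z\<close> dominates every coordinate of \<open>z\<close>, the weight is at most a product of weights in one
  variable with exponents \<open>a / 3\<close> and \<open>b / 3\<close>, and the hypotheses are exactly what makes these factors
  integrable over the line.\<close>

lemma integrable_weight:
  fixes a b :: real
  assumes "0 \<le> a" "a < 3" "0 \<le> b" "a + 2 * b > 3"
  shows "integrable lborel (\<lambda>z::real^3. norm z powr - a * (1 + (norm z)\<^sup>2) powr - b)"
proof -
  (* On the coordinate planes the real power of 0 would be 0 and spoil the product bound;
     the value top at 0 restores it without changing the integral. *)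
  define \<phi> :: "real \<Rightarrow> ennreal" where
    "\<phi> u = (if u = 0 then top else ennreal (\<bar>u\<bar> powr - (a / 3) * (1 + u\<^sup>2) powr - (b / 3)))" for u
  have [measurable]: "\<phi> \<in> borel_measurable borel" unfolding \<phi>_def by measurable
  have "(\<integral>\<^sup>+u. \<phi> u \<partial>lborel) = (\<integral>\<^sup>+u. ennreal (\<bar>u\<bar> powr - (a / 3) * (1 + u\<^sup>2) powr - (b / 3)) \<partial>lborel)"
    using AE_lborel_singleton[of "0::real"]
    by (intro nn_integral_cong_AE) (auto simp: \<phi>_def elim: eventually_mono)
  also have "\<dots> < \<infinity>" using assms by (intro nn_integral_weight_real_finite) auto
  finally have fin: "(\<integral>\<^sup>+u. \<phi> u \<partial>lborel) < \<infinity>" .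
  have card: "card (Basis :: (real^3) set) = 3" by simp
  have le: "ennreal (norm z powr - a * (1 + (norm z)\<^sup>2) powr - b) \<le> (\<Prod>c\<in>Basis. \<phi> (z \<bullet> c))" for z :: "real^3"
  proof (cases "\<exists>c\<in>Basis. z \<bullet> c = 0")
    case True
    have "\<phi> u \<noteq> 0" for u
    proof (cases "u = 0")
      case False
      have "1 + u\<^sup>2 > 0" by (intro add_pos_nonneg) auto
      then have "\<bar>u\<bar> powr - (a / 3) * (1 + u\<^sup>2) powr - (b / 3) > 0" using False by simp
      then show ?thesis using False by (auto simp: \<phi>_def)
    qed (auto simp: \<phi>_def)
    then have "(\<Prod>c\<in>Basis. \<phi> (z \<bullet> c)) = top"
      using True unfolding ennreal_prod_eq_top by (auto simp: \<phi>_def)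
    then show ?thesis by simp
  next
    case False
    have cube: "(y powr - (c / 3)) ^ 3 = y powr - c" for y c :: real
      by (simp add: power3_eq_cube powr_add[symmetric])
    have "norm z powr - a * (1 + (norm z)\<^sup>2) powr - b =
       (\<Prod>c\<in>(Basis::(real^3) set). norm z powr - (a/3) * (1 + (norm z)\<^sup>2) powr - (b/3))"
      by (simp add: card power_mult_distrib cube)
    also have "\<dots> \<le> (\<Prod>c\<in>Basis. \<bar>z \<bullet> c\<bar> powr - (a/3) * (1 + (z \<bullet> c)\<^sup>2) powr - (b/3))"
    proof (intro prod_mono conjI mult_mono powr_mono2')
      fix c :: "real^3" assume c: "c \<in> Basis"
      show "\<bar>z \<bullet> c\<bar> \<le> norm z" using Basis_le_norm c by blast
      then show "1 + (z \<bullet> c)\<^sup>2 \<le> 1 + (norm z)\<^sup>2" using power_mono[of "\<bar>z \<bullet> c\<bar>" "norm z" 2] by simp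
    qed (use False assms in \<open>auto intro: add_pos_nonneg\<close>)
    finally have "ennreal (norm z powr - a * (1 + (norm z)\<^sup>2) powr - b) \<le>
       ennreal (\<Prod>c\<in>Basis. \<bar>z \<bullet> c\<bar> powr - (a/3) * (1 + (z \<bullet> c)\<^sup>2) powr - (b/3))"
      by (rule ennreal_leI)
    also have "\<dots> = (\<Prod>c\<in>Basis. \<phi> (z \<bullet> c))"
      using False by (subst prod_ennreal[symmetric]) (auto simp: \<phi>_def intro!: prod.cong)
    finally show ?thesis .
  qed
  have "(\<integral>\<^sup>+z. ennreal (norm z powr - a * (1 + (norm z)\<^sup>2) powr - b) \<partial>(lborel :: (real^3) measure))
      \<le> (\<integral>\<^sup>+z. (\<Prod>c\<in>Basis. \<phi> (z \<bullet> c)) \<partial>(lborel :: (real^3) measure))"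
    by (intro nn_integral_mono le)
  also have "\<dots> = (\<Prod>c\<in>(Basis :: (real^3) set). \<integral>\<^sup>+u. \<phi> u \<partial>lborel)"
    by (rule nn_integral_lborel_prod) auto
  also have "\<dots> < \<infinity>" using fin by (simp add: power_less_top_ennreal)
  finally show ?thesis
    by (intro integrableI_bounded) (auto simp: abs_mult)
qed

lemma
  fixes g :: "real^3 \<Rightarrow> real"
  assumes "\<epsilon> > 0" and g: "integrable lborel g" and g0: "\<And>z. 0 \<le> g z"
  shows integrable_scaled: "integrable lborel (\<lambda>z. g ((x - z) /\<^sub>R \<epsilon>))" 
    and integral_scaled: "(\<integral>z. g ((x - z) /\<^sub>R \<epsilon>) \<partial>lborel) = \<epsilon> ^ 3 * (\<integral>z. g z \<partial>lborel)"
proof -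
  have [measurable]: "g \<in> borel_measurable borel" using g by auto
  have "(\<integral>\<^sup>+z. ennreal (g ((x - z) /\<^sub>R \<epsilon>)) \<partial>lborel) = 
     (\<integral>\<^sup>+z. ennreal (g ((x - z) /\<^sub>R \<epsilon>)) \<partial>density (distr lborel borel (\<lambda>z. x + (-\<epsilon>) *\<^sub>R z)) (\<lambda>_. \<bar>-\<epsilon>\<bar>^DIM(real^3)))"
    using assms by (subst lborel_affine[of "-\<epsilon>" x]) auto
  also have "\<dots> = ennreal (\<epsilon> ^ 3) * (\<integral>\<^sup>+z. ennreal (g z) \<partial>lborel)"
    using assms by (subst nn_integral_density) (auto simp: nn_integral_distr nn_integral_cmult ennreal_power)
  also have "\<dots> = ennreal (\<epsilon> ^ 3 * (\<integral>z. g z \<partial>lborel))"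
    using assms by (subst nn_integral_eq_integral[OF g]) (auto simp: ennreal_mult' intro!: integral_nonneg_AE)
  finally have eq: "(\<integral>\<^sup>+z. ennreal (g ((x - z) /\<^sub>R \<epsilon>)) \<partial>lborel) = ennreal (\<epsilon> ^ 3 * (\<integral>z. g z \<partial>lborel))" .
  have nn: "0 \<le> \<epsilon> ^ 3 * (\<integral>z. g z \<partial>lborel)" using assms by (auto intro!: mult_nonneg_nonneg integral_nonneg_AE)
  show "integrable lborel (\<lambda>z. g ((x - z) /\<^sub>R \<epsilon>))"
    using eq g0 by (intro integrableI_bounded) auto
  show "(\<integral>z. g ((x - z) /\<^sub>R \<epsilon>) \<partial>lborel) = \<epsilon> ^ 3 * (\<integral>z. g z \<partial>lborel)"
    using eq nn g0 by (subst integral_eq_nn_integral) auto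
qed

lemma integrable_bessel_weight:
  assumes "b > 3 / 2"
  shows "integrable lborel (\<lambda>z::real^3. (1 + (norm z)\<^sup>2) powr - b)"
proof -
  have "integrable lborel (\<lambda>z::real^3. norm z powr - 0 * (1 + (norm z)\<^sup>2) powr - b)"
    using assms by (intro integrable_weight) auto
  moreover have "AE z in lborel. norm z powr - 0 * (1 + (norm z)\<^sup>2) powr - b = (1 + (norm (z::real^3))\<^sup>2) powr - b"
    using AE_lborel_singleton[of "0::real^3"] by (auto elim: eventually_mono)
  ultimately show ?thesis by (subst (asm) integrable_cong_AE) auto
qed

section \<open>The softened Coulomb kernel\<close>

definition soft_norm :: "real \<Rightarrow> real^3 \<Rightarrow> real" where
  "soft_norm \<epsilon> z = sqrt ((norm z)\<^sup>2 + \<epsilon>\<^sup>2)"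

text \<open>For \<open>\<epsilon> = 0\<close> this is the Coulomb kernel, with the value \<open>0\<close> at the origin.\<close>

definition soft_kernel :: "real \<Rightarrow> real^3 \<Rightarrow> real^3" where
  "soft_kernel \<epsilon> z = z /\<^sub>R soft_norm \<epsilon> z ^ 3"

definition soft_kernel_deriv :: "real \<Rightarrow> real^3 \<Rightarrow> real^3 \<Rightarrow> real^3" where
  "soft_kernel_deriv \<epsilon> z h = h /\<^sub>R soft_norm \<epsilon> z ^ 3 - (3 * (z \<bullet> h) / soft_norm \<epsilon> z ^ 5) *\<^sub>R z"

definition weight :: "real \<Rightarrow> real \<Rightarrow> real^3 \<Rightarrow> real" where
  "weight a b z = norm z powr - a * (1 + (norm z)\<^sup>2) powr - b"

lemma weight_nonneg [simp]: "0 \<le> weight a b z" by (simp add: weight_def)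

lemma soft_norm_0 [simp]: "soft_norm 0 z = norm z" by (simp add: soft_norm_def)

lemma norm_le_soft_norm: "norm z \<le> soft_norm \<epsilon> z"
  by (auto simp: soft_norm_def intro: real_le_rsqrt)

lemma abs_le_soft_norm: "\<bar>\<epsilon>\<bar> \<le> soft_norm \<epsilon> z"
  by (auto simp: soft_norm_def intro: real_le_rsqrt)

lemma soft_norm_pos: "\<epsilon> \<noteq> 0 \<Longrightarrow> 0 < soft_norm \<epsilon> z"
  using abs_le_soft_norm[of \<epsilon> z] by auto

lemma soft_norm_sq: "soft_norm \<epsilon> z ^ 2 = (norm z)\<^sup>2 + \<epsilon>\<^sup>2"
  by (simp add: soft_norm_def)

lemma soft_norm_nonneg [simp]: "0 \<le> soft_norm \<epsilon> z"
  by (simp add: soft_norm_def)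

lemma soft_norm_measurable [measurable]: "soft_norm \<epsilon> \<in> borel_measurable borel"
  unfolding soft_norm_def[abs_def] by measurable

lemma soft_kernel_measurable [measurable]: "soft_kernel \<epsilon> \<in> borel_measurable borel"
  unfolding soft_kernel_def[abs_def] by measurable

lemma soft_kernel_deriv_measurable [measurable]: "(\<lambda>z. soft_kernel_deriv \<epsilon> z h) \<in> borel_measurable borel"
  unfolding soft_kernel_deriv_def[abs_def] by measurable

lemma norm_soft_kernel_le: "norm (soft_kernel \<epsilon> z) \<le> norm z powr - 2"
proof (cases "z = 0")
  case False
  have "norm z / soft_norm \<epsilon> z ^ 3 \<le> norm z / norm z ^ 3"
    using False norm_le_soft_norm[of z \<epsilon>] order_less_le_trans[of 0 "norm z" "soft_norm \<epsilon> z"]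
    by (intro divide_left_mono power_mono mult_pos_pos) auto
  also have "\<dots> = norm z powr - 2"
    using False by (simp add: powr_minus powr_numeral power3_eq_cube power2_eq_square field_simps)
  finally show ?thesis by (simp add: soft_kernel_def divide_inverse mult.commute)
qed (simp add: soft_kernel_def)

text \<open>The bound is \<open>\<epsilon>\<close> to the power \<open>-2\<close> times a fixed integrable function of \<open>z / \<epsilon>\<close>, so its integral over
  space is proportional to \<open>\<epsilon>\<close>: softening the kernel moves the field of a bounded density by \<open>O(\<epsilon>)\<close>.
  It rests on \<open>1 - u\<^sup>3 \<le> 1 - u\<^sup>4 \<le> 2 (1 - u\<^sup>2)\<close> for \<open>u = norm z / soft_norm \<epsilon> z\<close>.\<close>

lemma norm_soft_kernel_diff_le:
  assumes "\<epsilon> > 0"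
  shows "norm (soft_kernel \<epsilon> z - soft_kernel 0 z) \<le> 2 / \<epsilon>\<^sup>2 * weight 2 1 (z /\<^sub>R \<epsilon>)"
proof (cases "z = 0")
  case False
  define r s where "r = norm z" and "s = soft_norm \<epsilon> z"
  have r: "r > 0" and s: "s > 0" and rs: "r \<le> s" and s2: "s\<^sup>2 = r\<^sup>2 + \<epsilon>\<^sup>2"
    using False assms norm_le_soft_norm[of z \<epsilon>] soft_norm_pos[of \<epsilon> z] soft_norm_sq[of \<epsilon> z] by (auto simp: r_def s_def)
  have "soft_kernel \<epsilon> z - soft_kernel 0 z = (1 / s ^ 3 - 1 / r ^ 3) *\<^sub>R z"
    by (simp add: soft_kernel_def r_def s_def scaleR_diff_left inverse_eq_divide)
  then have "norm (soft_kernel \<epsilon> z - soft_kernel 0 z) = \<bar>1 / s ^ 3 - 1 / r ^ 3\<bar> * r"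
    by (simp add: r_def)
  also have "\<dots> = (1 / r ^ 3 - 1 / s ^ 3) * r"
    using r s rs by (subst abs_of_nonpos) (auto intro!: divide_left_mono power_mono)
  also have "\<dots> = (1 - (r / s) ^ 3) / r\<^sup>2"
    using r s by (simp add: field_simps power_divide power2_eq_square power3_eq_cube)
  also have "\<dots> \<le> (1 - (r / s) ^ 4) / r\<^sup>2"
    using r s rs by (intro divide_right_mono diff_left_mono power_decreasing) auto
  also have "1 - (r / s) ^ 4 = (1 + (r / s)\<^sup>2) * (1 - (r / s)\<^sup>2)"
    by (simp add: algebra_simps power2_eq_square power4_eq_xxxx)
  also have "\<dots> \<le> 2 * (1 - (r / s)\<^sup>2)"
    using r s rs by (intro mult_right_mono) (auto simp: power_le_one)
  also have "1 - (r / s)\<^sup>2 = \<epsilon>\<^sup>2 / s\<^sup>2"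
    using s r s2 by (simp add: power_divide eq_divide_eq left_diff_distrib)
  also have "2 * (\<epsilon>\<^sup>2 / s\<^sup>2) / r\<^sup>2 = 2 / \<epsilon>\<^sup>2 * (\<epsilon>\<^sup>2 / r\<^sup>2 * (\<epsilon>\<^sup>2 / s\<^sup>2))"
    using assms r s by (simp add: field_simps power2_eq_square)
  also have "\<epsilon>\<^sup>2 / s\<^sup>2 = 1 / (1 + (r / \<epsilon>)\<^sup>2)"
    unfolding s2 using assms r by (simp add: field_simps power_divide)
  also have "\<epsilon>\<^sup>2 / r\<^sup>2 * (1 / (1 + (r / \<epsilon>)\<^sup>2)) = weight 2 1 (z /\<^sub>R \<epsilon>)"
  proof -
    have pos: "1 + (r / \<epsilon>)\<^sup>2 > 0" by (intro add_pos_nonneg) auto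
    have n: "norm (z /\<^sub>R \<epsilon>) = r / \<epsilon>" using assms by (simp add: r_def divide_inverse mult.commute)
    have p2: "(r / \<epsilon>) powr - 2 = \<epsilon>\<^sup>2 / r\<^sup>2"
      using r assms by (simp add: powr_minus powr_numeral power_divide)
    have p1: "(1 + (r / \<epsilon>)\<^sup>2) powr - 1 = 1 / (1 + (r / \<epsilon>)\<^sup>2)"
      using pos by (simp add: powr_minus_divide)
    show ?thesis unfolding weight_def n p1 p2 by simp
  qed
  finally show ?thesis by (simp add: divide_right_mono)
qed (simp add: soft_kernel_def)

lemma norm_soft_kernel_deriv_le:
  assumes "\<epsilon> > 0"
  shows "norm (soft_kernel_deriv \<epsilon> z h) \<le> 4 / soft_norm \<epsilon> z ^ 3 * norm h"
proof -
  define s where "s = soft_norm \<epsilon> z"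
  have s: "s > 0" "norm z \<le> s" using assms soft_norm_pos norm_le_soft_norm by (auto simp: s_def)
  have "norm (soft_kernel_deriv \<epsilon> z h) \<le> norm (h /\<^sub>R s ^ 3) + norm ((3 * (z \<bullet> h) / s ^ 5) *\<^sub>R z)"
    unfolding soft_kernel_deriv_def s_def by (rule norm_triangle_ineq4)
  also have "norm ((3 * (z \<bullet> h) / s ^ 5) *\<^sub>R z) = 3 / s ^ 5 * (\<bar>z \<bullet> h\<bar> * norm z)"
    using s by (simp add: abs_mult)
  also have "\<dots> \<le> 3 / s ^ 5 * ((s * norm h) * s)"
    using s by (intro mult_left_mono mult_mono order_trans[OF Cauchy_Schwarz_ineq2]) auto
  also have "\<dots> = 3 / s ^ 3 * norm h" using s by (simp add: field_simps eval_nat_numeral)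
  also have "norm (h /\<^sub>R s ^ 3) = 1 / s ^ 3 * norm h" using s by (simp add: field_simps)
  also have "1 / s ^ 3 * norm h + 3 / s ^ 3 * norm h = 4 / s ^ 3 * norm h" by (simp add: field_simps)
  finally show ?thesis by (simp add: s_def)
qed

lemma has_derivative_soft_norm:
  assumes "\<epsilon> > 0"
  shows "(soft_norm \<epsilon> has_derivative (\<lambda>h. (z \<bullet> h) / soft_norm \<epsilon> z)) (at z)"
proof -
  have pos: "z \<bullet> z + \<epsilon>\<^sup>2 > 0" using assms by (simp add: add_nonneg_pos)
  have eq: "soft_norm \<epsilon> = (\<lambda>z. sqrt (z \<bullet> z + \<epsilon>\<^sup>2))" by (auto simp: soft_norm_def power2_norm_eq_inner)
  show ?thesis unfolding eq
    by (rule derivative_eq_intros refl pos)+ (simp add: fun_eq_iff inner_commute field_simps)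
qed

lemma has_derivative_soft_kernel:
  assumes "\<epsilon> > 0"
  shows "(soft_kernel \<epsilon> has_derivative soft_kernel_deriv \<epsilon> z) (at z)"
proof -
  have s: "soft_norm \<epsilon> z > 0" using assms by (simp add: soft_norm_pos)
  have n0: "soft_norm \<epsilon> z ^ 3 \<noteq> 0" using s by simp
  note cube_deriv = has_derivative_power[OF has_derivative_soft_norm[OF assms, of z], of 3]
  note kernel_deriv = has_derivative_scaleR[OF Deriv.has_derivative_inverse[OF n0 cube_deriv] has_derivative_ident]
  have "(\<lambda>h. inverse (soft_norm \<epsilon> z ^ 3) *\<^sub>R h
        + (- (inverse (soft_norm \<epsilon> z ^ 3) * (of_nat 3 * (z \<bullet> h / soft_norm \<epsilon> z) * soft_norm \<epsilon> z ^ (3 - 1)) * inverse (soft_norm \<epsilon> z ^ 3))) *\<^sub>R z) = soft_kernel_deriv \<epsilon> z"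
  proof
    fix h
    have "inverse (soft_norm \<epsilon> z ^ 3) * (of_nat 3 * (z \<bullet> h / soft_norm \<epsilon> z) * soft_norm \<epsilon> z ^ (3 - 1)) * inverse (soft_norm \<epsilon> z ^ 3)
       = 3 * (z \<bullet> h) / soft_norm \<epsilon> z ^ 5"
      using s by (simp add: field_simps eval_nat_numeral)
    then show "inverse (soft_norm \<epsilon> z ^ 3) *\<^sub>R h
        + (- (inverse (soft_norm \<epsilon> z ^ 3) * (of_nat 3 * (z \<bullet> h / soft_norm \<epsilon> z) * soft_norm \<epsilon> z ^ (3 - 1)) * inverse (soft_norm \<epsilon> z ^ 3))) *\<^sub>R z = soft_kernel_deriv \<epsilon> z h"
      by (simp only: soft_kernel_deriv_def scaleR_minus_left add_uminus_conv_diff)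
  qed
  then show ?thesis
    using kernel_deriv unfolding soft_kernel_def[abs_def] by (rule has_derivative_eq_rhs[rotated])
qed

lemma linear_soft_kernel_deriv: "linear (soft_kernel_deriv \<epsilon> z)"
  unfolding soft_kernel_deriv_def
  by (auto intro!: linearI simp: algebra_simps inner_right_distrib add_divide_distrib)

lemma soft_kernel_lipschitz:
  assumes "\<epsilon> > 0"
  shows "norm (soft_kernel \<epsilon> z - soft_kernel \<epsilon> z') \<le> 4 / \<epsilon> ^ 3 * norm (z - z')"
proof (rule differentiable_bound[where S=UNIV and f'="soft_kernel_deriv \<epsilon>"])
  fix x :: "real^3"
  have "4 / soft_norm \<epsilon> x ^ 3 \<le> 4 / \<epsilon> ^ 3"
    using abs_le_soft_norm[of \<epsilon> x] assms soft_norm_pos[of \<epsilon> x]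
    by (intro divide_left_mono power_mono mult_pos_pos) auto
  then have "norm (soft_kernel_deriv \<epsilon> x h) \<le> 4 / \<epsilon> ^ 3 * norm h" for h
    using norm_soft_kernel_deriv_le[OF assms, of x h] by (meson mult_right_mono norm_ge_zero order_trans)
  then show "onorm (soft_kernel_deriv \<epsilon> x) \<le> 4 / \<epsilon> ^ 3" using assms by (intro onorm_bound) auto
qed (auto intro: has_derivative_soft_kernel assms)

text \<open>The divergence of the kernel is a multiple of an approximate identity, which is the softened form
  of \<open>div E = 4 \<pi> \<rho>\<close>.\<close>

lemma trace_soft_kernel_deriv:
  assumes "\<epsilon> > 0"
  shows "(\<Sum>i\<in>UNIV. soft_kernel_deriv \<epsilon> z (axis i 1) $ i) = 3 * \<epsilon>\<^sup>2 / soft_norm \<epsilon> z ^ 5"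
proof -
  define s where "s = soft_norm \<epsilon> z"
  have s: "s > 0" using assms by (simp add: s_def soft_norm_pos)
  have "(\<Sum>i\<in>UNIV. soft_kernel_deriv \<epsilon> z (axis i 1) $ i) = 3 / s ^ 3 - 3 * (\<Sum>i\<in>UNIV. (z $ i)\<^sup>2) / s ^ 5"
    by (simp add: soft_kernel_deriv_def s_def[symmetric] inner_axis sum_3 algebra_simps power2_eq_square divide_inverse)
  also have "(\<Sum>i\<in>UNIV. (z $ i)\<^sup>2) = s\<^sup>2 - \<epsilon>\<^sup>2"
    using soft_norm_sq[of \<epsilon> z] by (simp add: s_def norm_vec_def L2_set_def sum_nonneg)
  finally show ?thesis using s by (simp add: s_def[symmetric] field_simps eval_nat_numeral)
qed

section \<open>The softened field of a decaying density\<close>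

definition soft_field :: "real \<Rightarrow> (real^3 \<Rightarrow> real) \<Rightarrow> real^3 \<Rightarrow> real^3" where
  "soft_field \<epsilon> r x = (\<integral>y. r y *\<^sub>R soft_kernel \<epsilon> (x - y) \<partial>lborel)"

definition soft_field_deriv :: "real \<Rightarrow> (real^3 \<Rightarrow> real) \<Rightarrow> real^3 \<Rightarrow> real^3 \<Rightarrow> real^3" where
  "soft_field_deriv \<epsilon> r x h = (\<integral>y. r y *\<^sub>R soft_kernel_deriv \<epsilon> (x - y) h \<partial>lborel)"

definition weight_mass :: "real \<Rightarrow> real \<Rightarrow> real" where
  "weight_mass a b = (\<integral>z. weight a b z \<partial>lborel)"

definition bessel_mass :: "real \<Rightarrow> real" where
  "bessel_mass p = (\<integral>y. R y powr - p \<partial>lborel)"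

lemma R_ge_1: "1 \<le> R x" by (simp add: R_def)

lemma R_pos [simp]: "0 < R x" using R_ge_1[of x] by linarith

lemma R_neq_0 [simp]: "R x \<noteq> 0"
  using R_pos[of x] by linarith

lemma R_powr: "R y powr a = (1 + (norm y)\<^sup>2) powr (a / 2)"
  by (simp add: R_def powr_half_sqrt[symmetric] powr_powr add_nonneg_nonneg)

lemma R_measurable [measurable]: "R \<in> borel_measurable borel"
  unfolding R_def[abs_def] by measurable

lemma integrable_R_powr: "p > 3 \<Longrightarrow> integrable lborel (\<lambda>y. R y powr - p)"
  using integrable_bessel_weight[of "p/2"] by (simp add: R_powr)

lemma integrable_weight': "\<lbrakk>0 \<le> a; a < 3; 0 \<le> b; a + 2 * b > 3\<rbrakk> \<Longrightarrow> integrable lborel (weight a b)"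
  using integrable_weight[of a b] by (simp add: weight_def[abs_def])

lemma weight_mass_nonneg [simp]: "0 \<le> weight_mass a b"
  unfolding weight_mass_def by (intro integral_nonneg_AE) auto

lemma bessel_mass_nonneg [simp]: "0 \<le> bessel_mass a"
  unfolding bessel_mass_def by (intro integral_nonneg_AE) auto

lemma integrable_weight_shift:
  assumes "\<epsilon> > 0" "0 \<le> a" "a < 3" "0 \<le> b" "a + 2 * b > 3"
  shows "integrable lborel (\<lambda>y. weight a b ((x - y) /\<^sub>R \<epsilon>))"
    and "(\<integral>y. weight a b ((x - y) /\<^sub>R \<epsilon>) \<partial>lborel) = \<epsilon> ^ 3 * weight_mass a b"
  using integrable_scaled[of \<epsilon> "weight a b" x] integral_scaled[of \<epsilon> "weight a b" x] integrable_weight' assms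
  by (auto simp: weight_mass_def)

locale decaying_density =
  fixes r :: "real^3 \<Rightarrow> real" and S p :: real
  assumes r_measurable [measurable]: "r \<in> borel_measurable borel"
    and r_le: "\<bar>r y\<bar> \<le> S * R y powr - p"
    and p_gt_3: "p > 3"
begin

lemma S_nonneg: "0 \<le> S"
proof -
  have "0 \<le> S * R 0 powr - p" using r_le[of 0] by linarith
  then show ?thesis by (simp add: zero_le_mult_iff)
qed

lemma r_le_S: "\<bar>r y\<bar> \<le> S"
proof -
  have "R y powr - p \<le> R y powr 0" using R_ge_1[of y] p_gt_3 by (intro powr_mono) auto
  then have "S * R y powr - p \<le> S * 1" using S_nonneg by (intro mult_left_mono) auto
  then show ?thesis using r_le[of y] by simp
qed

lemma integrable_r: "integrable lborel r"
  by (rule Bochner_Integration.integrable_bound[of _ "\<lambda>y. S * R y powr - p"])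
     (use r_le integrable_R_powr p_gt_3 S_nonneg in \<open>auto simp: abs_mult\<close>)

lemma integral_abs_r_le: "(\<integral>y. \<bar>r y\<bar> \<partial>lborel) \<le> S * bessel_mass p"
proof -
  have "(\<integral>y. \<bar>r y\<bar> \<partial>lborel) \<le> (\<integral>y. S * R y powr - p \<partial>lborel)"
    using integrable_r integrable_R_powr[OF p_gt_3] r_le by (intro integral_mono) auto
  then show ?thesis by (simp add: bessel_mass_def)
qed

lemma
  shows integrable_soft_field: "integrable lborel (\<lambda>y. r y *\<^sub>R soft_kernel \<epsilon> (x - y))"
    and norm_soft_field_le: "norm (soft_field \<epsilon> r x) \<le> S * (2 * weight_mass 2 1 + bessel_mass p)"
proof -
  let ?g = "\<lambda>y. 2 * S * weight 2 1 ((x - y) /\<^sub>R 1) + \<bar>r y\<bar>"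
  have le: "norm (r y *\<^sub>R soft_kernel \<epsilon> (x - y)) \<le> ?g y" for y
  proof (cases "norm (x - y) \<le> 1")
    case True
    have "norm (x - y) powr - 2 \<le> 2 * weight 2 1 (x - y)"
    proof -
      have "(norm (x - y))\<^sup>2 \<le> 1" using True by (simp add: power_le_one)
      moreover have "0 < 1 + (norm (x - y))\<^sup>2" by (intro add_pos_nonneg) auto
      ultimately have "2 * (1 + (norm (x - y))\<^sup>2) powr - 1 \<ge> 1" by (simp add: powr_minus_divide)
      then have "norm (x - y) powr - 2 * 1 \<le> norm (x - y) powr - 2 * (2 * (1 + (norm (x - y))\<^sup>2) powr - 1)"
        by (intro mult_left_mono) auto
      then show ?thesis unfolding weight_def by (simp only: mult_1_right mult.left_commute)
    qed
    then have "norm (soft_kernel \<epsilon> (x - y)) \<le> 2 * weight 2 1 (x - y)"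
      using norm_soft_kernel_le order_trans by blast
    then have "\<bar>r y\<bar> * norm (soft_kernel \<epsilon> (x - y)) \<le> S * (2 * weight 2 1 (x - y))"
      using r_le_S S_nonneg by (intro mult_mono) auto
    then show ?thesis by (simp add: mult_ac)
  next
    case False
    have "norm (x - y) powr - 2 \<le> norm (x - y) powr 0" using False by (intro powr_mono) auto
    also have "norm (x - y) powr 0 \<le> 1" by simp
    finally have "norm (soft_kernel \<epsilon> (x - y)) \<le> 1"
      using norm_soft_kernel_le[of \<epsilon> "x - y"] by linarith
    then have "\<bar>r y\<bar> * norm (soft_kernel \<epsilon> (x - y)) \<le> \<bar>r y\<bar>"
      by (intro mult_left_le) auto
    then show ?thesis using S_nonneg by (simp add: add_increasing)
  qed
  have w: "integrable lborel (\<lambda>y. weight 2 1 ((x - y) /\<^sub>R 1))"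
      "(\<integral>y. weight 2 1 ((x - y) /\<^sub>R 1) \<partial>lborel) = weight_mass 2 1"
    using integrable_weight_shift[of 1 2 1 x] by auto
  have g: "integrable lborel ?g" using w integrable_r by auto
  show int: "integrable lborel (\<lambda>y. r y *\<^sub>R soft_kernel \<epsilon> (x - y))"
    by (rule Bochner_Integration.integrable_bound[OF g]) (use le in \<open>auto intro: order_trans abs_ge_self\<close>)
  have "norm (soft_field \<epsilon> r x) \<le> (\<integral>y. ?g y \<partial>lborel)"
    unfolding soft_field_def by (rule Bochner_Integration.integral_norm_bound_integral[OF int g]) (use le in auto)
  also have "\<dots> = 2 * S * weight_mass 2 1 + (\<integral>y. \<bar>r y\<bar> \<partial>lborel)"
    using w integrable_r by (subst Bochner_Integration.integral_add) auto
  also have "\<dots> \<le> S * (2 * weight_mass 2 1 + bessel_mass p)"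
    using integral_abs_r_le by (simp add: algebra_simps)
  finally show "norm (soft_field \<epsilon> r x) \<le> S * (2 * weight_mass 2 1 + bessel_mass p)" .
qed

lemma norm_soft_field_diff_le:
  assumes "\<epsilon> > 0"
  shows "norm (soft_field \<epsilon> r x - soft_field 0 r x) \<le> 2 * S * weight_mass 2 1 * \<epsilon>"
proof -
  let ?g = "\<lambda>y. S * (2 / \<epsilon>\<^sup>2) * weight 2 1 ((x - y) /\<^sub>R \<epsilon>)"
  have w: "integrable lborel (\<lambda>y. weight 2 1 ((x - y) /\<^sub>R \<epsilon>))"
      "(\<integral>y. weight 2 1 ((x - y) /\<^sub>R \<epsilon>) \<partial>lborel) = \<epsilon> ^ 3 * weight_mass 2 1"
    using integrable_weight_shift[of \<epsilon> 2 1 x] assms by auto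
  have "soft_field \<epsilon> r x - soft_field 0 r x
      = (\<integral>y. r y *\<^sub>R soft_kernel \<epsilon> (x - y) - r y *\<^sub>R soft_kernel 0 (x - y) \<partial>lborel)"
    unfolding soft_field_def by (intro Bochner_Integration.integral_diff[symmetric] integrable_soft_field)
  also have "norm \<dots> \<le> (\<integral>y. ?g y \<partial>lborel)"
  proof (rule Bochner_Integration.integral_norm_bound_integral)
    fix y :: "real^3"
    have "\<bar>r y\<bar> * norm (soft_kernel \<epsilon> (x - y) - soft_kernel 0 (x - y)) \<le> S * (2 / \<epsilon>\<^sup>2 * weight 2 1 ((x - y) /\<^sub>R \<epsilon>))"
      using assms r_le_S S_nonneg by (intro mult_mono norm_soft_kernel_diff_le) auto
    then show "norm (r y *\<^sub>R soft_kernel \<epsilon> (x - y) - r y *\<^sub>R soft_kernel 0 (x - y)) \<le> ?g y"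
      by (simp add: scaleR_diff_right[symmetric] mult.assoc)
  qed (use w in \<open>auto intro!: Bochner_Integration.integrable_diff integrable_soft_field\<close>)
  also have "\<dots> = 2 * S * weight_mass 2 1 * \<epsilon>"
    using w assms by (simp add: field_simps eval_nat_numeral)
  finally show ?thesis .
qed

lemma integrable_soft_field_deriv:
  assumes "\<epsilon> > 0"
  shows "integrable lborel (\<lambda>y. \<bar>r y\<bar> / soft_norm \<epsilon> (x - y) ^ 3)"
    and "integrable lborel (\<lambda>y. r y *\<^sub>R soft_kernel_deriv \<epsilon> (x - y) h)"
proof -
  show int: "integrable lborel (\<lambda>y. \<bar>r y\<bar> / soft_norm \<epsilon> (x - y) ^ 3)"
  proof (rule Bochner_Integration.integrable_bound[of _ "\<lambda>y. r y * (1 / \<epsilon> ^ 3)"])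
    have "1 / soft_norm \<epsilon> z ^ 3 \<le> 1 / \<epsilon> ^ 3" for z
      using abs_le_soft_norm[of \<epsilon> z] assms soft_norm_pos[of \<epsilon> z]
      by (intro divide_left_mono power_mono mult_pos_pos) auto
    then have "\<bar>r y\<bar> * (1 / soft_norm \<epsilon> (x - y) ^ 3) \<le> \<bar>r y\<bar> * (1 / \<epsilon> ^ 3)" for y
      by (intro mult_left_mono) auto
    then show "AE y in lborel. norm (\<bar>r y\<bar> / soft_norm \<epsilon> (x - y) ^ 3) \<le> norm (r y * (1 / \<epsilon> ^ 3))"
      using assms by (auto simp: abs_mult)
  qed (use integrable_r in auto)
  show "integrable lborel (\<lambda>y. r y *\<^sub>R soft_kernel_deriv \<epsilon> (x - y) h)"
  proof (rule Bochner_Integration.integrable_bound[OF integrable_mult_left[OF int, of "4 * norm h"]])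
    have "\<bar>r y\<bar> * norm (soft_kernel_deriv \<epsilon> (x - y) h) \<le> \<bar>r y\<bar> * (4 / soft_norm \<epsilon> (x - y) ^ 3 * norm h)" for y
      by (intro mult_left_mono norm_soft_kernel_deriv_le assms) auto
    then show "AE y in lborel. norm (r y *\<^sub>R soft_kernel_deriv \<epsilon> (x - y) h)
        \<le> norm (\<bar>r y\<bar> / soft_norm \<epsilon> (x - y) ^ 3 * (4 * norm h))"
      by (auto simp: abs_mult mult_ac)
  qed auto
qed

lemma norm_soft_field_deriv_le:
  assumes "\<epsilon> > 0"
  shows "norm (soft_field_deriv \<epsilon> r x h) \<le> 4 * (\<integral>y. \<bar>r y\<bar> / soft_norm \<epsilon> (x - y) ^ 3 \<partial>lborel) * norm h"
proof -
  have "norm (soft_field_deriv \<epsilon> r x h) \<le> (\<integral>y. (\<bar>r y\<bar> / soft_norm \<epsilon> (x - y) ^ 3) * (4 * norm h) \<partial>lborel)"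
    unfolding soft_field_deriv_def
  proof (rule Bochner_Integration.integral_norm_bound_integral[OF integrable_soft_field_deriv(2)[OF assms]
        integrable_mult_left[OF integrable_soft_field_deriv(1)[OF assms]]])
    have "\<bar>r y\<bar> * norm (soft_kernel_deriv \<epsilon> (x - y) h) \<le> \<bar>r y\<bar> * (4 / soft_norm \<epsilon> (x - y) ^ 3 * norm h)" for y
      by (intro mult_left_mono norm_soft_kernel_deriv_le assms) auto
    then show "norm (r y *\<^sub>R soft_kernel_deriv \<epsilon> (x - y) h)
        \<le> \<bar>r y\<bar> / soft_norm \<epsilon> (x - y) ^ 3 * (4 * norm h)" for y
      by (auto simp: abs_mult mult_ac)
  qed
  also have "\<dots> = (\<integral>y. \<bar>r y\<bar> / soft_norm \<epsilon> (x - y) ^ 3 \<partial>lborel) * (4 * norm h)"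
    by (rule integral_mult_left_zero)
  finally show ?thesis by (simp add: mult_ac)
qed

lemma linear_soft_field_deriv:
  assumes "\<epsilon> > 0"
  shows "linear (soft_field_deriv \<epsilon> r x)"
proof (rule linearI)
  note int = integrable_soft_field_deriv(2)[OF assms]
  show "soft_field_deriv \<epsilon> r x (h + k) = soft_field_deriv \<epsilon> r x h + soft_field_deriv \<epsilon> r x k" for h k
    unfolding soft_field_deriv_def
    by (simp add: linear_add[OF linear_soft_kernel_deriv] scaleR_add_right Bochner_Integration.integral_add[OF int int])
  show "soft_field_deriv \<epsilon> r x (c *\<^sub>R h) = c *\<^sub>R soft_field_deriv \<epsilon> r x h" for c h
    unfolding soft_field_deriv_def integral_scaleR_right[symmetric]
    by (simp add: linear_scale[OF linear_soft_kernel_deriv] mult.commute)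
qed

text \<open>Differentiation under the integral sign; the difference quotients of the kernel are dominated by
  its Lipschitz constant.\<close>

lemma has_derivative_soft_field:
  assumes "\<epsilon> > 0"
  shows "(soft_field \<epsilon> r has_derivative soft_field_deriv \<epsilon> r x) (at x)"
  unfolding has_derivative_at2
proof
  have lin: "linear (soft_field_deriv \<epsilon> r x)" by (rule linear_soft_field_deriv[OF assms])
  then show "bounded_linear (soft_field_deriv \<epsilon> r x)" by (simp add: linear_conv_bounded_linear)
  let ?q = "\<lambda>z y. (1 / norm (z - x)) *\<^sub>R (r y *\<^sub>R soft_kernel \<epsilon> (z - y)
     - (r y *\<^sub>R soft_kernel \<epsilon> (x - y) + r y *\<^sub>R soft_kernel_deriv \<epsilon> (x - y) (z - x)))"
  have eq: "(1 / norm (z - x)) *\<^sub>R (soft_field \<epsilon> r z - (soft_field \<epsilon> r x + soft_field_deriv \<epsilon> r x (z - x)))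
      = (\<integral>y. ?q z y \<partial>lborel)" for z
    unfolding soft_field_def soft_field_deriv_def
    using integrable_soft_field integrable_soft_field_deriv(2)[OF assms]
    by (simp add: Bochner_Integration.integral_diff Bochner_Integration.integral_add)
  show "((\<lambda>z. (1 / norm (z - x)) *\<^sub>R (soft_field \<epsilon> r z - (soft_field \<epsilon> r x + soft_field_deriv \<epsilon> r x (z - x)))) \<longlongrightarrow> 0) (at x)"
    unfolding eq tendsto_at_iff_sequentially comp_def
  proof (intro allI impI)
    fix Z :: "nat \<Rightarrow> real^3" assume Z: "\<forall>i. Z i \<in> UNIV - {x}" "Z \<longlonglongrightarrow> x"
    have "(\<lambda>i. \<integral>y. ?q (Z i) y \<partial>lborel) \<longlonglongrightarrow> (\<integral>y. (0::real^3) \<partial>(lborel :: (real^3) measure))"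
    proof (rule integral_dominated_convergence[where w="\<lambda>y. 8 / \<epsilon> ^ 3 * \<bar>r y\<bar>"])
      show "integrable lborel (\<lambda>y. 8 / \<epsilon> ^ 3 * \<bar>r y\<bar>)" using integrable_r by auto
      show "AE y in lborel. (\<lambda>i. ?q (Z i) y) \<longlonglongrightarrow> 0"
      proof (rule AE_I2)
        fix y :: "real^3"
        have "((\<lambda>z. z - y) has_derivative (\<lambda>h. h)) (at x)"
          by (auto intro!: derivative_eq_intros)
        then have "((\<lambda>z. soft_kernel \<epsilon> (z - y)) has_derivative soft_kernel_deriv \<epsilon> (x - y)) (at x)"
          using has_derivative_compose[of "\<lambda>z. z - y" "\<lambda>h. h" x UNIV "soft_kernel \<epsilon>" "soft_kernel_deriv \<epsilon> (x - y)"]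
            has_derivative_soft_kernel[OF assms, of "x - y"]
          by auto
        then have "((\<lambda>z. (1 / norm (z - x)) *\<^sub>R (soft_kernel \<epsilon> (z - y)
           - (soft_kernel \<epsilon> (x - y) + soft_kernel_deriv \<epsilon> (x - y) (z - x)))) \<longlongrightarrow> 0) (at x)"
          unfolding has_derivative_at2 by blast
        then have "(\<lambda>i. (1 / norm (Z i - x)) *\<^sub>R (soft_kernel \<epsilon> (Z i - y)
           - (soft_kernel \<epsilon> (x - y) + soft_kernel_deriv \<epsilon> (x - y) (Z i - x)))) \<longlonglongrightarrow> 0"
          using Z unfolding tendsto_at_iff_sequentially comp_def by blast
        then have "(\<lambda>i. r y *\<^sub>R ((1 / norm (Z i - x)) *\<^sub>R (soft_kernel \<epsilon> (Z i - y)
           - (soft_kernel \<epsilon> (x - y) + soft_kernel_deriv \<epsilon> (x - y) (Z i - x))))) \<longlonglongrightarrow> r y *\<^sub>R 0"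
          by (intro tendsto_intros)
        then show "(\<lambda>i. ?q (Z i) y) \<longlonglongrightarrow> 0"
          by (simp add: algebra_simps)
      qed
      show "AE y in lborel. norm (?q (Z i) y) \<le> 8 / \<epsilon> ^ 3 * \<bar>r y\<bar>" for i
      proof (rule AE_I2)
        fix y :: "real^3"
        define d where "d = norm (Z i - x)"
        define w where "w = soft_kernel \<epsilon> (Z i - y) - soft_kernel \<epsilon> (x - y) - soft_kernel_deriv \<epsilon> (x - y) (Z i - x)"
        have d: "d > 0" using Z by (auto simp: d_def)
        have s: "4 / soft_norm \<epsilon> (x - y) ^ 3 \<le> 4 / \<epsilon> ^ 3"
          using abs_le_soft_norm[of \<epsilon> "x - y"] assms soft_norm_pos[of \<epsilon> "x - y"]
          by (intro divide_left_mono power_mono mult_pos_pos) auto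
        have "norm (soft_kernel_deriv \<epsilon> (x - y) (Z i - x)) \<le> 4 / \<epsilon> ^ 3 * d"
          unfolding d_def
          by (rule order_trans[OF norm_soft_kernel_deriv_le[OF assms] mult_right_mono[OF s]]) auto
        moreover have "norm (soft_kernel \<epsilon> (Z i - y) - soft_kernel \<epsilon> (x - y)) \<le> 4 / \<epsilon> ^ 3 * d"
          using soft_kernel_lipschitz[OF assms, of "Z i - y" "x - y"] by (simp add: d_def)
        ultimately have "norm w \<le> 8 / \<epsilon> ^ 3 * d"
          unfolding w_def by (intro order_trans[OF norm_triangle_ineq4]) simp
        then have "\<bar>r y\<bar> / d * norm w \<le> \<bar>r y\<bar> / d * (8 / \<epsilon> ^ 3 * d)"
          using d by (intro mult_left_mono) auto
        also have "\<dots> = 8 / \<epsilon> ^ 3 * \<bar>r y\<bar>" using d by simp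
        finally have "\<bar>r y\<bar> / d * norm w \<le> 8 / \<epsilon> ^ 3 * \<bar>r y\<bar>" .
        moreover have "?q (Z i) y = (r y / d) *\<^sub>R w"
          by (simp add: d_def w_def algebra_simps)
        ultimately show "norm (?q (Z i) y) \<le> 8 / \<epsilon> ^ 3 * \<bar>r y\<bar>"
          using d by (simp only: norm_scaleR abs_divide abs_of_pos)
      qed
    qed (auto simp: soft_field_def)
    then show "(\<lambda>i. \<integral>y. ?q (Z i) y \<partial>lborel) \<longlonglongrightarrow> 0" by simp
  qed
qed

text \<open>The cube of the inverse distance just fails to be integrable, both at the origin and at infinity.
  Closer than \<open>d\<close> to the point, a factor \<open>\<epsilon>\<close> to the power \<open>- \<eta>\<close> is sacrificed to gain integrability at the
  origin, and the bound \<open>a\<close> on the nearby density multiplies the result. Farther away the kernel is at most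
  \<open>1 / d ^ 3\<close> and the density itself is integrable.\<close>

lemma integral_soft_norm_cube_le:
  assumes \<epsilon>: "0 < \<epsilon>" and \<eta>: "0 < \<eta>" "\<eta> \<le> 1" and d: "0 < d"
    and near: "\<And>y. norm (y - x) \<le> d \<Longrightarrow> \<bar>r y\<bar> \<le> a"
  shows "(\<integral>y. \<bar>r y\<bar> / soft_norm \<epsilon> (x - y) ^ 3 \<partial>lborel)
     \<le> a * \<epsilon> powr - \<eta> * (1 + d\<^sup>2) powr \<eta> * weight_mass (3 - \<eta>) \<eta> + S * bessel_mass p / d ^ 3"
proof -
  define c where "c = a * \<epsilon> powr - \<eta> * (1 + d\<^sup>2) powr \<eta>"
  have a: "0 \<le> a" using near[of x] d by auto
  have c: "0 \<le> c" using a by (simp add: c_def)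
  let ?g = "\<lambda>y. c * weight (3 - \<eta>) \<eta> ((x - y) /\<^sub>R 1) + \<bar>r y\<bar> * (1 / d ^ 3)"
  have w: "integrable lborel (\<lambda>y. weight (3 - \<eta>) \<eta> ((x - y) /\<^sub>R 1))"
      "(\<integral>y. weight (3 - \<eta>) \<eta> ((x - y) /\<^sub>R 1) \<partial>lborel) = weight_mass (3 - \<eta>) \<eta>"
    using integrable_weight_shift[of 1 "3 - \<eta>" \<eta> x] \<eta> by auto
  have "AE y in lborel. y \<noteq> x" by (rule AE_lborel_singleton)
  then have le: "AE y in lborel. \<bar>r y\<bar> / soft_norm \<epsilon> (x - y) ^ 3 \<le> ?g y"
  proof (rule eventually_mono)
    fix y assume "y \<noteq> x"
    define s where "s = soft_norm \<epsilon> (x - y)"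
    have s: "s > 0" "\<epsilon> \<le> s" "norm (x - y) \<le> s"
      using \<epsilon> soft_norm_pos[of \<epsilon>] abs_le_soft_norm[of \<epsilon>] norm_le_soft_norm by (auto simp: s_def)
    show "\<bar>r y\<bar> / soft_norm \<epsilon> (x - y) ^ 3 \<le> ?g y"
    proof (cases "norm (x - y) \<le> d")
      case True
      have n: "norm (x - y) > 0" using \<open>y \<noteq> x\<close> by simp
      have r: "\<bar>r y\<bar> \<le> a" using True by (intro near) (simp add: norm_minus_commute)
      have "1 / s ^ 3 = s powr - \<eta> * s powr - (3 - \<eta>)"
        using s by (simp only: powr_add[symmetric]) (simp add: powr_minus_divide powr_numeral)
      also have "\<dots> \<le> \<epsilon> powr - \<eta> * norm (x - y) powr - (3 - \<eta>)"
        using s \<epsilon> \<eta> n by (intro mult_mono powr_mono2') auto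
      also have "\<dots> \<le> \<epsilon> powr - \<eta> * norm (x - y) powr - (3 - \<eta>) * ((1 + d\<^sup>2) powr \<eta> * (1 + (norm (x - y))\<^sup>2) powr - \<eta>)"
      proof -
        have pos: "0 < 1 + (norm (x - y))\<^sup>2" by (intro add_pos_nonneg) auto
        have "1 + (norm (x - y))\<^sup>2 \<le> 1 + d\<^sup>2" using True by (simp add: power_mono)
        then have "(1 + (norm (x - y))\<^sup>2) powr \<eta> \<le> (1 + d\<^sup>2) powr \<eta>"
          using pos \<eta> by (intro powr_mono2) auto
        then have "1 \<le> (1 + d\<^sup>2) powr \<eta> * (1 + (norm (x - y))\<^sup>2) powr - \<eta>"
          using pos by (simp add: powr_minus_divide le_divide_eq)
        then show ?thesis using mult_left_mono[of 1 _ "\<epsilon> powr - \<eta> * norm (x - y) powr - (3 - \<eta>)"] by simp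
      qed
      finally have "1 / s ^ 3 \<le> \<epsilon> powr - \<eta> * (1 + d\<^sup>2) powr \<eta> * weight (3 - \<eta>) \<eta> (x - y)"
        by (simp add: weight_def mult_ac)
      then have "\<bar>r y\<bar> * (1 / s ^ 3) \<le> a * (\<epsilon> powr - \<eta> * (1 + d\<^sup>2) powr \<eta> * weight (3 - \<eta>) \<eta> (x - y))"
        using r s a by (intro mult_mono) auto
      then show ?thesis by (simp add: s_def c_def mult_ac add_increasing2 d less_imp_le)
    next
      case False
      then have "1 / s ^ 3 \<le> 1 / d ^ 3"
        using s d by (intro divide_left_mono power_mono mult_pos_pos) auto
      then have "\<bar>r y\<bar> * (1 / s ^ 3) \<le> \<bar>r y\<bar> * (1 / d ^ 3)" by (intro mult_left_mono) auto
      then show ?thesis using c by (simp add: s_def add_increasing)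
    qed
  qed
  have "(\<integral>y. \<bar>r y\<bar> / soft_norm \<epsilon> (x - y) ^ 3 \<partial>lborel) \<le> (\<integral>y. ?g y \<partial>lborel)"
    using w integrable_r integrable_soft_field_deriv(1)[OF \<epsilon>] le by (intro integral_mono_AE) auto
  also have "\<dots> = c * weight_mass (3 - \<eta>) \<eta> + (\<integral>y. \<bar>r y\<bar> \<partial>lborel) / d ^ 3"
    using w integrable_r by (subst Bochner_Integration.integral_add) auto
  also have "\<dots> \<le> c * weight_mass (3 - \<eta>) \<eta> + S * bessel_mass p / d ^ 3"
    using integral_abs_r_le d by (intro add_left_mono divide_right_mono) auto
  finally show ?thesis by (simp add: c_def)
qed

text \<open>Within distance \<open>1\<close> the divergence kernel has a mass bounded independently of \<open>\<epsilon>\<close>; beyond that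
  distance it is \<open>O(\<epsilon>\<^sup>2)\<close>. No power of \<open>\<epsilon>\<close> is lost here, unlike in the bound on the full derivative, and
  the Gronwall argument depends on that.\<close>

lemma trace_soft_field_deriv_le:
  assumes \<epsilon>: "0 < \<epsilon>" and near: "\<And>y. norm (y - x) \<le> 1 \<Longrightarrow> \<bar>r y\<bar> \<le> a"
  shows "\<bar>\<Sum>i\<in>UNIV. soft_field_deriv \<epsilon> r x (axis i 1) $ i\<bar> \<le> 3 * bessel_mass 5 * a + 3 * S * bessel_mass p * \<epsilon>\<^sup>2"
proof -
  have a: "0 \<le> a" using near[of x] by auto
  let ?k = "\<lambda>y. 3 * \<epsilon>\<^sup>2 / soft_norm \<epsilon> (x - y) ^ 5"
  let ?g = "\<lambda>y. a * (3 / \<epsilon> ^ 3) * R ((x - y) /\<^sub>R \<epsilon>) powr - 5 + 3 * \<epsilon>\<^sup>2 * \<bar>r y\<bar>"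
  have "(\<Sum>i\<in>UNIV. soft_field_deriv \<epsilon> r x (axis i 1) $ i)
      = (\<Sum>i\<in>UNIV. \<integral>y. (r y *\<^sub>R soft_kernel_deriv \<epsilon> (x - y) (axis i 1)) $ i \<partial>lborel)"
    unfolding soft_field_deriv_def
    using integrable_soft_field_deriv(2)[OF \<epsilon>]
    by (intro sum.cong refl integral_bounded_linear[symmetric, OF bounded_linear_vec_nth])
  also have "\<dots> = (\<integral>y. (\<Sum>i\<in>UNIV. (r y *\<^sub>R soft_kernel_deriv \<epsilon> (x - y) (axis i 1)) $ i) \<partial>lborel)"
    by (intro Bochner_Integration.integral_sum[symmetric] integrable_bounded_linear[OF bounded_linear_vec_nth]
        integrable_soft_field_deriv(2)[OF \<epsilon>])
  also have "\<dots> = (\<integral>y. r y * ?k y \<partial>lborel)"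
    by (simp add: sum_distrib_left[symmetric] trace_soft_kernel_deriv[OF \<epsilon>])
  finally have eq: "(\<Sum>i\<in>UNIV. soft_field_deriv \<epsilon> r x (axis i 1) $ i) = (\<integral>y. r y * ?k y \<partial>lborel)" .
  have w: "integrable lborel (\<lambda>y. R ((x - y) /\<^sub>R \<epsilon>) powr - 5)"
      "(\<integral>y. R ((x - y) /\<^sub>R \<epsilon>) powr - 5 \<partial>lborel) = \<epsilon> ^ 3 * bessel_mass 5"
    using integrable_scaled[of \<epsilon> "\<lambda>z. R z powr - 5" x] integral_scaled[of \<epsilon> "\<lambda>z. R z powr - 5" x]
      integrable_R_powr[of 5] \<epsilon> by (auto simp: bessel_mass_def)
  have le: "\<bar>r y * ?k y\<bar> \<le> ?g y" for y
  proof -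
    define s where "s = soft_norm \<epsilon> (x - y)"
    have s: "s > 0" "norm (x - y) \<le> s"
      using \<epsilon> soft_norm_pos[of \<epsilon>] norm_le_soft_norm by (auto simp: s_def)
    have sR: "s = \<epsilon> * R ((x - y) /\<^sub>R \<epsilon>)"
    proof -
      have n: "norm ((x - y) /\<^sub>R \<epsilon>) = norm (x - y) / \<epsilon>"
        using \<epsilon> by (simp add: divide_inverse mult.commute)
      have "s\<^sup>2 = (\<epsilon> * R ((x - y) /\<^sub>R \<epsilon>))\<^sup>2"
        unfolding R_def n using \<epsilon>
        by (simp add: s_def soft_norm_sq power_mult_distrib power_divide field_simps add_nonneg_nonneg)
      then show ?thesis using s \<epsilon> power2_eq_iff_nonneg[of s "\<epsilon> * R ((x - y) /\<^sub>R \<epsilon>)"] by (simp add: less_imp_le)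
    qed
    have k: "?k y = 3 / \<epsilon> ^ 3 * R ((x - y) /\<^sub>R \<epsilon>) powr - 5"
    proof -
      have "R ((x - y) /\<^sub>R \<epsilon>) powr - 5 = 1 / R ((x - y) /\<^sub>R \<epsilon>) ^ 5"
        by (simp only: powr_minus_divide powr_numeral[OF less_imp_le[OF R_pos]])
      then show ?thesis
        unfolding s_def[symmetric] sR using \<epsilon> by (simp add: power_mult_distrib field_simps eval_nat_numeral)
    qed
    show ?thesis
    proof (cases "norm (x - y) \<le> 1")
      case True
      then have "\<bar>r y\<bar> \<le> a" by (intro near) (simp add: norm_minus_commute)
      then have "\<bar>r y\<bar> * ?k y \<le> a * ?k y" using s by (intro mult_right_mono) (auto simp: s_def)
      then show ?thesis unfolding k using \<epsilon>
        by (simp add: abs_mult mult_ac add_increasing2)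
    next
      case False
      then have "1 \<le> s ^ 5" using s by (intro one_le_power) auto
      then have "?k y \<le> 3 * \<epsilon>\<^sup>2" using s \<epsilon> unfolding s_def[symmetric]
        by (subst divide_le_eq) (auto simp: mult_le_cancel_left1)
      then have "\<bar>r y\<bar> * ?k y \<le> \<bar>r y\<bar> * (3 * \<epsilon>\<^sup>2)" by (intro mult_left_mono) auto
      moreover have "\<bar>r y * ?k y\<bar> = \<bar>r y\<bar> * ?k y" using s by (simp add: abs_mult s_def)
      moreover have "0 \<le> a * (3 / \<epsilon> ^ 3) * R ((x - y) /\<^sub>R \<epsilon>) powr - 5" using a \<epsilon> by simp
      ultimately show ?thesis by (simp only: mult.commute[of "\<bar>r y\<bar>" "3 * \<epsilon>\<^sup>2"] add_increasing)
    qed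
  qed
  have g: "integrable lborel ?g" using w integrable_r by auto
  have int: "integrable lborel (\<lambda>y. r y * ?k y)"
    by (rule Bochner_Integration.integrable_bound[OF g]) (use le in \<open>auto intro: order_trans abs_ge_self\<close>)
  have "\<bar>\<integral>y. r y * ?k y \<partial>lborel\<bar> \<le> (\<integral>y. ?g y \<partial>lborel)"
    using Bochner_Integration.integral_norm_bound_integral[OF int g] le by simp
  also have "\<dots> = a * (3 / \<epsilon> ^ 3) * (\<epsilon> ^ 3 * bessel_mass 5) + 3 * \<epsilon>\<^sup>2 * (\<integral>y. \<bar>r y\<bar> \<partial>lborel)"
    using w integrable_r by (subst Bochner_Integration.integral_add) auto
  also have "\<dots> \<le> a * (3 / \<epsilon> ^ 3) * (\<epsilon> ^ 3 * bessel_mass 5) + 3 * \<epsilon>\<^sup>2 * (S * bessel_mass p)"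
    by (intro add_left_mono mult_left_mono integral_abs_r_le) auto
  also have "\<dots> = 3 * bessel_mass 5 * a + 3 * S * bessel_mass p * \<epsilon>\<^sup>2"
    using \<epsilon> by (simp add: field_simps)
  finally show ?thesis unfolding eq .
qed

end

section \<open>Euler polygons of the characteristic system\<close>

text \<open>Explicit Euler steps, backwards in time, for the system \<open>x' = v\<close>, \<open>v' = - B\<close>; the field \<open>B k\<close> is the
  force at the time of the \<open>k\<close>-th vertex.\<close>

primrec euler :: "(nat \<Rightarrow> real^3 \<Rightarrow> real^3) \<Rightarrow> real \<Rightarrow> (real^3) \<times> (real^3) \<Rightarrow> nat \<Rightarrow> (real^3) \<times> (real^3)" where
  "euler B \<delta> z 0 = z"
| "euler B \<delta> z (Suc k) =
     (fst (euler B \<delta> z k) - \<delta> *\<^sub>R snd (euler B \<delta> z k),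
      snd (euler B \<delta> z k) + \<delta> *\<^sub>R B k (fst (euler B \<delta> z k)))"

lemma euler_growth:
  assumes \<delta>: "0 \<le> \<delta>" and M: "\<And>k y. k < n \<Longrightarrow> norm (B k y) \<le> M" and T: "n * \<delta> \<le> T" and M0: "0 \<le> M" and "k \<le> n"
  shows "norm (snd (euler B \<delta> z k) - snd z) \<le> T * M"
    and "norm (fst (euler B \<delta> z k) - fst z) \<le> T * (norm (snd z) + T * M)"
proof -
  have kT: "real j * \<delta> \<le> T" if "j \<le> n" for j
    using mult_right_mono[of "real j" "real n" \<delta>] \<delta> T that by simp
  have T0: "0 \<le> T" using kT[of 0] by simp
  have "norm (snd (euler B \<delta> z k) - snd z) \<le> k * \<delta> * M \<and>
        norm (fst (euler B \<delta> z k) - fst z) \<le> k * \<delta> * (norm (snd z) + T * M)" using \<open>k \<le> n\<close>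
  proof (induction k)
    case (Suc k)
    let ?x = "fst (euler B \<delta> z k)" and ?v = "snd (euler B \<delta> z k)"
    have IH: "norm (?v - snd z) \<le> k * \<delta> * M" "norm (?x - fst z) \<le> k * \<delta> * (norm (snd z) + T * M)"
      using Suc by auto
    have "norm (?v + \<delta> *\<^sub>R B k ?x - snd z) \<le> norm (?v - snd z) + norm (\<delta> *\<^sub>R B k ?x)"
      using norm_triangle_ineq[of "?v - snd z" "\<delta> *\<^sub>R B k ?x"] by (simp add: algebra_simps)
    also have "norm (\<delta> *\<^sub>R B k ?x) \<le> \<delta> * M" using \<delta> M[of k] Suc by (auto intro!: mult_left_mono)
    finally have 1: "norm (?v + \<delta> *\<^sub>R B k ?x - snd z) \<le> Suc k * \<delta> * M" using IH by (simp add: algebra_simps)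
    have "norm ?v \<le> norm (snd z) + norm (?v - snd z)" using norm_triangle_ineq[of "snd z" "?v - snd z"] by simp
    also have "\<dots> \<le> norm (snd z) + T * M" using IH(1) mult_right_mono[OF kT[of k] M0] Suc by simp
    finally have v: "norm ?v \<le> norm (snd z) + T * M" .
    have "norm (?x - \<delta> *\<^sub>R ?v - fst z) \<le> norm (?x - fst z) + norm (\<delta> *\<^sub>R ?v)"
      using norm_triangle_ineq4[of "?x - fst z" "\<delta> *\<^sub>R ?v"] by (simp add: algebra_simps)
    also have "norm (\<delta> *\<^sub>R ?v) \<le> \<delta> * (norm (snd z) + T * M)" using \<delta> v by (auto intro!: mult_left_mono)
    finally have 2: "norm (?x - \<delta> *\<^sub>R ?v - fst z) \<le> Suc k * \<delta> * (norm (snd z) + T * M)"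
      using IH by (simp add: algebra_simps)
    from 1 2 show ?case by simp
  qed simp
  moreover have "k * \<delta> * M \<le> T * M" "k * \<delta> * (norm (snd z) + T * M) \<le> T * (norm (snd z) + T * M)"
    using kT[OF \<open>k \<le> n\<close>] M0 T0 by (auto intro!: mult_right_mono)
  ultimately show "norm (snd (euler B \<delta> z k) - snd z) \<le> T * M"
    and "norm (fst (euler B \<delta> z k) - fst z) \<le> T * (norm (snd z) + T * M)" by linarith+
qed

text \<open>The induction closes with linear bounds because \<open>2 * \<Lambda> * T\<^sup>2 \<le> 1\<close>; far from the origin the Lipschitz
  constant \<open>\<Lambda>\<close> is small enough for this.\<close>

lemma euler_compare:
  assumes \<delta>: "0 \<le> \<delta>" and T: "n * \<delta> \<le> T" and \<Lambda>: "0 \<le> \<Lambda>" "2 * \<Lambda> * T\<^sup>2 \<le> 1"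
    and near: "\<And>k y. k < n \<Longrightarrow> norm (B k y - H k y) \<le> e"
    and lip: "\<And>k y y'. k < n \<Longrightarrow> y \<in> D \<Longrightarrow> y' \<in> D \<Longrightarrow> norm (H k y - H k y') \<le> \<Lambda> * norm (y - y')"
    and D: "\<And>k. k < n \<Longrightarrow> fst (euler B \<delta> z k) \<in> D" "\<And>k. k < n \<Longrightarrow> fst (euler H \<delta> z k) \<in> D"
    and e: "0 \<le> e" and "k \<le> n"
  shows "norm (snd (euler B \<delta> z k) - snd (euler H \<delta> z k)) \<le> 2 * e * T"
proof -
  have kT: "real j * \<delta> \<le> T" if "j \<le> n" for j
    using mult_right_mono[of "real j" "real n" \<delta>] \<delta> T that by simp
  have T0: "0 \<le> T" using kT[of 0] by simp
  have "norm (snd (euler B \<delta> z k) - snd (euler H \<delta> z k)) \<le> 2 * e * (k * \<delta>) \<and>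
        norm (fst (euler B \<delta> z k) - fst (euler H \<delta> z k)) \<le> 2 * e * (k * \<delta>) * T" using \<open>k \<le> n\<close>
  proof (induction k)
    case (Suc k)
    let ?x = "fst (euler B \<delta> z k)" and ?v = "snd (euler B \<delta> z k)"
    let ?y = "fst (euler H \<delta> z k)" and ?w = "snd (euler H \<delta> z k)"
    have IH: "norm (?v - ?w) \<le> 2 * e * (k * \<delta>)" "norm (?x - ?y) \<le> 2 * e * (k * \<delta>) * T"
      using Suc by auto
    have k: "k < n" "real k * \<delta> \<le> T" using Suc kT by auto
    have "2 * e * (k * \<delta>) * T \<le> 2 * e * T * T"
      using k e T0 by (intro mult_right_mono mult_left_mono) auto
    then have "norm (?x - ?y) \<le> 2 * e * T * T" using IH(2) by linarith
    then have "\<Lambda> * norm (?x - ?y) \<le> \<Lambda> * (2 * e * T * T)" using \<Lambda> by (intro mult_left_mono) auto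
    also have "\<dots> = 2 * \<Lambda> * T\<^sup>2 * e" by (simp add: power2_eq_square)
    also have "\<dots> \<le> 1 * e" using \<Lambda> e by (intro mult_right_mono) auto
    finally have "norm (H k ?x - H k ?y) \<le> e" using lip[of k ?x ?y] D k by fastforce
    then have "norm (B k ?x - H k ?y) \<le> 2 * e"
      using near[OF k(1), of ?x] norm_triangle_ineq[of "B k ?x - H k ?x" "H k ?x - H k ?y"] by simp
    then have f: "norm (\<delta> *\<^sub>R (B k ?x - H k ?y)) \<le> \<delta> * (2 * e)" using \<delta> by (auto intro!: mult_left_mono)
    have "(?v + \<delta> *\<^sub>R B k ?x) - (?w + \<delta> *\<^sub>R H k ?y) = (?v - ?w) + \<delta> *\<^sub>R (B k ?x - H k ?y)"
      by (simp add: algebra_simps)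
    then have 1: "norm ((?v + \<delta> *\<^sub>R B k ?x) - (?w + \<delta> *\<^sub>R H k ?y)) \<le> 2 * e * (Suc k * \<delta>)"
      using IH(1) f norm_triangle_ineq[of "?v - ?w" "\<delta> *\<^sub>R (B k ?x - H k ?y)"] by (simp add: algebra_simps)
    have "2 * e * (k * \<delta>) \<le> 2 * e * T" using k e by (intro mult_left_mono) auto
    then have "norm (?v - ?w) \<le> 2 * e * T" using IH(1) by linarith
    then have g: "norm (\<delta> *\<^sub>R (?v - ?w)) \<le> \<delta> * (2 * e * T)" using \<delta> by (auto intro!: mult_left_mono)
    have "(?x - \<delta> *\<^sub>R ?v) - (?y - \<delta> *\<^sub>R ?w) = (?x - ?y) - \<delta> *\<^sub>R (?v - ?w)"
      by (simp add: algebra_simps)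
    then have 2: "norm ((?x - \<delta> *\<^sub>R ?v) - (?y - \<delta> *\<^sub>R ?w)) \<le> 2 * e * (Suc k * \<delta>) * T"
      using IH(2) g norm_triangle_ineq4[of "?x - ?y" "\<delta> *\<^sub>R (?v - ?w)"] by (simp add: algebra_simps)
    from 1 2 show ?case by simp
  qed simp
  moreover have "2 * e * (k * \<delta>) \<le> 2 * e * T" using kT[OF \<open>k \<le> n\<close>] e by (intro mult_left_mono) auto
  ultimately show ?thesis by linarith
qed

text \<open>The derivative of \<open>euler H \<delta> z k\<close> with respect to the velocity component of \<open>z\<close>, in direction \<open>h\<close>,
  provided that \<open>H' k\<close> is the derivative of \<open>H k\<close>.\<close>

primrec euler_deriv :: "(nat \<Rightarrow> real^3 \<Rightarrow> real^3) \<Rightarrow> (nat \<Rightarrow> real^3 \<Rightarrow> real^3 \<Rightarrow> real^3) \<Rightarrow> real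
    \<Rightarrow> (real^3) \<times> (real^3) \<Rightarrow> nat \<Rightarrow> real^3 \<Rightarrow> (real^3) \<times> (real^3)" where
  "euler_deriv H H' \<delta> z 0 h = (0, h)"
| "euler_deriv H H' \<delta> z (Suc k) h =
     (fst (euler_deriv H H' \<delta> z k h) - \<delta> *\<^sub>R snd (euler_deriv H H' \<delta> z k h),
      snd (euler_deriv H H' \<delta> z k h) + \<delta> *\<^sub>R H' k (fst (euler H \<delta> z k)) (fst (euler_deriv H H' \<delta> z k h)))"

lemma has_derivative_euler:
  assumes "\<And>j. j < k \<Longrightarrow> (H j has_derivative H' j (fst (euler H \<delta> (x, v) j))) (at (fst (euler H \<delta> (x, v) j)))"
  shows "((\<lambda>v. euler H \<delta> (x, v) k) has_derivative euler_deriv H H' \<delta> (x, v) k) (at v)"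
  using assms
proof (induction k)
  case 0
  show ?case by (auto intro!: derivative_eq_intros)
next
  case (Suc k)
  have IH: "((\<lambda>v. euler H \<delta> (x, v) k) has_derivative euler_deriv H H' \<delta> (x, v) k) (at v)"
    using Suc by simp
  have X: "((\<lambda>v. fst (euler H \<delta> (x, v) k)) has_derivative (\<lambda>h. fst (euler_deriv H H' \<delta> (x, v) k h))) (at v)"
    and V: "((\<lambda>v. snd (euler H \<delta> (x, v) k)) has_derivative (\<lambda>h. snd (euler_deriv H H' \<delta> (x, v) k h))) (at v)"
    using has_derivative_fst[OF IH] has_derivative_snd[OF IH] by auto
  have HX: "((\<lambda>v. H k (fst (euler H \<delta> (x, v) k))) has_derivative
      (\<lambda>h. H' k (fst (euler H \<delta> (x, v) k)) (fst (euler_deriv H H' \<delta> (x, v) k h)))) (at v)"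
    using has_derivative_compose[OF X Suc.prems[of k]] by simp
  have eq: "euler_deriv H H' \<delta> (x, v) (Suc k) = (\<lambda>h.
      (fst (euler_deriv H H' \<delta> (x, v) k h) - \<delta> *\<^sub>R snd (euler_deriv H H' \<delta> (x, v) k h),
       snd (euler_deriv H H' \<delta> (x, v) k h)
         + \<delta> *\<^sub>R H' k (fst (euler H \<delta> (x, v) k)) (fst (euler_deriv H H' \<delta> (x, v) k h))))"
    by (simp add: fun_eq_iff)
  show ?case unfolding eq euler.simps
    by (intro has_derivative_Pair has_derivative_diff has_derivative_add has_derivative_scaleR_right X V HX)
qed

text \<open>Without a force the derivative would be \<open>(- (k * \<delta>) *\<^sub>R h, h)\<close>.\<close>

lemma euler_deriv_near_free_flow:
  assumes \<delta>: "0 \<le> \<delta>" and T: "n * \<delta> \<le> T" and \<Lambda>: "0 \<le> \<Lambda>" "2 * \<Lambda> * T\<^sup>2 \<le> 1"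
    and bound: "\<And>k h. k < n \<Longrightarrow> norm (H' k (fst (euler H \<delta> z k)) h) \<le> \<Lambda> * norm h"
    and "k \<le> n"
  shows "norm (snd (euler_deriv H H' \<delta> z k h) - h) \<le> 2 * \<Lambda> * T\<^sup>2 * norm h"
    and "norm (fst (euler_deriv H H' \<delta> z k h) + (k * \<delta>) *\<^sub>R h) \<le> 2 * \<Lambda> * T ^ 3 * norm h"
proof -
  have kT: "real j * \<delta> \<le> T" if "j \<le> n" for j
    using mult_right_mono[of "real j" "real n" \<delta>] \<delta> T that by simp
  have T0: "0 \<le> T" using kT[of 0] by simp
  have "norm (snd (euler_deriv H H' \<delta> z k h) - h) \<le> 2 * \<Lambda> * T * (k * \<delta>) * norm h \<and>
        norm (fst (euler_deriv H H' \<delta> z k h) + (k * \<delta>) *\<^sub>R h) \<le> 2 * \<Lambda> * T\<^sup>2 * (k * \<delta>) * norm h" using \<open>k \<le> n\<close>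
  proof (induction k)
    case (Suc k)
    let ?x = "fst (euler_deriv H H' \<delta> z k h)" and ?v = "snd (euler_deriv H H' \<delta> z k h)"
    have IH: "norm (?v - h) \<le> 2 * \<Lambda> * T * (k * \<delta>) * norm h"
        "norm (?x + (k * \<delta>) *\<^sub>R h) \<le> 2 * \<Lambda> * T\<^sup>2 * (k * \<delta>) * norm h"
      using Suc by auto
    have k: "k < n" "real k * \<delta> \<le> T" using Suc kT by auto
    have "2 * \<Lambda> * T\<^sup>2 * (k * \<delta>) * norm h \<le> 1 * T * norm h"
      using k \<Lambda> T0 \<delta> by (intro mult_right_mono mult_mono) auto
    moreover have "norm ((k * \<delta>) *\<^sub>R h) \<le> T * norm h" using k \<delta> by (auto intro!: mult_right_mono)
    ultimately have "norm ?x \<le> 2 * T * norm h"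
      using IH(2) norm_triangle_ineq4[of "?x + (k * \<delta>) *\<^sub>R h" "(k * \<delta>) *\<^sub>R h"] by simp
    then have "\<Lambda> * norm ?x \<le> \<Lambda> * (2 * T * norm h)" using \<Lambda> by (intro mult_left_mono) auto
    then have "norm (H' k (fst (euler H \<delta> z k)) ?x) \<le> 2 * \<Lambda> * T * norm h"
      using bound[OF k(1), of ?x] by simp
    then have f: "norm (\<delta> *\<^sub>R H' k (fst (euler H \<delta> z k)) ?x) \<le> \<delta> * (2 * \<Lambda> * T * norm h)"
      using \<delta> by (auto intro!: mult_left_mono)
    have "?v + \<delta> *\<^sub>R H' k (fst (euler H \<delta> z k)) ?x - h = (?v - h) + \<delta> *\<^sub>R H' k (fst (euler H \<delta> z k)) ?x" by simp
    then have 1: "norm (?v + \<delta> *\<^sub>R H' k (fst (euler H \<delta> z k)) ?x - h) \<le> 2 * \<Lambda> * T * (Suc k * \<delta>) * norm h"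
      using IH(1) f norm_triangle_ineq[of "?v - h" "\<delta> *\<^sub>R H' k (fst (euler H \<delta> z k)) ?x"] by (simp add: algebra_simps)
    have "2 * \<Lambda> * T * (k * \<delta>) * norm h \<le> 2 * \<Lambda> * T * T * norm h"
      using k \<Lambda> T0 by (intro mult_right_mono mult_left_mono) auto
    then have g: "norm (\<delta> *\<^sub>R (?v - h)) \<le> \<delta> * (2 * \<Lambda> * T\<^sup>2 * norm h)"
      using IH(1) \<delta> by (auto intro!: mult_left_mono simp: power2_eq_square mult.assoc)
    have "?x - \<delta> *\<^sub>R ?v + (Suc k * \<delta>) *\<^sub>R h = (?x + (k * \<delta>) *\<^sub>R h) - \<delta> *\<^sub>R (?v - h)"
      by (simp add: algebra_simps)
    then have 2: "norm (?x - \<delta> *\<^sub>R ?v + (Suc k * \<delta>) *\<^sub>R h) \<le> 2 * \<Lambda> * T\<^sup>2 * (Suc k * \<delta>) * norm h"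
      using IH(2) g norm_triangle_ineq4[of "?x + (k * \<delta>) *\<^sub>R h" "\<delta> *\<^sub>R (?v - h)"] by (simp add: algebra_simps)
    from 1 2 show ?case by simp
  qed simp
  moreover have "2 * \<Lambda> * T * (k * \<delta>) * norm h \<le> 2 * \<Lambda> * T * T * norm h"
    using kT[OF \<open>k \<le> n\<close>] \<Lambda> T0 by (intro mult_right_mono mult_left_mono) auto
  moreover have "2 * \<Lambda> * T\<^sup>2 * (k * \<delta>) * norm h \<le> 2 * \<Lambda> * T\<^sup>2 * T * norm h"
    using kT[OF \<open>k \<le> n\<close>] \<Lambda> T0 by (intro mult_right_mono mult_left_mono) auto
  ultimately show "norm (snd (euler_deriv H H' \<delta> z k h) - h) \<le> 2 * \<Lambda> * T\<^sup>2 * norm h"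
    and "norm (fst (euler_deriv H H' \<delta> z k h) + (k * \<delta>) *\<^sub>R h) \<le> 2 * \<Lambda> * T ^ 3 * norm h"
    by (simp_all add: power2_eq_square power3_eq_cube mult_ac)
qed

text \<open>To first order the velocity derivative accumulates \<open>H'\<close> applied to the free flow, that is
  \<open>- (k * \<delta>)\<close> times \<open>H'\<close>, whose trace is a divergence; the deviation from the free flow enters
  multiplied by a second factor \<open>H'\<close> and is therefore quadratic in \<open>\<Lambda>\<close>.\<close>

lemma trace_euler_deriv_le:
  assumes \<delta>: "0 \<le> \<delta>" and T: "n * \<delta> \<le> T" and \<Lambda>: "0 \<le> \<Lambda>" "2 * \<Lambda> * T\<^sup>2 \<le> 1"
    and lin: "\<And>k. k < n \<Longrightarrow> linear (H' k (fst (euler H \<delta> z k)))"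
    and bound: "\<And>k h. k < n \<Longrightarrow> norm (H' k (fst (euler H \<delta> z k)) h) \<le> \<Lambda> * norm h"
    and tr: "\<And>k. k < n \<Longrightarrow> \<bar>\<Sum>i\<in>UNIV. H' k (fst (euler H \<delta> z k)) (axis i 1) $ i\<bar> \<le> \<sigma> k"
  shows "\<bar>\<Sum>i\<in>UNIV. (snd (euler_deriv H H' \<delta> z n (axis i 1)) - axis i 1) $ i\<bar>
     \<le> T * (\<delta> * (\<Sum>k<n. \<sigma> k)) + 6 * \<Lambda>\<^sup>2 * T ^ 4"
proof -
  have kT: "real j * \<delta> \<le> T" if "j \<le> n" for j
    using mult_right_mono[of "real j" "real n" \<delta>] \<delta> T that by simp
  have T0: "0 \<le> T" using kT[of 0] by simp
  let ?tr = "\<lambda>k. \<Sum>i\<in>UNIV. (snd (euler_deriv H H' \<delta> z k (axis i 1)) - axis i 1) $ i"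
  have "\<bar>?tr k\<bar> \<le> (\<Sum>j<k. \<delta> * (T * \<sigma> j + 6 * \<Lambda>\<^sup>2 * T ^ 3))" if "k \<le> n" for k
    using that
  proof (induction k)
    case (Suc k)
    define L where "L = H' k (fst (euler H \<delta> z k))"
    define X where "X i = fst (euler_deriv H H' \<delta> z k (axis i 1))" for i
    have k: "k < n" "real k * \<delta> \<le> T" using Suc kT by auto
    have L: "linear L" and Lb: "norm (L h) \<le> \<Lambda> * norm h" for h using lin bound k by (auto simp: L_def)
    have split: "L (X i) = L (X i + (k * \<delta>) *\<^sub>R axis i 1) - (k * \<delta>) *\<^sub>R L (axis i 1)" for i
      by (simp add: linear_add[OF L] linear_scale[OF L])
    have "\<bar>L (X i + (k * \<delta>) *\<^sub>R axis i 1) $ i\<bar> \<le> 2 * \<Lambda>\<^sup>2 * T ^ 3" for i :: 3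
    proof -
      have "norm (X i + (k * \<delta>) *\<^sub>R axis i 1) \<le> 2 * \<Lambda> * T ^ 3 * norm (axis i 1 :: real^3)"
        unfolding X_def
        using euler_deriv_near_free_flow(2)[where H=H and H'=H' and z=z and k=k and h="axis i 1", OF \<delta> T \<Lambda> bound] k
        by simp
      then have "\<Lambda> * norm (X i + (k * \<delta>) *\<^sub>R axis i 1) \<le> \<Lambda> * (2 * \<Lambda> * T ^ 3)" using \<Lambda> by (intro mult_left_mono) auto
      then show ?thesis using Lb[of "X i + (k * \<delta>) *\<^sub>R axis i 1"] component_le_norm_cart[of "L (X i + (k * \<delta>) *\<^sub>R axis i 1)" i]
        by (simp add: power2_eq_square)
    qed
    then have "(\<Sum>i\<in>UNIV. \<bar>L (X i + (k * \<delta>) *\<^sub>R axis i 1) $ i\<bar>) \<le> (\<Sum>i\<in>(UNIV :: 3 set). 2 * \<Lambda>\<^sup>2 * T ^ 3)"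
      by (intro sum_mono)
    then have a: "\<bar>\<Sum>i\<in>UNIV. L (X i + (k * \<delta>) *\<^sub>R axis i 1) $ i\<bar> \<le> 6 * \<Lambda>\<^sup>2 * T ^ 3"
      by (intro order_trans[OF sum_abs]) simp
    have "\<bar>(k * \<delta>) * (\<Sum>i\<in>UNIV. L (axis i 1) $ i)\<bar> \<le> T * \<sigma> k"
      unfolding abs_mult using k \<delta> T0 tr[of k] by (intro mult_mono) (auto simp: L_def)
    then have "\<bar>\<Sum>i\<in>UNIV. L (X i) $ i\<bar> \<le> T * \<sigma> k + 6 * \<Lambda>\<^sup>2 * T ^ 3"
      using a unfolding split by (simp add: sum_subtractf sum_distrib_left[symmetric])
    then have b: "\<bar>\<delta> * (\<Sum>i\<in>UNIV. L (X i) $ i)\<bar> \<le> \<delta> * (T * \<sigma> k + 6 * \<Lambda>\<^sup>2 * T ^ 3)"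
      unfolding abs_mult using \<delta> by (intro mult_mono) auto
    have "?tr (Suc k) = ?tr k + \<delta> * (\<Sum>i\<in>UNIV. L (X i) $ i)"
      by (simp add: L_def X_def sum.distrib[symmetric] sum_distrib_left algebra_simps)
    then show ?case using b Suc by simp
  qed simp
  from this[of n] have "\<bar>?tr n\<bar> \<le> (\<Sum>j<n. \<delta> * (T * \<sigma> j + 6 * \<Lambda>\<^sup>2 * T ^ 3))" by simp
  also have "\<dots> = T * (\<delta> * (\<Sum>k<n. \<sigma> k)) + (n * \<delta>) * (6 * \<Lambda>\<^sup>2 * T ^ 3)"
    by (simp add: sum.distrib sum_distrib_left algebra_simps)
  also have "(n * \<delta>) * (6 * \<Lambda>\<^sup>2 * T ^ 3) \<le> T * (6 * \<Lambda>\<^sup>2 * T ^ 3)"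
    using T T0 by (intro mult_right_mono) auto
  finally show ?thesis by (simp add: power_numeral_reduce mult_ac)
qed

section \<open>Maps of velocity space close to the identity\<close>

lemma det_near_identity:
  fixes M :: "real^3^3"
  assumes le: "\<And>i j. \<bar>M $ i $ j\<bar> \<le> \<mu>" and \<mu>: "\<mu> \<le> 1"
  shows "\<bar>det (mat 1 + M) - 1\<bar> \<le> \<bar>\<Sum>i\<in>UNIV. M $ i $ i\<bar> + 12 * \<mu>\<^sup>2"
proof -
  define a b c d e f g h i where "a = M$1$1" and "b = M$1$2" and "c = M$1$3" and "d = M$2$1" and "e = M$2$2"
    and "f = M$2$3" and "g = M$3$1" and "h = M$3$2" and "i = M$3$3"
  note defs = this
  have \<mu>0: "0 \<le> \<mu>" using le[of 1 1] by linarith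
  have p2: "\<bar>x * y\<bar> \<le> \<mu>\<^sup>2" if "\<bar>x\<bar> \<le> \<mu>" "\<bar>y\<bar> \<le> \<mu>" for x y
    unfolding abs_mult power2_eq_square using that \<mu>0 by (intro mult_mono) auto
  have p3: "\<bar>x * y * z\<bar> \<le> \<mu>\<^sup>2" if "\<bar>x\<bar> \<le> \<mu>" "\<bar>y\<bar> \<le> \<mu>" "\<bar>z\<bar> \<le> \<mu>" for x y z
  proof -
    have "\<bar>x * y\<bar> * \<bar>z\<bar> \<le> \<mu>\<^sup>2 * 1"
      using that \<mu> \<mu>0 p2 by (intro mult_mono) auto
    then show ?thesis by (simp add: abs_mult)
  qed
  define r where "r = a * e + a * i + e * i - b * d - c * g - f * h + a * e * i + b * f * g + c * d * h
      - a * f * h - b * d * i - c * e * g"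
  have "det (mat 1 + M) = (1 + a) * (1 + e) * (1 + i) + b * f * g + c * d * h
      - (1 + a) * f * h - b * d * (1 + i) - c * (1 + e) * g"
    unfolding det_3 defs by (simp add: mat_def)
  also have "\<dots> = 1 + (a + e + i) + r" unfolding r_def by algebra
  finally have eq: "det (mat 1 + M) - 1 = (\<Sum>i\<in>UNIV. M $ i $ i) + r" by (simp add: sum_3 defs)
  have ent: "\<bar>a\<bar> \<le> \<mu>" "\<bar>b\<bar> \<le> \<mu>" "\<bar>c\<bar> \<le> \<mu>" "\<bar>d\<bar> \<le> \<mu>" "\<bar>e\<bar> \<le> \<mu>" "\<bar>f\<bar> \<le> \<mu>" "\<bar>g\<bar> \<le> \<mu>" "\<bar>h\<bar> \<le> \<mu>" "\<bar>i\<bar> \<le> \<mu>"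
    using le by (auto simp: defs)
  note P = p2[OF ent(1) ent(5)] p2[OF ent(1) ent(9)] p2[OF ent(5) ent(9)] p2[OF ent(2) ent(4)]
      p2[OF ent(3) ent(7)] p2[OF ent(6) ent(8)]
      p3[OF ent(1) ent(5) ent(9)] p3[OF ent(2) ent(6) ent(7)] p3[OF ent(3) ent(4) ent(8)]
      p3[OF ent(1) ent(6) ent(8)] p3[OF ent(2) ent(4) ent(9)] p3[OF ent(3) ent(5) ent(7)]
  have "r \<le> 12 * \<mu>\<^sup>2" and "- r \<le> 12 * \<mu>\<^sup>2"
    using P[THEN abs_le_D1] P[THEN abs_le_D2] unfolding r_def by linarith+
  then have "\<bar>r\<bar> \<le> 12 * \<mu>\<^sup>2" by (rule abs_leI)
  then show ?thesis
    unfolding eq using abs_triangle_ineq[of "\<Sum>i\<in>UNIV. M $ i $ i" r] by linarith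
qed

lemma absolutely_integrable_on_compact:
  fixes f :: "'a::euclidean_space \<Rightarrow> 'b::euclidean_space"
  assumes "compact S" "continuous_on S f"
  shows "f absolutely_integrable_on S"
  unfolding set_integrable_def
  using borel_integrable_compact[OF assms] by (intro integrable_completion[THEN iffD2]) auto

text \<open>Solving \<open>w v = u\<close> means finding a fixed point of \<open>v \<mapsto> u - (w v - v)\<close>, which Brouwer's theorem
  provides.\<close>

lemma near_identity_image_superset:
  fixes w :: "real^3 \<Rightarrow> real^3"
  assumes cont: "continuous_on (cball 0 V) w"
    and near: "\<And>v. norm v \<le> V \<Longrightarrow> norm (w v - v) \<le> a" and u: "norm u + a \<le> V" and a: "0 \<le> a"
  shows "u \<in> w ` cball 0 V"
proof -
  obtain v where "v \<in> cball 0 V" "u - (w v - v) = v"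
  proof (rule brouwer[of "cball (0::real^3) V" "\<lambda>v. u - (w v - v)"])
    show "continuous_on (cball 0 V) (\<lambda>v. u - (w v - v))" using cont by (intro continuous_intros)
    show "(\<lambda>v. u - (w v - v)) \<in> cball 0 V \<rightarrow> cball 0 V"
    proof
      fix v :: "real^3" assume "v \<in> cball 0 V"
      then have "norm (u - (w v - v)) \<le> norm u + a"
        using near[of v] norm_triangle_ineq4[of u "w v - v"] by simp
      then show "u - (w v - v) \<in> cball 0 V" using u by simp
    qed
    show "cball (0::real^3) V \<noteq> {}" using u a norm_ge_zero[of u] by (simp del: norm_ge_zero)
  qed auto
  then show ?thesis by (intro image_eqI[of _ _ v]) auto
qed

lemma inj_on_near_identity:
  fixes w :: "real^3 \<Rightarrow> real^3" 
  assumes D: "convex D"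
    and der: "\<And>v. v \<in> D \<Longrightarrow> (w has_derivative w' v) (at v)"
    and w': "\<And>v h. v \<in> D \<Longrightarrow> norm (w' v h - h) \<le> \<mu> * norm h" and \<mu>: "\<mu> < 1"
  shows "inj_on w D"
proof (rule inj_onI)
    fix u v assume uv: "u \<in> D" "v \<in> D" "w u = w v"
    have "norm ((w u - u) - (w v - v)) \<le> \<mu> * norm (u - v)"
    proof (rule differentiable_bound[OF D, where f="\<lambda>v. w v - v" and f'="\<lambda>v h. w' v h - h"])
      fix y assume y: "y \<in> D"
      show "((\<lambda>v. w v - v) has_derivative (\<lambda>h. w' y h - h)) (at y within D)"
        by (rule has_derivative_diff[OF has_derivative_at_withinI[OF der[OF y]] has_derivative_ident])
      show "onorm (\<lambda>h. w' y h - h) \<le> \<mu>"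
        by (rule onorm_le) (rule w'[OF y])
    qed (rule uv)+
    moreover have "norm ((w u - u) - (w v - v)) = norm (u - v)"
      unfolding uv(3) using norm_minus_commute[of v u] by simp
    ultimately have "(1 - \<mu>) * norm (u - v) \<le> 0" by (simp only: left_diff_distrib mult_1)
    then show "u = v" using \<mu> by (simp add: mult_le_0_iff)
  qed

text \<open>The image of the ball under the injective map \<open>w\<close> contains the support of \<open>F\<close>, so changing variables
  gives \<open>\<integral> F = \<integral> F(w) \<bar>det Dw\<bar>\<close>. Hence only \<open>\<bar>det Dw\<bar> - 1\<close> contributes to the difference, and
  the trace is the only term of first order in it.\<close>

lemma integral_diff_near_identity_le:
  fixes F :: "real^3 \<Rightarrow> real" and w :: "real^3 \<Rightarrow> real^3"
  assumes F: "continuous_on UNIV F" "\<And>v. norm v \<ge> W \<Longrightarrow> F v = 0" "\<And>v. \<bar>F v\<bar> \<le> b"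
    and V: "W + a \<le> V" and a: "0 \<le> a"
    and der: "\<And>v. norm v \<le> V \<Longrightarrow> (w has_derivative w' v) (at v)"
    and near: "\<And>v. norm v \<le> V \<Longrightarrow> norm (w v - v) \<le> a"
    and w': "\<And>v h. norm v \<le> V \<Longrightarrow> norm (w' v h - h) \<le> \<mu> * norm h" and \<mu>: "\<mu> < 1"
    and tr: "\<And>v. norm v \<le> V \<Longrightarrow> \<bar>\<Sum>i\<in>UNIV. (w' v (axis i 1) - axis i 1) $ i\<bar> \<le> \<tau>"
  shows "\<bar>integral (cball 0 V) (\<lambda>v. F v - F (w v))\<bar> \<le> b * (\<tau> + 12 * \<mu>\<^sup>2) * measure lebesgue (cball (0::real^3) V)"
proof -
  define D where "D = cball (0::real^3) V"
  have D: "compact D" "convex D" and inD: "v \<in> D \<longleftrightarrow> norm v \<le> V" for v by (auto simp: D_def)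
  have contw: "continuous_on D w"
    using der by (intro continuous_at_imp_continuous_on ballI has_derivative_continuous) (auto simp: inD)
  have b: "0 \<le> b" using F(3)[of 0] by linarith
  have inj: "inj_on w D"
    using der w' \<mu> by (intro inj_on_near_identity[OF D(2), where w'=w' and \<mu>=\<mu>]) (auto simp: inD)
  define J where "J v = det (matrix (w' v))" for v
  have J: "\<bar>\<bar>J v\<bar> - 1\<bar> \<le> \<tau> + 12 * \<mu>\<^sup>2" if "v \<in> D" for v
  proof -
    have v: "norm v \<le> V" using that by (simp add: inD)
    define M where "M = (\<chi> i j. (w' v (axis j 1) - axis j 1) $ i)"
    have M: "matrix (w' v) = mat 1 + M" by (simp add: M_def matrix_def vec_eq_iff mat_def axis_def)
    have "\<bar>M $ i $ j\<bar> \<le> \<mu>" for i j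
      using component_le_norm_cart[of "w' v (axis j 1) - axis j 1" i] w'[OF v, of "axis j 1"] by (simp add: M_def)
    then have "\<bar>det (mat 1 + M) - 1\<bar> \<le> \<bar>\<Sum>i\<in>UNIV. M $ i $ i\<bar> + 12 * \<mu>\<^sup>2"
      using \<mu> by (intro det_near_identity) auto
    also have "\<bar>\<Sum>i\<in>UNIV. M $ i $ i\<bar> \<le> \<tau>" using tr[OF v] by (simp add: M_def)
    finally show ?thesis unfolding J_def M by linarith
  qed
  (* The change of variables theorem is about vector-valued functions. *)
  let ?F = "\<lambda>u. vec (F u) :: real^1"
  have cF: "continuous_on S ?F" for S
    unfolding vec_def by (intro continuous_on_vec_lambda continuous_on_subset[OF F(1)]) auto
  have "?F absolutely_integrable_on (w ` D)"
    using D contw by (intro absolutely_integrable_on_compact compact_continuous_image cF)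
  moreover have "D \<in> sets lebesgue" by (simp add: D_def)
  moreover have "(w has_derivative w' v) (at v within D)" if "v \<in> D" for v
    using der[of v] that by (auto simp: inD intro: has_derivative_at_withinI)
  ultimately have cv: "(\<lambda>v. \<bar>J v\<bar> *\<^sub>R ?F (w v)) absolutely_integrable_on D"
      "integral D (\<lambda>v. \<bar>J v\<bar> *\<^sub>R ?F (w v)) = integral (w ` D) ?F"
    using has_absolute_integral_change_of_variables[of D w w' ?F "integral (w ` D) ?F"] inj
    unfolding J_def by blast+
  have zero: "?F u = 0" if "u \<notin> w ` D" for u
  proof (rule ccontr)
    assume "?F u \<noteq> 0"
    then have "norm u < W" using F(2)[of u] by (force simp: vec_eq_iff not_le)
    then show False
      using near_identity_image_superset[of V w a u] contw near V a that by (auto simp: D_def)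
  qed
  have zero': "?F u = 0" if "u \<notin> D" for u
    using that F(2)[of u] V a by (auto simp: inD vec_eq_iff)
  have "integral (w ` D) ?F = integral UNIV (\<lambda>u. if u \<in> w ` D then ?F u else 0)"
    by (simp add: integral_restrict_UNIV)
  also have "(\<lambda>u. if u \<in> w ` D then ?F u else 0) = (\<lambda>u. if u \<in> D then ?F u else 0)"
    using zero zero' by auto
  also have "integral UNIV \<dots> = integral D ?F" by (simp add: integral_restrict_UNIV)
  finally have "integral D (\<lambda>v. \<bar>J v\<bar> *\<^sub>R ?F (w v)) $ 1 = integral D ?F $ 1" using cv by simp
  moreover have iJ: "(\<lambda>v. \<bar>J v\<bar> *\<^sub>R ?F (w v)) integrable_on D" and iF': "?F integrable_on D"
    using cv(1) absolutely_integrable_on_compact[OF D(1) cF] by (auto simp: absolutely_integrable_on_def)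
  ultimately have eq: "integral D (\<lambda>v. \<bar>J v\<bar> * F (w v)) = integral D F"
    using integral_component_eq_cart[OF iJ, of 1] integral_component_eq_cart[OF iF', of 1] by simp
  have iJ': "(\<lambda>v. \<bar>J v\<bar> * F (w v)) integrable_on D" 
    using integrable_linear[OF iJ bounded_linear_vec_nth[of 1]] by (simp add: o_def)
  have iF: "F integrable_on D" and iFw: "(\<lambda>v. F (w v)) integrable_on D"
    using absolutely_integrable_on_compact[OF D(1), of F] absolutely_integrable_on_compact[OF D(1), of "\<lambda>v. F (w v)"]
      F(1) contw continuous_on_subset[OF F(1)] continuous_on_compose2[OF F(1) contw]
    by (auto simp: absolutely_integrable_on_def)
  have "integral D (\<lambda>v. F v - F (w v)) = integral D (\<lambda>v. \<bar>J v\<bar> * F (w v) - F (w v))"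
    using eq iF iFw iJ' by (simp add: Henstock_Kurzweil_Integration.integral_diff)
  also have "norm \<dots> \<le> integral D (\<lambda>v. b * (\<tau> + 12 * \<mu>\<^sup>2))"
  proof (rule Henstock_Kurzweil_Integration.integral_norm_bound_integral)
    fix v assume v: "v \<in> D"
    have "\<bar>\<bar>J v\<bar> - 1\<bar> * \<bar>F (w v)\<bar> \<le> (\<tau> + 12 * \<mu>\<^sup>2) * b"
      using J[OF v] F(3) b by (intro mult_mono) (auto intro: order_trans[OF abs_ge_zero])
    moreover have "\<bar>J v\<bar> * F (w v) - F (w v) = (\<bar>J v\<bar> - 1) * F (w v)" by (simp add: algebra_simps)
    ultimately show "norm (\<bar>J v\<bar> * F (w v) - F (w v)) \<le> b * (\<tau> + 12 * \<mu>\<^sup>2)"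
      by (simp only: real_norm_def abs_mult mult.commute)
  next
    show "(\<lambda>v. \<bar>J v\<bar> * F (w v) - F (w v)) integrable_on D"
      by (intro Henstock_Kurzweil_Integration.integrable_diff iJ' iFw)
    show "(\<lambda>v. b * (\<tau> + 12 * \<mu>\<^sup>2)) integrable_on D"
      by (intro integrable_on_const lmeasurable_compact D)
  qed
  also have "\<dots> = b * (\<tau> + 12 * \<mu>\<^sup>2) * measure lebesgue D"
    using lmeasure_integral[of D] D
      integral_mult_right[of D "b * (\<tau> + 12 * \<mu>\<^sup>2)" "\<lambda>_. 1::real"]
    by (simp add: lmeasurable_compact)
  finally show ?thesis by (simp add: D_def)
qed

section \<open>Transport of the solution along polygons\<close>

lemma inner_grad:
  fixes g :: "'a::euclidean_space \<Rightarrow> real"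
  assumes "(g has_derivative g') (at z)"
  shows "u \<bullet> grad g z = g' u"
proof -
  have lin: "linear g'" using assms has_derivative_linear by blast
  have "u \<bullet> grad g z = (\<Sum>b\<in>Basis. g' b * (u \<bullet> b))"
    using frechet_derivative_at[OF assms] by (simp add: grad_def inner_sum_right)
  also have "\<dots> = g' (\<Sum>b\<in>Basis. (u \<bullet> b) *\<^sub>R b)"
    by (simp add: linear_sum[OF lin] linear_scale[OF lin] mult.commute)
  also have "(\<Sum>b\<in>Basis. (u \<bullet> b) *\<^sub>R b) = u" by (rule euclidean_representation)
  finally show ?thesis .
qed

text \<open>By the chain rule, each term of the equation is the full derivative of \<open>f\<close> in one of the three
  component directions.\<close>

lemma transport_direction:
  fixes f :: "real \<Rightarrow> real^3 \<Rightarrow> real^3 \<Rightarrow> real"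
  assumes f': "((\<lambda>(t, x, v). f t x v) has_derivative f') (at (\<tau>, x, v) within {0..<T} \<times> UNIV \<times> UNIV)"
    and \<tau>: "\<tau> \<in> {0..<T}"
    and eq: "vector_derivative (\<lambda>s. f s x v) (at \<tau> within {0..<T}) + v \<bullet> grad (\<lambda>y. f \<tau> y v) x
        - b \<bullet> grad (f \<tau> x) v = 0"
  shows "f' (1, v, - b) = 0"
proof -
  let ?S = "{0..<T} \<times> UNIV \<times> (UNIV :: (real^3) set)"
  have lin: "linear f'" using f' has_derivative_linear by blast
  have chain: "((\<lambda>s. (\<lambda>(t, x, v). f t x v) (h s)) has_derivative (\<lambda>k. f' (h' k))) (at a within D)"
    if "(h has_derivative h') (at a within D)" "h a = (\<tau>, x, v)" "h ` D \<subseteq> ?S" for h h' a D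
  proof -
    have "((\<lambda>(t, x, v). f t x v) has_derivative f') (at (h a) within h ` D)"
      unfolding that(2) by (rule has_derivative_subset[OF f' that(3)])
    from has_derivative_in_compose[OF that(1) this] show ?thesis .
  qed
  have "((\<lambda>s. f s x v) has_derivative (\<lambda>k. f' (k, 0, 0))) (at \<tau> within {0..<T})"
  proof -
    have h: "((\<lambda>s. (s, x, v)) has_derivative (\<lambda>k. (k, 0, 0))) (at \<tau> within {0..<T})"
      by (intro has_derivative_Pair has_derivative_ident has_derivative_const)
    have sub: "(\<lambda>s. (s, x, v)) ` {0..<T} \<subseteq> ?S" by blast
    show ?thesis using chain[OF h _ sub] by simp
  qed
  moreover have "(\<lambda>k. f' (k, 0, 0)) = (\<lambda>k. k *\<^sub>R f' (1, 0, 0))"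
  proof
    show "f' (k, 0, 0) = k *\<^sub>R f' (1, 0, 0)" for k
      using linear_scale[OF lin, of k "(1, 0, 0)"] by simp
  qed
  ultimately have "((\<lambda>s. f s x v) has_vector_derivative f' (1, 0, 0)) (at \<tau> within {0..<T})"
    unfolding has_vector_derivative_def by (simp only:)
  moreover have "at \<tau> within {0..<T} \<noteq> bot"
  proof -
    have "\<tau> islimpt {0..<T}"
      using \<tau> islimpt_subset[of \<tau> "{\<tau>..<T}" "{0..<T}"] islimpt_Ico[of \<tau> T \<tau>] by auto
    then show ?thesis by (simp add: trivial_limit_within)
  qed
  ultimately have 1: "vector_derivative (\<lambda>s. f s x v) (at \<tau> within {0..<T}) = f' (1, 0, 0)"
    by (rule vector_derivative_within[rotated])
  have "((\<lambda>y. f \<tau> y v) has_derivative (\<lambda>k. f' (0, k, 0))) (at x)"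
  proof -
    have h: "((\<lambda>y. (\<tau>, y, v)) has_derivative (\<lambda>k. (0, k, 0))) (at x)"
      by (intro has_derivative_Pair has_derivative_ident has_derivative_const)
    have sub: "(\<lambda>y. (\<tau>, y, v)) ` UNIV \<subseteq> ?S" using \<tau> by blast
    show ?thesis using chain[OF h _ sub] by simp
  qed
  then have 2: "v \<bullet> grad (\<lambda>y. f \<tau> y v) x = f' (0, v, 0)" by (rule inner_grad)
  have "(f \<tau> x has_derivative (\<lambda>k. f' (0, 0, k))) (at v)"
  proof -
    have h: "((\<lambda>w. (\<tau>, x, w)) has_derivative (\<lambda>k. (0, 0, k))) (at v)"
      by (intro has_derivative_Pair has_derivative_ident has_derivative_const)
    have sub: "(\<lambda>w. (\<tau>, x, w)) ` UNIV \<subseteq> ?S" using \<tau> by blast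
    show ?thesis using chain[OF h _ sub] by simp
  qed
  then have 3: "b \<bullet> grad (f \<tau> x) v = f' (0, 0, b)" by (rule inner_grad)
  have "f' (1, v, - b) = f' (1, 0, 0) + f' (0, v, 0) - f' (0, 0, b)"
    using linear_add[OF lin, of "(1, 0, 0)" "(0, v, 0)"] linear_diff[OF lin, of "(1, v, 0)" "(0, 0, b)"]
    by simp
  then show ?thesis using eq 1 2 3 by simp
qed

text \<open>The derivative of \<open>f\<close> at the start of the step vanishes in the direction of the step, and along the
  step it varies little by uniform continuity on a compact set. Therefore a bound on \<open>B\<close> suffices, however rough
  \<open>B\<close> is in time.\<close>

lemma transport_euler_step:
  fixes f :: "real \<Rightarrow> real^3 \<Rightarrow> real^3 \<Rightarrow> real"
  assumes C1: "C1_on ({0..<T} \<times> UNIV \<times> UNIV) (\<lambda>(t, x, v). f t x v)"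
    and eq: "\<And>\<tau> x v. \<tau> \<in> {0..<T} \<Longrightarrow> vector_derivative (\<lambda>s. f s x v) (at \<tau> within {0..<T})
        + v \<bullet> grad (\<lambda>y. f \<tau> y v) x - B \<tau> x \<bullet> grad (f \<tau> x) v = 0"
    and t: "t < T" and B: "\<And>\<tau> x. \<tau> \<in> {0..t} \<Longrightarrow> norm (B \<tau> x) \<le> M" and M: "0 \<le> M"
    and r: "0 \<le> r" and e: "0 < e"
  obtains d where "0 < d" "\<And>\<tau> \<delta> x v. \<lbrakk>\<tau> \<in> {0..t}; 0 \<le> \<delta>; \<delta> \<le> d; \<delta> \<le> \<tau>; norm x \<le> r; norm v \<le> r\<rbrakk> \<Longrightarrow>
      \<bar>f (\<tau> - \<delta>) (x - \<delta> *\<^sub>R v) (v + \<delta> *\<^sub>R B \<tau> x) - f \<tau> x v\<bar> \<le> e * \<delta>"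
proof -
  let ?f = "\<lambda>(t, x, v). f t x v" and ?S = "{0..<T} \<times> UNIV \<times> (UNIV :: (real^3) set)"
  obtain f' :: "real \<times> (real^3) \<times> (real^3) \<Rightarrow> (real \<times> (real^3) \<times> (real^3)) \<Rightarrow>\<^sub>L real"
    where f': "\<And>z. z \<in> ?S \<Longrightarrow> (?f has_derivative blinfun_apply (f' z)) (at z within ?S)"
      and cont: "continuous_on ?S f'"
    using C1 unfolding C1_on_def by blast
  define l where "l = 1 + r + M"
  have l: "l > 0" using r M by (simp add: l_def)
  define K where "K = {0..t} \<times> cball (0::real^3) (r + l) \<times> cball (0::real^3) (r + l)"
  have "compact K" unfolding K_def by (intro compact_Times compact_Icc compact_cball)
  moreover have "continuous_on K f'"
    using t by (intro continuous_on_subset[OF cont]) (auto simp: K_def)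
  ultimately have "uniformly_continuous_on K f'" by (rule compact_uniformly_continuous[rotated])
  then obtain d' where d': "d' > 0" "\<And>z z'. \<lbrakk>z \<in> K; z' \<in> K; dist z' z < d'\<rbrakk> \<Longrightarrow> dist (f' z') (f' z) < e / l"
    using divide_pos_pos[OF e l] unfolding uniformly_continuous_on_def by blast
  define d where "d = min 1 (d' / (2 * l))"
  have d: "d > 0" using d' l by (simp add: d_def)
  show thesis
  proof (rule that[OF d])
    fix \<tau> \<delta> :: real and x v :: "real^3"
    assume \<tau>: "\<tau> \<in> {0..t}" and \<delta>: "0 \<le> \<delta>" "\<delta> \<le> d" "\<delta> \<le> \<tau>" and xv: "norm x \<le> r" "norm v \<le> r"
    define a where "a = (\<tau>, x, v)"
    define b where "b = (\<tau> - \<delta>, x - \<delta> *\<^sub>R v, v + \<delta> *\<^sub>R B \<tau> x)"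
    have ba: "b - a = - \<delta> *\<^sub>R (1, v, - B \<tau> x)" by (simp add: a_def b_def)
    have len: "norm (1::real, v, - B \<tau> x) \<le> l"
      using norm_Pair_le[of "1::real" "(v, - B \<tau> x)"] norm_Pair_le[of v "- B \<tau> x"] B[OF \<tau>, of x] xv
      by (simp add: l_def)
    then have nba: "norm (b - a) \<le> \<delta> * l" unfolding ba norm_scaleR using \<delta> by (simp add: mult_left_mono)
    have aK: "a \<in> K" using \<tau> xv l by (auto simp: a_def K_def)
    have seg: "a + s *\<^sub>R (b - a) \<in> K" "dist (a + s *\<^sub>R (b - a)) a < d'" if s: "s \<in> {0..1}" for s
    proof -
      have sd: "s * \<delta> \<le> \<delta>" "0 \<le> s * \<delta>" using s \<delta> by (auto intro: mult_left_le_one_le)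
      have p: "a + s *\<^sub>R (b - a) = (\<tau> - s * \<delta>, x - (s * \<delta>) *\<^sub>R v, v + (s * \<delta>) *\<^sub>R B \<tau> x)"
        unfolding ba unfolding a_def
        by (simp only: scaleR_Pair add_Pair scaleR_scaleR prod.inject) (simp add: algebra_simps)
      have "s * \<delta> \<le> 1" using sd \<delta> by (simp add: d_def)
      then have "(s * \<delta>) * norm v \<le> 1 * r" "(s * \<delta>) * norm (B \<tau> x) \<le> 1 * M"
        using sd xv B[OF \<tau>, of x] by (intro mult_mono; simp)+
      then have "norm ((s * \<delta>) *\<^sub>R v) \<le> l" "norm ((s * \<delta>) *\<^sub>R B \<tau> x) \<le> l"
        unfolding norm_scaleR abs_of_nonneg[OF sd(2)] using M r by (simp_all add: l_def)
      then have "norm (x - (s * \<delta>) *\<^sub>R v) \<le> r + l" "norm (v + (s * \<delta>) *\<^sub>R B \<tau> x) \<le> r + l"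
        using xv norm_triangle_ineq4[of x "(s * \<delta>) *\<^sub>R v"] norm_triangle_ineq[of v "(s * \<delta>) *\<^sub>R B \<tau> x"] by linarith+
      then show "a + s *\<^sub>R (b - a) \<in> K" using \<tau> sd \<delta> unfolding p by (auto simp: K_def)
      have "dist (a + s *\<^sub>R (b - a)) a = s * norm (b - a)" using s by (simp only: dist_norm add_diff_cancel_left' norm_scaleR) simp
      also have "\<dots> \<le> 1 * (\<delta> * l)" using s nba by (intro mult_mono) auto
      also have "\<dots> < d'"
      proof -
        have "\<delta> \<le> d' / (2 * l)" using \<delta> by (simp add: d_def)
        then have "\<delta> * l \<le> d' / 2" using l by (simp add: field_simps)
        then show ?thesis using d' by simp
      qed
      finally show "dist (a + s *\<^sub>R (b - a)) a < d'" .
    qed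
    define G where "G = (\<lambda>s. a + s *\<^sub>R (b - a)) ` {0..1}"
    have GS: "G \<subseteq> ?S" using seg(1) t by (force simp: G_def K_def)
    have "norm (?f b - ?f a - f' a (b - a)) \<le> norm (b - a) * (e / l)"
    proof (rule differentiable_bound_linearization[where S=G and f'="\<lambda>z. blinfun_apply (f' z)"])
      show "a + s *\<^sub>R (b - a) \<in> G" if "s \<in> {0..1}" for s using that by (auto simp: G_def)
      show "(?f has_derivative blinfun_apply (f' z)) (at z within G)" if "z \<in> G" for z
        using that GS by (intro has_derivative_subset[OF f' GS]) auto
      show "onorm (blinfun_apply (f' z) - blinfun_apply (f' a)) \<le> e / l" if "z \<in> G" for z
      proof -
        have "blinfun_apply (f' z) - blinfun_apply (f' a) = blinfun_apply (f' z - f' a)"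
          by (auto simp: blinfun.diff_left)
        moreover have "norm (f' z - f' a) < e / l"
          using d'(2)[OF aK seg(1)] seg(2) that unfolding G_def dist_norm by blast
        ultimately show ?thesis by (simp add: norm_blinfun.rep_eq)
      qed
      show "a \<in> G" unfolding G_def by (rule image_eqI[of _ _ 0]) auto
    qed
    moreover have "f' a (b - a) = 0"
    proof -
      have "f' a (1, v, - B \<tau> x) = 0"
        unfolding a_def using \<tau> t by (intro transport_direction[OF f' _ eq]) auto
      then show ?thesis unfolding ba blinfun.scaleR_right by simp
    qed
    ultimately have "\<bar>?f b - ?f a\<bar> \<le> norm (b - a) * (e / l)" by simp
    also have "\<dots> \<le> \<delta> * l * (e / l)" using nba e l by (intro mult_right_mono) auto
    finally show "\<bar>f (\<tau> - \<delta>) (x - \<delta> *\<^sub>R v) (v + \<delta> *\<^sub>R B \<tau> x) - f \<tau> x v\<bar> \<le> e * \<delta>"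
      using l by (simp add: a_def b_def mult.commute)
  qed
qed

text \<open>With \<open>n\<close> steps of size \<open>\<tau> / n\<close>, the errors of size \<open>o(1 / n)\<close> add up to \<open>o(1)\<close>. The rate is uniform for
  starting points in a ball because all vertices stay in a larger ball.\<close>

lemma transport_along_polygon:
  fixes f :: "real \<Rightarrow> real^3 \<Rightarrow> real^3 \<Rightarrow> real"
  assumes C1: "C1_on ({0..<T} \<times> UNIV \<times> UNIV) (\<lambda>(t, x, v). f t x v)"
    and eq: "\<And>\<tau> x v. \<tau> \<in> {0..<T} \<Longrightarrow> vector_derivative (\<lambda>s. f s x v) (at \<tau> within {0..<T})
        + v \<bullet> grad (\<lambda>y. f \<tau> y v) x - B \<tau> x \<bullet> grad (f \<tau> x) v = 0"
    and t: "0 \<le> t" "t < T" and B: "\<And>\<tau> x. \<tau> \<in> {0..t} \<Longrightarrow> norm (B \<tau> x) \<le> M" and M: "0 \<le> M"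
    and r: "0 \<le> r" and e: "0 < e"
  obtains n0 :: nat where "0 < n0" "\<And>n \<tau> x v. \<lbrakk>n0 \<le> n; \<tau> \<in> {0..t}; norm x \<le> r; norm v \<le> r\<rbrakk> \<Longrightarrow>
      \<bar>f \<tau> x v - (\<lambda>(y, w). f 0 y w) (euler (\<lambda>k. B (\<tau> - k * (\<tau> / n))) (\<tau> / n) (x, v) n)\<bar> \<le> e"
proof -
  define r' where "r' = r + t * M + t * (r + t * M)"
  have r': "0 \<le> r'" using r t M by (simp add: r'_def)
  define e' where "e' = e / (1 + t)"
  have e': "e' > 0" using e t by (simp add: e'_def)
  obtain d where d: "0 < d" and step: "\<And>\<tau> \<delta> x v. \<lbrakk>\<tau> \<in> {0..t}; 0 \<le> \<delta>; \<delta> \<le> d; \<delta> \<le> \<tau>; norm x \<le> r'; norm v \<le> r'\<rbrakk> \<Longrightarrow>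
      \<bar>f (\<tau> - \<delta>) (x - \<delta> *\<^sub>R v) (v + \<delta> *\<^sub>R B \<tau> x) - f \<tau> x v\<bar> \<le> e' * \<delta>"
    by (rule transport_euler_step[OF C1 eq t(2) B M r' e']) blast+
  obtain n0 :: nat where n0: "t / d < n0" using reals_Archimedean2 by blast
  show thesis
  proof (rule that[of "Suc n0"])
    fix n \<tau> and x v :: "real^3"
    assume n: "Suc n0 \<le> n" and \<tau>: "\<tau> \<in> {0..t}" and xv: "norm x \<le> r" "norm v \<le> r"
    define \<delta> where "\<delta> = \<tau> / n"
    have npos: "real n > 0" using n by simp
    have \<delta>: "0 \<le> \<delta>" "n * \<delta> = \<tau>" using \<tau> npos by (auto simp: \<delta>_def)
    have "\<delta> \<le> t / n" using \<tau> npos by (auto simp: \<delta>_def divide_right_mono)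
    also have "t / n \<le> d"
    proof -
      have "t / d \<le> n" using n0 n by linarith
      then show ?thesis using d npos by (simp add: field_simps)
    qed
    finally have \<delta>d: "\<delta> \<le> d" .
    let ?B = "\<lambda>k. B (\<tau> - k * \<delta>)"
    let ?z = "euler ?B \<delta> (x, v)"
    have time: "\<tau> - real k * \<delta> \<in> {0..t}" if "k \<le> n" for k
    proof -
      have "real k * \<delta> \<le> real n * \<delta>" using that \<delta> by (intro mult_right_mono) auto
      moreover have "0 \<le> real k * \<delta>" using \<delta> by simp
      ultimately show ?thesis using \<delta>(2) \<tau> unfolding atLeastAtMost_iff by linarith
    qed
    have nt: "real n * \<delta> \<le> t" using \<delta> \<tau> by simp
    have growth: "norm (fst (?z k)) \<le> r'" "norm (snd (?z k)) \<le> r'" if "k \<le> n" for k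
    proof -
      have BM: "\<And>k y. k < n \<Longrightarrow> norm (?B k y) \<le> M" using B time by simp
      have V: "norm (snd (?z k) - v) \<le> t * M" and X: "norm (fst (?z k) - x) \<le> t * (norm v + t * M)"
        using euler_growth[of \<delta> n ?B M t k "(x, v)", OF \<delta>(1) BM nt M that] by auto
      have tr: "t * (norm v + t * M) \<le> t * (r + t * M)" using t xv by (intro mult_left_mono) auto
      have pos: "0 \<le> t * M" "0 \<le> t * (r + t * M)" using t M r by auto
      show "norm (fst (?z k)) \<le> r'" "norm (snd (?z k)) \<le> r'"
        using V X tr pos xv norm_triangle_sub[of "fst (?z k)" x] norm_triangle_sub[of "snd (?z k)" v]
        by (simp_all add: r'_def)
    qed
    have "\<bar>f \<tau> x v - f (\<tau> - k * \<delta>) (fst (?z k)) (snd (?z k))\<bar> \<le> e' * (k * \<delta>)" if "k \<le> n" for k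
      using that
    proof (induction k)
      case (Suc k)
      have "\<delta> \<le> \<tau> - k * \<delta>"
        using time[OF Suc.prems] by (simp add: algebra_simps)
      then have "\<bar>f (\<tau> - k * \<delta> - \<delta>) (fst (?z (Suc k))) (snd (?z (Suc k))) - f (\<tau> - k * \<delta>) (fst (?z k)) (snd (?z k))\<bar> \<le> e' * \<delta>"
        using step[of "\<tau> - k * \<delta>" \<delta> "fst (?z k)" "snd (?z k)"] time[of k] \<delta> \<delta>d growth[of k] Suc.prems by simp
      moreover have "\<tau> - k * \<delta> - \<delta> = \<tau> - Suc k * \<delta>" by (simp add: algebra_simps)
      ultimately show ?case using Suc by (simp add: algebra_simps)
    qed simp
    from this[of n] have "\<bar>f \<tau> x v - f 0 (fst (?z n)) (snd (?z n))\<bar> \<le> e' * \<tau>" using \<delta> by simp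
    also have "\<dots> \<le> e"
    proof -
      have "e' * \<tau> \<le> e' * (1 + t)" using \<tau> e' by (intro mult_left_mono) auto
      also have "\<dots> = e" using t by (simp add: e'_def)
      finally show ?thesis .
    qed
    finally show "\<bar>f \<tau> x v - (\<lambda>(y, w). f 0 y w) (euler (\<lambda>k. B (\<tau> - k * (\<tau> / n))) (\<tau> / n) (x, v) n)\<bar> \<le> e"
      by (simp add: \<delta>_def case_prod_beta)
  qed simp
qed

section \<open>From an integral inequality to sixth-power decay\<close>

lemma R_triangle: "R x \<le> R y + norm (y - x)"
proof -
  have "R x \<le> sqrt (1\<^sup>2 + (norm y + norm (y - x))\<^sup>2)"
    unfolding R_def using norm_triangle_sub[of x y] by (auto simp: norm_minus_commute intro!: power_mono)
  also have "\<dots> \<le> sqrt (1\<^sup>2 + (norm y)\<^sup>2) + sqrt (0\<^sup>2 + (norm (y - x))\<^sup>2)"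
    using real_sqrt_sum_squares_triangle_ineq[of 1 0 "norm y" "norm (y - x)"] by simp
  finally show ?thesis by (simp add: R_def)
qed

lemma R_ge_norm: "norm x \<le> R x"
  by (simp add: R_def real_le_rsqrt)

lemma R_half_le: "norm x \<le> 2 * norm y \<Longrightarrow> R x \<le> 2 * R y"
proof -
  assume "norm x \<le> 2 * norm y"
  then have "(norm x)\<^sup>2 \<le> (2 * norm y)\<^sup>2" by (intro power_mono) auto
  then have "1 + (norm x)\<^sup>2 \<le> 2\<^sup>2 * (1 + (norm y)\<^sup>2)" by (simp add: power_mult_distrib)
  then have "R x \<le> sqrt (2\<^sup>2 * (1 + (norm y)\<^sup>2))" unfolding R_def by (rule real_sqrt_le_mono)
  also have "\<dots> = 2 * R y" by (simp only: real_sqrt_mult real_sqrt_abs R_def abs_numeral)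
  finally show ?thesis .
qed

lemma R_le_2_norm: "1 \<le> norm x \<Longrightarrow> R x \<le> 2 * norm x"
proof -
  assume "1 \<le> norm x"
  then have "1 \<le> (norm x)\<^sup>2" by simp
  then have "1 + (norm x)\<^sup>2 \<le> (2 * norm x)\<^sup>2" by (simp add: power_mult_distrib)
  then show ?thesis unfolding R_def by (intro real_le_lsqrt) auto
qed

text \<open>A Riemann sum for the integral of \<open>exp (- \<omega> s)\<close>, which is at most \<open>1 / \<omega>\<close>; the factor \<open>2\<close> pays for
  the step size.\<close>

lemma geometric_riemann_sum_le:
  fixes \<delta> \<omega> :: real
  assumes "0 \<le> \<delta>" "0 < \<omega>" "\<omega> * \<delta> \<le> 1"
  shows "\<delta> * (\<Sum>k<n. exp (- (\<omega> * (real k * \<delta>)))) \<le> 2 / \<omega>"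
proof (cases "\<delta> = 0")
  case False
  then have \<delta>: "\<delta> > 0" using assms by simp
  define q where "q = exp (- (\<omega> * \<delta>))"
  have q: "0 < q" "q < 1" using assms \<delta> by (auto simp: q_def)
  have pow: "exp (- (\<omega> * (real k * \<delta>))) = q ^ k" for k :: nat
    by (simp add: q_def exp_of_nat_mult[symmetric] mult_ac)
  have "q = 1 / exp (\<omega> * \<delta>)" by (simp add: q_def exp_minus divide_inverse)
  also have "\<dots> \<le> 1 / (1 + \<omega> * \<delta>)"
    using assms \<delta> exp_ge_add_one_self[of "\<omega> * \<delta>"] by (intro divide_left_mono mult_pos_pos add_pos_pos) auto
  finally have q_le: "q \<le> 1 / (1 + \<omega> * \<delta>)" .
  have "\<omega> * \<delta> / (1 + \<omega> * \<delta>) \<le> 1 - q"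
  proof -
    have "1 + \<omega> * \<delta> > 0" using assms \<delta> by (intro add_pos_pos mult_pos_pos) auto
    then have "\<omega> * \<delta> / (1 + \<omega> * \<delta>) = 1 - 1 / (1 + \<omega> * \<delta>)" by (simp add: field_simps)
    then show ?thesis using q_le by simp
  qed
  moreover have "\<omega> * \<delta> / (1 + \<omega> * \<delta>) \<ge> \<omega> * \<delta> / 2"
    using assms \<delta> by (intro divide_left_mono) (auto intro!: mult_pos_pos add_pos_pos)
  ultimately have gap: "\<omega> * \<delta> / 2 \<le> 1 - q" by linarith
  have "(\<Sum>k<n. q ^ k) * (1 - q) = 1 - q ^ n" by (simp add: one_diff_power_eq mult.commute)
  also have "\<dots> \<le> 1" using q by simp
  finally have "(\<Sum>k<n. q ^ k) * (1 - q) \<le> 1" .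
  moreover have "(\<Sum>k<n. q ^ k) * (\<omega> * \<delta> / 2) \<le> (\<Sum>k<n. q ^ k) * (1 - q)"
    using gap q by (intro mult_left_mono sum_nonneg) auto
  ultimately show ?thesis using assms unfolding pow by (simp add: field_simps)
qed (use assms in auto)

text \<open>Gronwall's argument. The supremum \<open>D\<close> of \<open>u\<close> times \<open>w\<close> times \<open>exp (- \<omega> s)\<close>, where the weight \<open>w\<close> is
  the sixth power of \<open>R\<close> cut off at its value in the point of interest, satisfies \<open>D \<le> const + D / 2\<close> for large
  \<open>\<omega>\<close>. The cutoff makes \<open>D\<close> finite at the outset; without it the inequality would say nothing. Sums over
  discrete times stand in for the time integral of \<open>u\<close>, which might not be measurable.\<close>

lemma decay_propagation:
  fixes u :: "real \<Rightarrow> real^3 \<Rightarrow> real"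
  assumes t: "0 \<le> t" and C: "0 \<le> C" and c: "0 \<le> c" and L: "0 \<le> L"
    and u: "\<And>\<tau> x. \<tau> \<in> {0..t} \<Longrightarrow> 0 \<le> u \<tau> x \<and> u \<tau> x \<le> S"
    and ineq: "\<And>\<tau> x e. \<lbrakk>\<tau> \<in> {0..t}; L \<le> norm x; 0 < e\<rbrakk> \<Longrightarrow> \<exists>n0. \<forall>n\<ge>n0. \<forall>\<sigma>. n > 0 \<longrightarrow>
        (\<forall>k<n. \<forall>y. norm (y - x) \<le> c \<longrightarrow> u (\<tau> - real k * (\<tau> / real n)) y \<le> \<sigma> k) \<longrightarrow>
        u \<tau> x \<le> C * R x powr - 6 + e + C * (\<tau> / real n * (\<Sum>k<n. \<sigma> k))"
    and \<tau>: "\<tau> \<in> {0..t}"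
  shows "u \<tau> x * R x ^ 6 \<le> 2 * (S * (1 + L) ^ 6 + C) * exp ((4 * C * (1 + c) ^ 6 + 1) * t)"
proof -
  define \<kappa> where "\<kappa> = (1 + c) ^ 6"
  (* kappa compares the weight at two points of distance at most c; with this omega the sums over
     past times contribute at most D / 2. *)
  define \<omega> where "\<omega> = 4 * C * \<kappa> + 1"
  define w where "w y = min (R y ^ 6) (R x ^ 6)" for y
  define Q where "Q = (\<lambda>(s, y). u s y * w y * exp (- (\<omega> * s))) ` ({0..t} \<times> UNIV)"
  define D where "D = Sup Q"
  have \<kappa>: "1 \<le> \<kappa>" using c by (simp add: \<kappa>_def one_le_power)
  have \<omega>: "0 < \<omega>" using C \<kappa> by (simp add: \<omega>_def add_nonneg_pos)
  have S: "0 \<le> S" using u[of 0 0] t by auto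
  have w: "0 < w y" "w y \<le> R y ^ 6" "w y \<le> R x ^ 6" for y by (auto simp: w_def)
  have w_mono: "w y \<le> \<kappa> * w z" if "norm (z - y) \<le> c" for y z
  proof -
    have "R y \<le> R z + c" using R_triangle[of y z] that by simp
    also have "\<dots> \<le> (1 + c) * R z" using R_ge_1[of z] c mult_left_mono[of 1 "R z" c] by (simp add: algebra_simps)
    finally have "R y ^ 6 \<le> ((1 + c) * R z) ^ 6" by (intro power_mono) (auto intro: less_imp_le)
    then have "R y ^ 6 \<le> \<kappa> * R z ^ 6" by (simp add: \<kappa>_def power_mult_distrib)
    moreover have "R x ^ 6 \<le> \<kappa> * R x ^ 6" using \<kappa> mult_right_mono[of 1 \<kappa> "R x ^ 6"] by simp
    moreover have "\<kappa> * min (R z ^ 6) (R x ^ 6) = min (\<kappa> * R z ^ 6) (\<kappa> * R x ^ 6)"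
      using \<kappa> by (simp add: min_mult_distrib_left)
    ultimately show ?thesis unfolding w_def by (simp only: min.mono)
  qed
  have bdd: "bdd_above Q"
  proof (rule bdd_aboveI)
    fix z assume "z \<in> Q"
    then obtain s y where z: "z = u s y * w y * exp (- (\<omega> * s))" and s: "s \<in> {0..t}" by (auto simp: Q_def)
    have "u s y * w y * exp (- (\<omega> * s)) \<le> S * R x ^ 6 * 1"
      using u[OF s, of y] w[of y] s \<omega> S by (intro mult_mono) (auto intro: less_imp_le)
    then show "z \<le> S * R x ^ 6" by (simp add: z)
  qed
  have le_D: "u s y \<le> D * exp (\<omega> * s) / w y" if "s \<in> {0..t}" for s y
  proof -
    have "u s y * w y * exp (- (\<omega> * s)) \<le> D"
      unfolding D_def using that by (intro cSup_upper bdd) (auto simp: Q_def)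
    then show ?thesis using w(1)[of y] by (simp add: exp_minus field_simps)
  qed
  have D: "0 \<le> D"
  proof -
    have "0 \<le> u 0 0 * w 0 * exp (- (\<omega> * 0))" using u[of 0 0] t w(1)[of 0] by simp
    also have "\<dots> \<le> D" unfolding D_def
      by (intro cSup_upper bdd) (unfold Q_def, rule image_eqI[of _ _ "(0, 0)"], use t in auto)
    finally show ?thesis .
  qed
  have step: "u s y * w y * exp (- (\<omega> * s)) \<le> S * (1 + L) ^ 6 + C + D / 2" if s: "s \<in> {0..t}" for s y
  proof (cases "norm y < L")
    case True
    have "R y \<le> 1 + L" using R_triangle[of y 0] True by (simp add: R_def)
    then have "w y \<le> (1 + L) ^ 6" using w(2)[of y] power_mono[of "R y" "1 + L" 6] by (simp add: less_imp_le)
    then have "u s y * w y * exp (- (\<omega> * s)) \<le> S * (1 + L) ^ 6 * 1"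
      using u[OF s, of y] w(1)[of y] s \<omega> S L by (intro mult_mono) (auto intro: less_imp_le)
    then show ?thesis using C D by simp
  next
    case False
    show ?thesis
    proof (rule field_le_epsilon)
      fix e :: real assume e: "0 < e"
      define e' where "e' = e / w y"
      have e': "0 < e'" using e w(1)[of y] by (simp add: e'_def)
      obtain n0 where n0: "\<forall>n\<ge>n0. \<forall>\<sigma>. n > 0 \<longrightarrow>
        (\<forall>k<n. \<forall>z. norm (z - y) \<le> c \<longrightarrow> u (s - real k * (s / real n)) z \<le> \<sigma> k) \<longrightarrow>
        u s y \<le> C * R y powr - 6 + e' + C * (s / real n * (\<Sum>k<n. \<sigma> k))"
        using ineq[OF s _ e', of y] False by auto
      obtain n1 :: nat where n1: "\<omega> * s < n1" using reals_Archimedean2 by blast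
      define n where "n = Suc (max n0 n1)"
      define \<delta> where "\<delta> = s / n"
      have npos: "0 < n" by (simp add: n_def)
      have \<delta>: "0 \<le> \<delta>" using s by (simp add: \<delta>_def)
      have \<omega>_step: "\<omega> * \<delta> \<le> 1" using n1 npos by (simp add: \<delta>_def n_def)
      define \<sigma> where "\<sigma> k = \<kappa> * D * exp (\<omega> * s) / w y * exp (- (\<omega> * (real k * \<delta>)))" for k :: nat
      have "u (s - k * \<delta>) z \<le> \<sigma> k" if "k < n" "norm (z - y) \<le> c" for k z
      proof -
        have "real k * \<delta> \<le> real n * \<delta>" using that \<delta> by (intro mult_right_mono) auto
        then have "real k * \<delta> \<le> s" using npos by (simp add: \<delta>_def)
        moreover have "0 \<le> real k * \<delta>" using \<delta> by simp
        ultimately have "s - k * \<delta> \<in> {0..t}" using s by auto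
        then have "u (s - k * \<delta>) z \<le> D * exp (\<omega> * (s - k * \<delta>)) / w z" by (rule le_D)
        also have "\<dots> \<le> D * exp (\<omega> * (s - k * \<delta>)) / (w y / \<kappa>)"
          using w_mono[OF that(2)] w(1)[of y] w(1)[of z] \<kappa> D
          by (intro divide_left_mono mult_pos_pos divide_pos_pos) (auto simp: field_simps)
        also have "\<dots> = \<sigma> k"
          by (simp add: \<sigma>_def exp_diff exp_minus right_diff_distrib field_simps)
        finally show ?thesis .
      qed
      then have "u s y \<le> C * R y powr - 6 + e' + C * (\<delta> * (\<Sum>k<n. \<sigma> k))"
        using n0[rule_format, of n \<sigma>] npos by (simp add: \<delta>_def n_def)
      also have "\<delta> * (\<Sum>k<n. \<sigma> k) = \<kappa> * D * exp (\<omega> * s) / w y * (\<delta> * (\<Sum>k<n. exp (- (\<omega> * (real k * \<delta>)))))"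
        by (simp add: \<sigma>_def sum_distrib_left mult_ac)
      also have "C * \<dots> \<le> C * (\<kappa> * D * exp (\<omega> * s) / w y * (2 / \<omega>))"
        using geometric_riemann_sum_le[OF \<delta> \<omega> \<omega>_step] C D \<kappa> w(1)[of y] by (intro mult_left_mono) auto
      also have "\<dots> = (2 * C * \<kappa> / \<omega>) * (D * exp (\<omega> * s) / w y)" by (simp add: mult_ac)
      also have "\<dots> \<le> 1 / 2 * (D * exp (\<omega> * s) / w y)"
        using D w(1)[of y] \<omega> C \<kappa> by (intro mult_right_mono) (auto simp: \<omega>_def field_simps intro: divide_nonneg_pos)
      finally have "u s y \<le> C * R y powr - 6 + e' + 1 / 2 * (D * exp (\<omega> * s) / w y)" by simp
      then have "u s y * w y \<le> (C * R y powr - 6 + e' + 1 / 2 * (D * exp (\<omega> * s) / w y)) * w y"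
        using w(1)[of y] by (intro mult_right_mono) auto
      also have "\<dots> = C * (R y powr - 6 * w y) + e + D / 2 * exp (\<omega> * s)"
        using w(1)[of y] by (simp add: e'_def field_simps)
      also have "R y powr - 6 * w y \<le> 1"
      proof -
        have "R y powr - 6 * w y \<le> R y powr - 6 * R y ^ 6" using w(2)[of y] by (intro mult_left_mono) auto
        also have "\<dots> = 1" by (simp add: powr_minus powr_numeral less_imp_le)
        finally show ?thesis .
      qed
      finally have "u s y * w y \<le> C + e + D / 2 * exp (\<omega> * s)" using C by (simp add: mult_left_mono)
      then have "u s y * w y * exp (- (\<omega> * s)) \<le> (C + e + D / 2 * exp (\<omega> * s)) * exp (- (\<omega> * s))"
        by (intro mult_right_mono) auto
      also have "\<dots> = (C + e) * exp (- (\<omega> * s)) + D / 2" by (simp add: exp_minus field_simps)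
      also have "(C + e) * exp (- (\<omega> * s)) \<le> (C + e) * 1" using C e \<omega> s by (intro mult_left_mono) auto
      finally have "u s y * w y * exp (- (\<omega> * s)) \<le> C + e + D / 2" by simp
      moreover have "0 \<le> S * (1 + L) ^ 6" using S L by simp
      ultimately show "u s y * w y * exp (- (\<omega> * s)) \<le> S * (1 + L) ^ 6 + C + D / 2 + e"
        by linarith
    qed
  qed
  have "Sup Q \<le> S * (1 + L) ^ 6 + C + D / 2"
    using step t by (intro cSup_least) (auto simp: Q_def)
  then have "D \<le> 2 * (S * (1 + L) ^ 6 + C)" by (simp add: D_def[symmetric])
  moreover have "u \<tau> x \<le> D * exp (\<omega> * \<tau>) / w x" using \<tau> by (rule le_D)
  then have "u \<tau> x * R x ^ 6 \<le> D * exp (\<omega> * \<tau>)" by (simp add: w_def field_simps)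
  moreover have "exp (\<omega> * \<tau>) \<le> exp (\<omega> * t)" using \<tau> \<omega> by simp
  ultimately show ?thesis
    using D mult_mono[of D "2 * (S * (1 + L) ^ 6 + C)" "exp (\<omega> * \<tau>)" "exp (\<omega> * t)"]
    by (simp add: \<omega>_def \<kappa>_def)
qed

section \<open>The density far away from the origin\<close>

text \<open>The data of the problem, reduced to what the estimates use. The one radius \<open>W\<close> bounds the velocity supports of
  both \<open>F\<close> and \<open>f0\<close>, and the one constant \<open>a\<close> bounds \<open>A\<close> as well as the decay of its derivative \<open>A'\<close>.\<close>

locale steady_background =
  fixes F :: "real^3 \<Rightarrow> real" and f0 :: "real^3 \<Rightarrow> real^3 \<Rightarrow> real"
    and A :: "real \<Rightarrow> real^3 \<Rightarrow> real^3" and A' :: "real \<Rightarrow> real^3 \<Rightarrow> real^3 \<Rightarrow> real^3"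
    and W N a l b :: real
  assumes F_cont: "continuous_on UNIV F"
    and F_supp: "W \<le> norm v \<Longrightarrow> F v = 0"
    and F_bound: "\<bar>F v\<bar> \<le> b"
    and F_lip: "\<bar>F u - F v\<bar> \<le> l * norm (u - v)"
    and f0_supp: "W \<le> norm v \<Longrightarrow> f0 x v = 0"
    and f0_far: "N < norm x \<Longrightarrow> f0 x v = F v"
    and A_bound: "0 \<le> s \<Longrightarrow> norm (A s x) \<le> a"
    and A_deriv: "0 \<le> s \<Longrightarrow> (A s has_derivative A' s x) (at x)"
    and A'_bound: "0 \<le> s \<Longrightarrow> norm (A' s x h) \<le> a * R x powr - 3 * norm h"
    and A'_trace: "0 \<le> s \<Longrightarrow> (\<Sum>i\<in>UNIV. A' s x (axis i 1) $ i) = 0"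
    and nonneg: "0 \<le> W" "0 \<le> N" "0 \<le> a" "0 \<le> l"
begin

text \<open>The constants that follow depend on the data and on \<open>S\<close>, \<open>p\<close>, \<open>t\<close>, but not on the solution; this makes the
  final bound uniform over all solutions. Here \<open>speed\<close> bounds the force, \<open>vmax\<close> the velocity support up
  to time \<open>t\<close>, \<open>reach\<close> the distance travelled within that support plus the radius \<open>1\<close> used for the divergence,
  \<open>stretch\<close> the derivative of the softened force relative to \<open>R\<close> to the power \<open>-3\<close>, and \<open>far\<close> is the
  distance from the origin beyond which the estimates start. In \<open>loss\<close>, the summands come from the softening
  of the field, the divergence due to the density nearby, the divergence due to the density far
  away, and the terms quadratic in the derivative of the force.\<close>

definition speed :: "real \<Rightarrow> real \<Rightarrow> real" where
  "speed S p = S * (2 * weight_mass 2 1 + bessel_mass p) + a"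

definition vmax :: "real \<Rightarrow> real \<Rightarrow> real \<Rightarrow> real" where
  "vmax S p t = W + t * speed S p"

definition reach :: "real \<Rightarrow> real \<Rightarrow> real \<Rightarrow> real" where
  "reach S p t = t * (vmax S p t + t * speed S p) + 1"

definition stretch :: "real \<Rightarrow> real \<Rightarrow> real" where
  "stretch S p = 4 * (S * 2 powr p * weight_mass (3 - (p - 3) / 8) ((p - 3) / 8) + 512 * (S * bessel_mass p)) + 8 * a"

definition far :: "real \<Rightarrow> real \<Rightarrow> real \<Rightarrow> real" where
  "far S p t = 1 + 4 * stretch S p * t\<^sup>2 + 4 * reach S p t + N"

definition vol :: "real \<Rightarrow> real \<Rightarrow> real \<Rightarrow> real" where
  "vol S p t = measure lebesgue (cball (0::real^3) (vmax S p t))"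

definition loss :: "real \<Rightarrow> real \<Rightarrow> real \<Rightarrow> real" where
  "loss S p t = vol S p t * (4 * l * t * (S * weight_mass 2 1))
     + vol S p t * b * (3 * t * bessel_mass 5) + vol S p t * b * (3 * t\<^sup>2 * (S * bessel_mass p))
     + vol S p t * b * (54 * (stretch S p)\<^sup>2 * t ^ 4)"

lemma b_nonneg: "0 \<le> b" using F_bound[of 0] by linarith

end

locale bounded_solution = steady_background +
  fixes f :: "real \<Rightarrow> real^3 \<Rightarrow> real^3 \<Rightarrow> real" and t T S p :: real
  assumes p: "3 < p" "p \<le> 4" and t: "0 \<le> t" "t < T"
    and sol: "VP_solution F A f0 T f"
    and density_le: "\<tau> \<in> {0..t} \<Longrightarrow> \<bar>charge_density F f \<tau> x\<bar> \<le> S * R x powr - p"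
begin

abbreviation "\<rho> \<equiv> charge_density F f"

lemma f_C1: "C1_on ({0..<T} \<times> UNIV \<times> UNIV) (\<lambda>(t, x, v). f t x v)"
  and f_eq: "\<tau> \<in> {0..<T} \<Longrightarrow> vector_derivative (\<lambda>s. f s x v) (at \<tau> within {0..<T})
        + v \<bullet> grad (\<lambda>y. f \<tau> y v) x - (electric_field F f \<tau> x + A \<tau> x) \<bullet> grad (f \<tau> x) v = 0"
  and f_init: "f 0 x v = f0 x v"
  using sol unfolding VP_solution_def by blast+

lemma f_continuous:
  assumes "\<tau> \<in> {0..t}"
  shows "continuous_on UNIV (\<lambda>(x, v). f \<tau> x v)"
proof -
  let ?S = "{0..<T} \<times> UNIV \<times> (UNIV :: (real^3) set)"
  have "continuous_on ?S (\<lambda>(t, x, v). f t x v)"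
    using f_C1 unfolding C1_on_def continuous_on_eq_continuous_within
    using has_derivative_continuous by blast
  then have "continuous_on UNIV (\<lambda>z. (\<lambda>(t, x, v). f t x v) (\<tau>, z))"
    by (rule continuous_on_compose2) (use assms t in \<open>auto intro!: continuous_intros\<close>)
  then show ?thesis by (simp add: case_prod_beta')
qed

lemma density: "\<tau> \<in> {0..t} \<Longrightarrow> decaying_density (\<rho> \<tau>) S p"
proof
  assume \<tau>: "\<tau> \<in> {0..t}"
  have "(\<lambda>(x, v). F v - f \<tau> x v) \<in> borel_measurable borel"
    using f_continuous[OF \<tau>] F_cont
    by (intro borel_measurable_continuous_onI)
       (auto simp: case_prod_beta' intro!: continuous_on_diff continuous_on_compose2[OF F_cont] continuous_intros)
  then have "(\<lambda>(x, v). F v - f \<tau> x v) \<in> borel_measurable (borel \<Otimes>\<^sub>M lborel)"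
    by (simp add: borel_prod[symmetric] cong: measurable_cong_sets)
  then show "\<rho> \<tau> \<in> borel_measurable borel"
    unfolding charge_density_def[abs_def] by (intro lborel.borel_measurable_lebesgue_integral) simp
  show "\<bar>\<rho> \<tau> y\<bar> \<le> S * R y powr - p" for y by (rule density_le[OF \<tau>])
qed (rule p)

lemma S_nonneg: "0 \<le> S"
  using decaying_density.S_nonneg[OF density[of 0]] t by simp

lemma electric_field_eq: "electric_field F f \<tau> x = soft_field 0 (\<rho> \<tau>) x"
  by (simp add: electric_field_def soft_field_def soft_kernel_def divide_inverse)

lemma
  assumes "\<tau> \<in> {0..t}"
  shows soft_force_le: "norm (soft_field \<epsilon> (\<rho> \<tau>) x + A \<tau> x) \<le> speed S p"
    and force_le: "norm (electric_field F f \<tau> x + A \<tau> x) \<le> speed S p"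
proof -
  show *: "norm (soft_field \<epsilon> (\<rho> \<tau>) x + A \<tau> x) \<le> speed S p" for \<epsilon>
    using norm_triangle_ineq[of "soft_field \<epsilon> (\<rho> \<tau>) x" "A \<tau> x"] A_bound[of \<tau> x] assms
      decaying_density.norm_soft_field_le[OF density[OF assms], of \<epsilon> x]
    by (simp add: speed_def)
  show "norm (electric_field F f \<tau> x + A \<tau> x) \<le> speed S p"
    unfolding electric_field_eq by (rule *)
qed

lemma speed_nonneg: "0 \<le> speed S p"
  using S_nonneg nonneg by (simp add: speed_def)

lemma vmax_nonneg: "0 \<le> vmax S p t"
  using speed_nonneg nonneg t by (simp add: vmax_def)

lemma polygon_limit:
  assumes "0 \<le> r" "0 < e"
  obtains n0 :: nat where "0 < n0" "\<And>n \<tau> x v. \<lbrakk>n0 \<le> n; \<tau> \<in> {0..t}; norm x \<le> r; norm v \<le> r\<rbrakk> \<Longrightarrow>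
      \<bar>f \<tau> x v - (\<lambda>(y, w). f0 y w) (euler (\<lambda>k y. electric_field F f (\<tau> - k * (\<tau> / n)) y
          + A (\<tau> - k * (\<tau> / n)) y) (\<tau> / n) (x, v) n)\<bar> \<le> e"
proof -
  obtain n0 :: nat where "0 < n0" "\<And>n \<tau> x v. \<lbrakk>n0 \<le> n; \<tau> \<in> {0..t}; norm x \<le> r; norm v \<le> r\<rbrakk> \<Longrightarrow>
      \<bar>f \<tau> x v - (\<lambda>(y, w). f 0 y w) (euler (\<lambda>k. (\<lambda>\<tau> y. electric_field F f \<tau> y + A \<tau> y) (\<tau> - k * (\<tau> / n)))
          (\<tau> / n) (x, v) n)\<bar> \<le> e"
    by (rule transport_along_polygon[where f=f and T=T and t=t and M="speed S p" and r=r and e=e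
        and B="\<lambda>\<tau> y. electric_field F f \<tau> y + A \<tau> y"])
       (use f_C1 f_eq t force_le speed_nonneg assms in auto)
  then show thesis unfolding f_init by (rule that)
qed

lemma polygon_time:
  assumes \<tau>: "\<tau> \<in> {0..t}" and n: "0 < n" and k: "k \<le> n"
  shows "\<tau> - real k * (\<tau> / real n) \<in> {0..t}"
proof -
  have "real k * (\<tau> / real n) \<le> real n * (\<tau> / real n)" using \<tau> k by (intro mult_right_mono) auto
  also have "\<dots> = \<tau>" using n by simp
  finally have "real k * (\<tau> / real n) \<le> \<tau>" .
  moreover have "0 \<le> real k * (\<tau> / real n)" using \<tau> by simp
  ultimately show ?thesis using \<tau> unfolding atLeastAtMost_iff by linarith
qed

lemma
  assumes \<tau>: "\<tau> \<in> {0..t}" and n: "0 < n" and k: "k \<le> n"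
    and B: "\<And>s y. s \<in> {0..t} \<Longrightarrow> norm (B s y) \<le> speed S p"
  shows polygon_velocity:
      "norm (snd (euler (\<lambda>k. B (\<tau> - real k * (\<tau> / real n))) (\<tau> / real n) (x, v) k) - v) \<le> t * speed S p"
    and polygon_position: "norm v \<le> vmax S p t \<Longrightarrow>
      norm (fst (euler (\<lambda>k. B (\<tau> - real k * (\<tau> / real n))) (\<tau> / real n) (x, v) k) - x) \<le> reach S p t - 1"
proof -
  have \<delta>: "0 \<le> \<tau> / real n" "real n * (\<tau> / real n) \<le> t" using \<tau> n by auto
  have bound: "norm (B (\<tau> - real k * (\<tau> / real n)) y) \<le> speed S p" if "k < n" for k y
    using polygon_time[OF \<tau> n less_imp_le[OF that]] by (rule B)
  note growth = euler_growth[of "\<tau> / real n" n "\<lambda>k. B (\<tau> - real k * (\<tau> / real n))" "speed S p" t k "(x, v)",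
      OF \<delta>(1) bound \<delta>(2) speed_nonneg k]
  show "norm (snd (euler (\<lambda>k. B (\<tau> - real k * (\<tau> / real n))) (\<tau> / real n) (x, v) k) - v) \<le> t * speed S p"
    using growth(1) by simp
  show "norm (fst (euler (\<lambda>k. B (\<tau> - real k * (\<tau> / real n))) (\<tau> / real n) (x, v) k) - x) \<le> reach S p t - 1"
    if "norm v \<le> vmax S p t"
  proof -
    have "t * (norm v + t * speed S p) \<le> t * (vmax S p t + t * speed S p)"
      using that t by (intro mult_left_mono) auto
    then show ?thesis using growth(2) by (simp add: reach_def)
  qed
qed

text \<open>Each step changes the velocity by at most \<open>speed\<close> times its length, so a polygon that starts with velocity of
  norm at least \<open>vmax\<close> ends where \<open>f0\<close> vanishes.\<close>

lemma f_supp: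
  assumes \<tau>: "\<tau> \<in> {0..t}" and v: "vmax S p t \<le> norm v"
  shows "f \<tau> x v = 0"
proof -
  have "\<bar>f \<tau> x v\<bar> \<le> e" if e: "0 < e" for e
  proof -
    let ?z = "\<lambda>n. euler (\<lambda>k y. electric_field F f (\<tau> - real k * (\<tau> / real n)) y
          + A (\<tau> - real k * (\<tau> / real n)) y) (\<tau> / real n) (x, v) n"
    obtain n where n: "0 < n" and le: "\<bar>f \<tau> x v - (\<lambda>(y, w). f0 y w) (?z n)\<bar> \<le> e"
    proof (rule polygon_limit[of "max (norm x) (norm v)" e])
      show "0 \<le> max (norm x) (norm v)" by (simp add: le_max_iff_disj)
    next
      fix n :: nat
      assume n: "0 < n" and lim: "\<And>m \<tau> y w. \<lbrakk>n \<le> m; \<tau> \<in> {0..t}; norm y \<le> max (norm x) (norm v); norm w \<le> max (norm x) (norm v)\<rbrakk>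
        \<Longrightarrow> \<bar>f \<tau> y w - (\<lambda>(y, w). f0 y w) (euler (\<lambda>k y. electric_field F f (\<tau> - real k * (\<tau> / real m)) y
          + A (\<tau> - real k * (\<tau> / real m)) y) (\<tau> / real m) (y, w) m)\<bar> \<le> e"
      show thesis
        using lim[of n \<tau> x v] \<tau> by (intro that[of n] n) simp
    qed (rule e)
    have "norm (snd (?z n) - v) \<le> t * speed S p"
      using force_le by (intro polygon_velocity[OF \<tau> n, where B="\<lambda>\<tau> y. electric_field F f \<tau> y + A \<tau> y"]) auto
    then have "W \<le> norm (snd (?z n))"
      using v norm_triangle_sub[of v "snd (?z n)"] by (simp add: vmax_def norm_minus_commute)
    then show ?thesis using le f0_supp by (simp add: case_prod_beta)
  qed
  then show ?thesis using field_le_epsilon[of "\<bar>f \<tau> x v\<bar>" 0] by simp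
qed

lemma density_eq:
  assumes \<tau>: "\<tau> \<in> {0..t}"
  shows "(\<lambda>v. F v - f \<tau> x v) absolutely_integrable_on cball 0 (vmax S p t)"
    and "\<rho> \<tau> x = integral (cball 0 (vmax S p t)) (\<lambda>v. F v - f \<tau> x v)"
proof -
  let ?D = "cball (0::real^3) (vmax S p t)"
  have "continuous_on UNIV (\<lambda>v. (\<lambda>(x, v). f \<tau> x v) (x, v))"
    by (rule continuous_on_compose2[OF f_continuous[OF \<tau>]]) (auto intro!: continuous_intros)
  then have cont: "continuous_on ?D (\<lambda>v. F v - f \<tau> x v)"
    using F_cont by (auto intro!: continuous_on_diff intro: continuous_on_subset)
  show "(\<lambda>v. F v - f \<tau> x v) absolutely_integrable_on ?D"
    by (rule absolutely_integrable_on_compact[OF compact_cball cont])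
  have "F v - f \<tau> x v = 0" if "v \<notin> ?D" for v
  proof -
    have "vmax S p t \<le> norm v" using that by simp
    moreover have "W \<le> vmax S p t" using t speed_nonneg by (simp add: vmax_def)
    ultimately show ?thesis using F_supp[of v] f_supp[OF \<tau>, of v x] by simp
  qed
  then have "\<rho> \<tau> x = set_lebesgue_integral lborel ?D (\<lambda>v. F v - f \<tau> x v)"
    unfolding charge_density_def set_lebesgue_integral_def
    by (intro Bochner_Integration.integral_cong) (auto simp: indicator_def)
  also have "\<dots> = integral ?D (\<lambda>v. F v - f \<tau> x v)"
    using borel_integrable_compact[OF compact_cball cont]
    by (intro set_borel_integral_eq_integral(2)) (simp add: set_integrable_def)
  finally show "\<rho> \<tau> x = integral ?D (\<lambda>v. F v - f \<tau> x v)" .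
qed

lemma reach_ge_1: "1 \<le> reach S p t"
  using t vmax_nonneg speed_nonneg by (simp add: reach_def)

lemma stretch_nonneg: "0 \<le> stretch S p"
  using S_nonneg nonneg by (simp add: stretch_def)

lemma far_ge: "1 \<le> far S p t" "4 * reach S p t \<le> far S p t" "4 * stretch S p * t\<^sup>2 \<le> far S p t"
    "N + reach S p t \<le> far S p t"
  using reach_ge_1 stretch_nonneg nonneg by (auto simp: far_def)

lemma loss_nonneg: "0 \<le> loss S p t"
  using S_nonneg nonneg b_nonneg t by (simp add: loss_def vol_def)

text \<open>With \<open>\<eta> = (p - 3) / 8\<close>, the loss of \<open>\<epsilon>\<close> to the power \<open>- \<eta>\<close> costs \<open>R\<close> to the power \<open>6 * \<eta>\<close>, and
  confining the near part to distance \<open>norm x / 4\<close> costs \<open>R\<close> to the power \<open>2 * \<eta>\<close>. Together these use up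
  exactly the surplus of the decay \<open>R\<close> to the power \<open>- p\<close> over \<open>R\<close> to the power \<open>-3\<close>.\<close>

lemma soft_force_deriv_le:
  assumes \<tau>: "\<tau> \<in> {0..t}" and x: "far S p t \<le> norm x" and y: "norm (y - x) \<le> reach S p t"
  shows "norm (soft_field_deriv (R x powr - 6) (\<rho> \<tau>) y h + A' \<tau> y h) \<le> stretch S p * R x powr - 3 * norm h"
proof -
  interpret decaying_density "\<rho> \<tau>" S p by (rule density[OF \<tau>])
  define \<eta> where "\<eta> = (p - 3) / 8"
  define d where "d = norm x / 4"
  define \<epsilon> where "\<epsilon> = R x powr - 6"
  define m where "m = S * 2 powr p * R x powr - p"
  have \<eta>: "0 < \<eta>" "\<eta> \<le> 1" "8 * \<eta> = p - 3" using p by (auto simp: \<eta>_def)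
  have x1: "1 \<le> norm x" "reach S p t \<le> norm x / 4" using x far_ge by auto
  have d: "0 < d" using x1(1) unfolding d_def by linarith
  have \<epsilon>: "0 < \<epsilon>" by (simp add: \<epsilon>_def)
  have m: "\<bar>\<rho> \<tau> z\<bar> \<le> m" if z: "norm (z - y) \<le> d" for z
  proof -
    have "norm x \<le> norm z + norm (z - y) + norm (y - x)"
      using norm_triangle_ineq4[of z "(z - y) + (y - x)"] norm_triangle_ineq[of "z - y" "y - x"] by simp
    then have "norm x \<le> 2 * norm z" using z y x1 by (simp add: d_def)
    then have "R x / 2 \<le> R z" using R_half_le by fastforce
    then have "R z powr - p \<le> (R x / 2) powr - p" using p by (intro powr_mono2') auto
    also have "\<dots> = 2 powr p * R x powr - p" by (simp add: powr_divide powr_minus_divide)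
    finally have "S * R z powr - p \<le> S * (2 powr p * R x powr - p)" using S_nonneg by (intro mult_left_mono)
    then show ?thesis using r_le[of z] by (simp add: m_def)
  qed
  have "m * \<epsilon> powr - \<eta> * (1 + d\<^sup>2) powr \<eta> \<le> S * 2 powr p * R x powr - 3"
  proof -
    have "1 + d\<^sup>2 \<le> R x ^ 2" by (simp add: R_def d_def power_divide)
    then have "(1 + d\<^sup>2) powr \<eta> \<le> (R x ^ 2) powr \<eta>" using \<eta> by (intro powr_mono2) (auto intro: add_nonneg_nonneg)
    also have "R x ^ 2 = R x powr 2" by (simp add: powr_numeral less_imp_le)
    also have "(R x powr 2) powr \<eta> = R x powr (2 * \<eta>)" by (simp only: powr_powr)
    finally have "m * \<epsilon> powr - \<eta> * (1 + d\<^sup>2) powr \<eta> \<le> m * \<epsilon> powr - \<eta> * R x powr (2 * \<eta>)"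
      using S_nonneg by (intro mult_left_mono) (auto simp: m_def)
    also have "\<dots> = S * 2 powr p * (R x powr - p * R x powr (6 * \<eta>) * R x powr (2 * \<eta>))"
      by (simp add: m_def \<epsilon>_def powr_powr)
    also have "R x powr - p * R x powr (6 * \<eta>) * R x powr (2 * \<eta>) = R x powr - 3"
      using \<eta>(3) by (simp add: powr_add[symmetric])
    finally show ?thesis .
  qed
  then have near: "m * \<epsilon> powr - \<eta> * (1 + d\<^sup>2) powr \<eta> * weight_mass (3 - \<eta>) \<eta>
      \<le> S * 2 powr p * R x powr - 3 * weight_mass (3 - \<eta>) \<eta>"
    by (intro mult_right_mono) auto
  have R3: "R x powr - 3 = 1 / R x ^ 3" by (simp add: powr_minus_divide powr_numeral less_imp_le)
  have away: "S * bessel_mass p / d ^ 3 \<le> 512 * (S * bessel_mass p) * R x powr - 3"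
  proof -
    have "R x / 8 \<le> d" using R_le_2_norm[OF x1(1)] by (simp add: d_def)
    then have "(R x / 8) ^ 3 \<le> d ^ 3" by (intro power_mono) (auto intro: less_imp_le)
    then have "S * bessel_mass p / d ^ 3 \<le> S * bessel_mass p / (R x / 8) ^ 3"
      using S_nonneg d by (intro divide_left_mono mult_pos_pos) auto
    then show ?thesis by (simp add: R3 power_divide mult.commute)
  qed
  have "norm (soft_field_deriv \<epsilon> (\<rho> \<tau>) y h)
      \<le> 4 * (S * 2 powr p * R x powr - 3 * weight_mass (3 - \<eta>) \<eta> + 512 * (S * bessel_mass p) * R x powr - 3) * norm h"
  proof -
    have "(\<integral>z. \<bar>\<rho> \<tau> z\<bar> / soft_norm \<epsilon> (y - z) ^ 3 \<partial>lborel)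
        \<le> S * 2 powr p * R x powr - 3 * weight_mass (3 - \<eta>) \<eta> + 512 * (S * bessel_mass p) * R x powr - 3"
      using integral_soft_norm_cube_le[where x=y and a=m, OF \<epsilon> \<eta>(1,2) d m] near away by linarith
    then show ?thesis
      by (intro order_trans[OF norm_soft_field_deriv_le[OF \<epsilon>]] mult_right_mono mult_left_mono) auto
  qed
  moreover have "norm (A' \<tau> y h) \<le> 8 * a * R x powr - 3 * norm h"
  proof -
    have "norm x \<le> 2 * norm y" using y x1 norm_triangle_sub[of x y] by (simp add: norm_minus_commute)
    then have "R x / 2 \<le> R y" using R_half_le by fastforce
    then have "R y powr - 3 \<le> (R x / 2) powr - 3" by (intro powr_mono2') auto
    also have "\<dots> = 8 * R x powr - 3" by (simp add: powr_divide powr_minus_divide powr_numeral less_imp_le)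
    finally have "a * R y powr - 3 * norm h \<le> a * (8 * R x powr - 3) * norm h"
      using nonneg by (intro mult_right_mono mult_left_mono) auto
    then show ?thesis using A'_bound[of \<tau> y h] \<tau> by simp
  qed
  ultimately show ?thesis
    using norm_triangle_ineq[of "soft_field_deriv \<epsilon> (\<rho> \<tau>) y h" "A' \<tau> y h"]
    by (simp add: stretch_def \<eta>_def[symmetric] \<epsilon>_def[symmetric] algebra_simps)
qed

text \<open>The polygon of the exact force carries \<open>f\<close> back to \<open>f0\<close>, hence to \<open>F\<close> because the polygon never comes
  near the origin. Exchanging the exact for the softened force costs \<open>O(\<epsilon>)\<close>, and the polygon of the
  softened force is a map \<open>w\<close> of velocities to which \<open>integral_diff_near_identity_le\<close> applies.\<close>

lemma local_estimate:
  assumes \<tau>: "\<tau> \<in> {0..t}" and x: "far S p t \<le> norm x" and e: "0 < e"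
  shows "\<exists>n0. \<forall>n\<ge>n0. \<forall>\<sigma>. n > 0 \<longrightarrow>
        (\<forall>k<n. \<forall>y. norm (y - x) \<le> reach S p t \<longrightarrow> \<bar>\<rho> (\<tau> - real k * (\<tau> / real n)) y\<bar> \<le> \<sigma> k) \<longrightarrow>
        \<bar>\<rho> \<tau> x\<bar> \<le> loss S p t * R x powr - 6 + e + loss S p t * (\<tau> / real n * (\<Sum>k<n. \<sigma> k))"
proof -
  define V where "V = vmax S p t"
  define \<epsilon> where "\<epsilon> = R x powr - 6"
  define \<Lambda> where "\<Lambda> = stretch S p * R x powr - 3"
  define e1 where "e1 = e / (vol S p t + 1)"
  define g where "g = 2 * S * weight_mass 2 1 * \<epsilon>"
  have vol: "0 \<le> vol S p t" by (simp add: vol_def)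
  have e1: "0 < e1" "vol S p t * e1 \<le> e" using e vol by (auto simp: e1_def field_simps)
  have \<epsilon>: "0 < \<epsilon>" "\<epsilon> \<le> 1" using R_ge_1[of x] by (auto simp: \<epsilon>_def powr_minus_divide powr_numeral less_imp_le)
  have \<epsilon>2: "\<epsilon>\<^sup>2 \<le> \<epsilon>" using \<epsilon> by (simp add: power2_eq_square mult_left_le)
  have g: "0 \<le> g" using S_nonneg \<epsilon> by (simp add: g_def)
  have \<Lambda>0: "0 \<le> \<Lambda>" using stretch_nonneg by (simp add: \<Lambda>_def)
  have \<Lambda>2: "\<Lambda>\<^sup>2 = (stretch S p)\<^sup>2 * \<epsilon>"
    by (simp add: \<Lambda>_def \<epsilon>_def power_mult_distrib power2_eq_square powr_add[symmetric])
  have \<Lambda>t: "2 * \<Lambda> * t\<^sup>2 \<le> 1 / 2"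
  proof -
    have "far S p t \<le> R x" using x R_ge_norm[of x] by simp
    then have st: "4 * stretch S p * t\<^sup>2 \<le> R x" using far_ge by linarith
    have "R x powr - 3 \<le> R x powr - 1" using R_ge_1[of x] by (intro powr_mono) auto
    then have "4 * stretch S p * t\<^sup>2 * R x powr - 3 \<le> R x * R x powr - 1"
      using st stretch_nonneg by (intro mult_mono) (auto intro: less_imp_le)
    also have "\<dots> = 1" by (simp add: powr_minus_divide less_imp_le)
    finally show ?thesis by (simp add: \<Lambda>_def mult_ac)
  qed
  have r0: "0 \<le> max (norm x) V" by (simp add: le_max_iff_disj)
  obtain n0 :: nat where "0 < n0" and n0: "\<And>n \<tau> y v. \<lbrakk>n0 \<le> n; \<tau> \<in> {0..t}; norm y \<le> max (norm x) V; norm v \<le> max (norm x) V\<rbrakk> \<Longrightarrow>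
      \<bar>f \<tau> y v - (\<lambda>(y, w). f0 y w) (euler (\<lambda>k y. electric_field F f (\<tau> - real k * (\<tau> / real n)) y
          + A (\<tau> - real k * (\<tau> / real n)) y) (\<tau> / real n) (y, v) n)\<bar> \<le> e1"
    by (rule polygon_limit[OF r0 e1(1)]) (rule that)
  show ?thesis
  proof (intro exI[of _ n0] allI impI)
    fix n :: nat and \<sigma> :: "nat \<Rightarrow> real"
    assume n: "n0 \<le> n" "0 < n"
      and \<sigma>: "\<forall>k<n. \<forall>y. norm (y - x) \<le> reach S p t \<longrightarrow> \<bar>\<rho> (\<tau> - real k * (\<tau> / real n)) y\<bar> \<le> \<sigma> k"
    define \<delta> where "\<delta> = \<tau> / real n"
    define s where "s k = \<tau> - real k * (\<tau> / real n)" for k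
    have \<delta>: "0 \<le> \<delta>" "real n * \<delta> \<le> t" using \<tau> n by (auto simp: \<delta>_def)
    have s: "s k \<in> {0..t}" if "k < n" for k
      unfolding s_def using polygon_time[OF \<tau> n(2)] that by simp
    define B where "B k y = electric_field F f (s k) y + A (s k) y" for k y
    define H where "H k y = soft_field \<epsilon> (\<rho> (s k)) y + A (s k) y" for k y
    define H' where "H' k y h = soft_field_deriv \<epsilon> (\<rho> (s k)) y h + A' (s k) y h" for k y h
    define D where "D = cball x (reach S p t - 1)"
    have D: "norm (y - x) \<le> reach S p t - 1" if "y \<in> D" for y
      using that by (simp add: D_def dist_norm norm_minus_commute)
    have near: "norm (B k y - H k y) \<le> g" if "k < n" for k y
      using decaying_density.norm_soft_field_diff_le[OF density[OF s[OF that]] \<epsilon>(1), of y]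
      by (simp add: B_def H_def g_def electric_field_eq norm_minus_commute)
    have H': "(H k has_derivative H' k y) (at y)" if "k < n" for k y
      unfolding H_def H'_def
      using decaying_density.has_derivative_soft_field[OF density[OF s[OF that]] \<epsilon>(1)] A_deriv[of "s k"] s[OF that]
      by (intro has_derivative_add) auto
    have lin: "linear (H' k y)" if "k < n" for k y
      using H'[OF that] has_derivative_linear by blast
    have H'_le: "norm (H' k y h) \<le> \<Lambda> * norm h" if "k < n" "y \<in> D" for k y h
      unfolding H'_def \<epsilon>_def \<Lambda>_def using D[OF that(2)] by (intro soft_force_deriv_le s that x) auto
    have tr: "\<bar>\<Sum>i\<in>UNIV. H' k y (axis i 1) $ i\<bar> \<le> 3 * bessel_mass 5 * \<sigma> k + 3 * S * bessel_mass p * \<epsilon>\<^sup>2"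
      if "k < n" "y \<in> D" for k y
    proof -
      have "\<bar>\<rho> (s k) z\<bar> \<le> \<sigma> k" if "norm (z - y) \<le> 1" for z
        using \<sigma> \<open>k < n\<close> that D[OF \<open>y \<in> D\<close>] norm_triangle_ineq[of "z - y" "y - x"] by (simp add: s_def)
      then show ?thesis
        using decaying_density.trace_soft_field_deriv_le[OF density[OF s[OF that(1)]] \<epsilon>(1), of y "\<sigma> k"]
          A'_trace[of "s k" y] s[OF that(1)]
        by (simp add: H'_def sum.distrib)
    qed
    have lip: "norm (H k y - H k z) \<le> \<Lambda> * norm (y - z)" if "k < n" "y \<in> D" "z \<in> D" for k y z
    proof (rule differentiable_bound[where S=D and f'="H' k"])
      show "convex D" by (simp add: D_def)
      show "(H k has_derivative H' k u) (at u within D)" if "u \<in> D" for u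
        by (rule has_derivative_at_withinI[OF H'[OF \<open>k < n\<close>]])
      show "onorm (H' k u) \<le> \<Lambda>" if "u \<in> D" for u
        by (rule onorm_le) (rule H'_le[OF \<open>k < n\<close> that])
    qed (use that in auto)
    have inD: "fst (euler B \<delta> (x, v) k) \<in> D" "fst (euler H \<delta> (x, v) k) \<in> D"
      if "norm v \<le> V" "k \<le> n" for v k
      using polygon_position[OF \<tau> n(2) that(2), of "\<lambda>\<tau> y. electric_field F f \<tau> y + A \<tau> y" v x]
        polygon_position[OF \<tau> n(2) that(2), of "\<lambda>\<tau> y. soft_field \<epsilon> (\<rho> \<tau>) y + A \<tau> y" v x]
        force_le soft_force_le that(1)
      by (simp_all add: D_def dist_norm norm_minus_commute B_def[abs_def] H_def[abs_def] s_def \<delta>_def V_def)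
    define w where "w v = snd (euler H \<delta> (x, v) n)" for v
    define w' where "w' v h = snd (euler_deriv H H' \<delta> (x, v) n h)" for v h
    have f_w: "\<bar>f \<tau> x v - F (w v)\<bar> \<le> e1 + l * (2 * g * t)" if v: "norm v \<le> V" for v
    proof -
      have "norm x - norm (fst (euler B \<delta> (x, v) n)) \<le> reach S p t - 1"
        using D[OF inD(1)[OF v order_refl]] norm_triangle_sub[of x "fst (euler B \<delta> (x, v) n)"]
        by (simp add: norm_minus_commute)
      then have "N < norm (fst (euler B \<delta> (x, v) n))" using x far_ge(4) by linarith
      then have "\<bar>f \<tau> x v - F (snd (euler B \<delta> (x, v) n))\<bar> \<le> e1"
        using n0[of n \<tau> x v] n \<tau> v f0_far by (simp add: B_def[abs_def] s_def \<delta>_def case_prod_beta)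
      moreover have "norm (snd (euler B \<delta> (x, v) n) - w v) \<le> 2 * g * t"
        unfolding w_def using \<Lambda>t inD[OF v]
        by (intro euler_compare[OF \<delta> \<Lambda>0 _ near lip _ _ g order_refl]) auto
      then have "l * norm (snd (euler B \<delta> (x, v) n) - w v) \<le> l * (2 * g * t)"
        using nonneg by (intro mult_left_mono) auto
      ultimately show ?thesis using F_lip[of "snd (euler B \<delta> (x, v) n)" "w v"] by linarith
    qed
    (* The bound on the trace of the derivative of w minus the identity. *)
    define \<theta> where "\<theta> = t * (\<delta> * (\<Sum>k<n. 3 * bessel_mass 5 * \<sigma> k + 3 * S * bessel_mass p * \<epsilon>\<^sup>2)) + 6 * \<Lambda>\<^sup>2 * t ^ 4"
    have der: "(w has_derivative w' v) (at v)" if "norm v \<le> V" for v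
      unfolding w_def w'_def
      by (intro has_derivative_snd has_derivative_euler) (rule H')
    have \<Lambda>t1: "2 * \<Lambda> * t\<^sup>2 \<le> 1" using \<Lambda>t by simp
    have "\<bar>integral (cball 0 V) (\<lambda>v. F v - F (w v))\<bar>
        \<le> b * (\<theta> + 12 * (2 * \<Lambda> * t\<^sup>2)\<^sup>2) * measure lebesgue (cball (0::real^3) V)"
    proof (rule integral_diff_near_identity_le[OF F_cont F_supp F_bound, where a="t * speed S p" and w'=w'])
      show "W + t * speed S p \<le> V" by (simp add: V_def vmax_def)
      show "0 \<le> t * speed S p" using t speed_nonneg by simp
      show "2 * \<Lambda> * t\<^sup>2 < 1" using \<Lambda>t by simp
      fix v :: "real^3" assume v: "norm v \<le> V"
      show "(w has_derivative w' v) (at v)" by (rule der[OF v])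
      show "norm (w v - v) \<le> t * speed S p"
        using polygon_velocity[OF \<tau> n(2) order_refl, of "\<lambda>\<tau> y. soft_field \<epsilon> (\<rho> \<tau>) y + A \<tau> y" x v] soft_force_le
        by (simp add: w_def H_def[abs_def] s_def \<delta>_def)
      have bd: "norm (H' k (fst (euler H \<delta> (x, v) k)) h) \<le> \<Lambda> * norm h" if "k < n" for k h
        using that inD(2)[OF v] by (intro H'_le) auto
      show "norm (w' v h - h) \<le> 2 * \<Lambda> * t\<^sup>2 * norm h" for h
        unfolding w'_def
        by (rule euler_deriv_near_free_flow(1)[where H=H and H'=H' and z="(x, v)" and k=n, OF \<delta> \<Lambda>0 \<Lambda>t1 bd order_refl])
      show "\<bar>\<Sum>i\<in>UNIV. (w' v (axis i 1) - axis i 1) $ i\<bar> \<le> \<theta>"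
        unfolding w'_def \<theta>_def
        using inD(2)[OF v]
        by (intro trace_euler_deriv_le[where H=H and H'=H' and z="(x, v)" and n=n, OF \<delta> \<Lambda>0 \<Lambda>t1 lin bd tr]) auto
    qed
    then have main: "\<bar>integral (cball 0 V) (\<lambda>v. F v - F (w v))\<bar> \<le> vol S p t * b * (\<theta> + 48 * \<Lambda>\<^sup>2 * t ^ 4)"
      by (simp add: vol_def V_def[symmetric] power_mult_distrib mult_ac)
    have Fw: "(\<lambda>v. F (w v)) integrable_on cball 0 V" and iF: "F integrable_on cball 0 V"
    proof -
      have "continuous_on (cball 0 V) w"
        using der by (intro continuous_at_imp_continuous_on ballI has_derivative_continuous) auto
      then have "continuous_on (cball 0 V) (\<lambda>v. F (w v))"
        by (intro continuous_on_compose2[OF F_cont]) auto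
      then show "(\<lambda>v. F (w v)) integrable_on cball 0 V"
        using absolutely_integrable_on_compact[OF compact_cball] by (auto simp: absolutely_integrable_on_def)
      show "F integrable_on cball 0 V"
        using absolutely_integrable_on_compact[OF compact_cball continuous_on_subset[OF F_cont]]
        by (auto simp: absolutely_integrable_on_def)
    qed
    have iFf: "(\<lambda>v. F v - f \<tau> x v) integrable_on cball 0 V"
      using density_eq(1)[OF \<tau>] by (simp add: V_def absolutely_integrable_on_def)
    have iFw: "(\<lambda>v. F v - F (w v)) integrable_on cball 0 V"
      by (intro Henstock_Kurzweil_Integration.integrable_diff iF Fw)
    have "norm (integral (cball 0 V) (\<lambda>v. (F v - f \<tau> x v) - (F v - F (w v))))
        \<le> integral (cball 0 V) (\<lambda>v::real^3. e1 + l * (2 * g * t))"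
      using f_w by (intro Henstock_Kurzweil_Integration.integral_norm_bound_integral
          Henstock_Kurzweil_Integration.integrable_diff iFf iFw integrable_on_const)
        (auto simp: abs_minus_commute)
    also have "\<dots> = vol S p t * (e1 + l * (2 * g * t))"
      using lmeasure_integral[of "cball (0::real^3) V"]
        integral_mult_right[of "cball (0::real^3) V" "e1 + l * (2 * g * t)" "\<lambda>_. 1::real"]
      by (simp add: vol_def V_def[symmetric])
    finally have "\<bar>\<rho> \<tau> x - integral (cball 0 V) (\<lambda>v. F v - F (w v))\<bar> \<le> vol S p t * (e1 + l * (2 * g * t))"
      unfolding Henstock_Kurzweil_Integration.integral_diff[OF iFf iFw] density_eq(2)[OF \<tau>] V_def[symmetric]
        real_norm_def .
    then have total: "\<bar>\<rho> \<tau> x\<bar> \<le> vol S p t * (e1 + l * (2 * g * t)) + vol S p t * b * (\<theta> + 48 * \<Lambda>\<^sup>2 * t ^ 4)"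
      using main by linarith
    define X Y1 Y2 Y3 where "X = vol S p t * (4 * l * t * (S * weight_mass 2 1))"
      and "Y1 = vol S p t * b * (3 * t * bessel_mass 5)" and "Y2 = vol S p t * b * (3 * t\<^sup>2 * (S * bessel_mass p))"
      and "Y3 = vol S p t * b * (54 * (stretch S p)\<^sup>2 * t ^ 4)"
    define \<Sigma> where "\<Sigma> = \<delta> * (\<Sum>k<n. \<sigma> k)"
    have \<Sigma>: "0 \<le> \<Sigma>"
    proof -
      have "0 \<le> \<sigma> k" if "k < n" for k
        using \<sigma>[rule_format, OF that, of x] reach_ge_1 by (simp add: order_trans[OF abs_ge_zero])
      then show ?thesis unfolding \<Sigma>_def using \<delta> by (intro mult_nonneg_nonneg sum_nonneg) auto
    qed
    have "\<theta> \<le> 3 * t * bessel_mass 5 * \<Sigma> + 3 * t\<^sup>2 * (S * bessel_mass p) * \<epsilon> + 6 * (stretch S p)\<^sup>2 * t ^ 4 * \<epsilon>"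
    proof -
      have "\<delta> * (\<Sum>k<n. 3 * bessel_mass 5 * \<sigma> k + 3 * S * bessel_mass p * \<epsilon>\<^sup>2)
          = 3 * bessel_mass 5 * \<Sigma> + (real n * \<delta>) * (3 * S * bessel_mass p * \<epsilon>\<^sup>2)"
        by (simp add: \<Sigma>_def sum.distrib sum_distrib_left algebra_simps)
      also have "(real n * \<delta>) * (3 * S * bessel_mass p * \<epsilon>\<^sup>2) \<le> t * (3 * S * bessel_mass p * \<epsilon>)"
        using \<delta> \<epsilon>2 S_nonneg t by (intro mult_mono mult_left_mono) auto
      finally have "t * (\<delta> * (\<Sum>k<n. 3 * bessel_mass 5 * \<sigma> k + 3 * S * bessel_mass p * \<epsilon>\<^sup>2))
          \<le> t * (3 * bessel_mass 5 * \<Sigma> + t * (3 * S * bessel_mass p * \<epsilon>))"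
        using t by (intro mult_left_mono) auto
      then show ?thesis unfolding \<theta>_def \<Lambda>2 by (simp add: algebra_simps power2_eq_square)
    qed
    then have "\<theta> + 48 * \<Lambda>\<^sup>2 * t ^ 4 \<le> 3 * t * bessel_mass 5 * \<Sigma> + 3 * t\<^sup>2 * (S * bessel_mass p) * \<epsilon>
        + 54 * (stretch S p)\<^sup>2 * t ^ 4 * \<epsilon>"
      unfolding \<Lambda>2 by (simp add: algebra_simps)
    then have "vol S p t * b * (\<theta> + 48 * \<Lambda>\<^sup>2 * t ^ 4)
        \<le> vol S p t * b * (3 * t * bessel_mass 5 * \<Sigma> + 3 * t\<^sup>2 * (S * bessel_mass p) * \<epsilon>
          + 54 * (stretch S p)\<^sup>2 * t ^ 4 * \<epsilon>)"
      using vol b_nonneg by (intro mult_left_mono) auto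
    also have "\<dots> = Y1 * \<Sigma> + Y2 * \<epsilon> + Y3 * \<epsilon>" by (simp add: Y1_def Y2_def Y3_def algebra_simps)
    finally have "vol S p t * b * (\<theta> + 48 * \<Lambda>\<^sup>2 * t ^ 4) \<le> Y1 * \<Sigma> + Y2 * \<epsilon> + Y3 * \<epsilon>" .
    moreover have "vol S p t * (e1 + l * (2 * g * t)) \<le> e + X * \<epsilon>"
      using e1(2) by (simp add: g_def X_def algebra_simps)
    ultimately have "\<bar>\<rho> \<tau> x\<bar> \<le> e + X * \<epsilon> + Y1 * \<Sigma> + Y2 * \<epsilon> + Y3 * \<epsilon>"
      using total by linarith
    moreover have "0 \<le> X" "0 \<le> Y1" "0 \<le> Y2" "0 \<le> Y3"
      using vol b_nonneg t S_nonneg nonneg by (auto simp: X_def Y1_def Y2_def Y3_def)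
    then have "0 \<le> Y1 * \<epsilon>" "0 \<le> X * \<Sigma>" "0 \<le> Y2 * \<Sigma>" "0 \<le> Y3 * \<Sigma>"
      using \<Sigma> \<epsilon> by (auto intro!: mult_nonneg_nonneg less_imp_le)
    moreover have "loss S p t = X + Y1 + Y2 + Y3" by (simp add: loss_def X_def Y1_def Y2_def Y3_def)
    ultimately have "\<bar>\<rho> \<tau> x\<bar> \<le> loss S p t * \<epsilon> + e + loss S p t * \<Sigma>"
      by (simp add: algebra_simps)
    then show "\<bar>\<rho> \<tau> x\<bar> \<le> loss S p t * R x powr - 6 + e + loss S p t * (\<tau> / real n * (\<Sum>k<n. \<sigma> k))"
      by (simp add: \<epsilon>_def \<Sigma>_def \<delta>_def)
  qed
qed

lemma density_decay:
  assumes "\<tau> \<in> {0..t}"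
  shows "\<bar>\<rho> \<tau> x\<bar> * R x ^ 6 \<le> 2 * (S * (1 + far S p t) ^ 6 + loss S p t)
     * exp ((4 * loss S p t * (1 + reach S p t) ^ 6 + 1) * t)"
proof (rule decay_propagation[OF t(1) loss_nonneg _ _ _ local_estimate assms])
  show "0 \<le> reach S p t" "0 \<le> far S p t" using reach_ge_1 far_ge by auto
  show "0 \<le> \<bar>\<rho> \<tau> y\<bar> \<and> \<bar>\<rho> \<tau> y\<bar> \<le> S" if "\<tau> \<in> {0..t}" for \<tau> y
    using decaying_density.r_le_S[OF density[OF that]] by simp
qed

end

section \<open>The uniform decay bound\<close>

lemma C1_on_imp_continuous_on: "C1_on S g \<Longrightarrow> continuous_on S g"
  unfolding C1_on_def continuous_on_eq_continuous_within using has_derivative_continuous by blast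

lemma C2_on_imp_C1_on: "C2_on S g \<Longrightarrow> C1_on S g"
  unfolding C2_on_def C1_on_def[of S g] using C1_on_imp_continuous_on by blast

lemma C1_compact_support_bounded:
  fixes g :: "'a::euclidean_space \<Rightarrow> real"
  assumes "C1_on UNIV g" and supp: "\<And>v. W \<le> norm v \<Longrightarrow> g v = 0"
  shows "\<exists>b. \<forall>v. \<bar>g v\<bar> \<le> b"
proof -
  have "continuous_on (cball 0 W) g"
    using C1_on_imp_continuous_on[OF assms(1)] by (rule continuous_on_subset) simp
  then have "bounded (g ` cball 0 W)" by (intro compact_imp_bounded compact_continuous_image) auto
  then obtain b where b: "0 < b" "\<And>v. v \<in> cball 0 W \<Longrightarrow> \<bar>g v\<bar> \<le> b" by (auto simp: bounded_pos)
  have "\<bar>g v\<bar> \<le> b" for v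
    using b supp[of v] by (cases "norm v \<le> W") auto
  then show ?thesis by blast
qed

lemma C1_compact_support_lipschitz:
  fixes g :: "'a::euclidean_space \<Rightarrow> real"
  assumes C1: "C1_on UNIV g" and supp: "\<And>v. W \<le> norm v \<Longrightarrow> g v = 0"
  shows "\<exists>l\<ge>0. \<forall>u v. \<bar>g u - g v\<bar> \<le> l * norm (u - v)"
proof -
  obtain g' where g': "\<And>z. (g has_derivative blinfun_apply (g' z)) (at z)" and cont: "continuous_on UNIV g'"
    using C1 unfolding C1_on_def by auto
  have "bounded (g' ` cball 0 W)"
    by (intro compact_imp_bounded compact_continuous_image continuous_on_subset[OF cont]) auto
  then obtain l where l: "0 < l" "\<And>v. v \<in> cball 0 W \<Longrightarrow> norm (g' v) \<le> l" by (auto simp: bounded_pos)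
  have "onorm (g' z) \<le> l" for z
  proof (cases "norm z \<le> W")
    case True
    then show ?thesis using l(2)[of z] by (simp add: norm_blinfun.rep_eq)
  next
    case False
    have "(g has_derivative (\<lambda>h. 0)) (at z)"
    proof (rule has_derivative_transform_within_open[of "\<lambda>_. 0" _ _ _ "- cball 0 W"])
      show "0 = g x" if "x \<in> - cball 0 W" for x using that supp[of x] by simp
    qed (use False in auto)
    then have "blinfun_apply (g' z) = (\<lambda>h. 0)" using g' has_derivative_unique by blast
    then show ?thesis using l(1) by (simp add: onorm_zero)
  qed
  then have "\<bar>g u - g v\<bar> \<le> l * norm (u - v)" for u v
    using differentiable_bound[of UNIV g "\<lambda>z. blinfun_apply (g' z)" l u v] g' by simp
  then show ?thesis using l(1) by (intro exI[of _ l]) auto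
qed

text \<open>On the whole slice \<open>{s} \<times> UNIV\<close> the derivative within \<open>{0..} \<times> UNIV\<close> is a full derivative in \<open>x\<close>, also
  for \<open>s = 0\<close>.\<close>

lemma C1_on_slice_differentiable:
  fixes A :: "real \<Rightarrow> 'a::real_normed_vector \<Rightarrow> 'b::real_normed_vector"
  assumes C1: "C1_on ({0..} \<times> UNIV) (\<lambda>(t, x). A t x)" and s: "0 \<le> s"
  shows "A s differentiable (at x)"
proof -
  obtain A' where A': "((\<lambda>(t, x). A t x) has_derivative blinfun_apply A') (at (s, x) within {0..} \<times> UNIV)"
    using C1 s unfolding C1_on_def by fastforce
  have "((\<lambda>y. (s, y)) has_derivative (\<lambda>k. (0, k))) (at x)"
    by (intro has_derivative_Pair has_derivative_ident has_derivative_const)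
  moreover have "((\<lambda>(t, x). A t x) has_derivative blinfun_apply A') (at (s, x) within (\<lambda>y. (s, y)) ` UNIV)"
    by (rule has_derivative_subset[OF A']) (use s in auto)
  ultimately have "((\<lambda>y. (\<lambda>(t, x). A t x) (s, y)) has_derivative (\<lambda>k. A' (0, k))) (at x)"
    by (rule has_derivative_in_compose)
  then show ?thesis by (auto simp: differentiable_def)
qed

lemma norm_matrix_vector_le:
  fixes M :: "real^3^3"
  shows "norm (M *v h) \<le> 9 * norm M * norm h"
proof -
  have "\<bar>M $ i $ j\<bar> \<le> norm M" for i j
    using order_trans[OF component_le_norm_cart Finite_Cartesian_Product.norm_nth_le] .
  then have "onorm (\<lambda>h. M *v h) \<le> real CARD(3) * real CARD(3) * norm M" by (rule onorm_le_matrix_component)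
  then have "onorm (\<lambda>h. M *v h) * norm h \<le> 9 * norm M * norm h" by (intro mult_right_mono) auto
  then show ?thesis using onorm[OF matrix_vector_mul_bounded_linear, of M h] by linarith
qed

theorem theorem3:
  fixes q p T :: real
    and F :: "real^3 \<Rightarrow> real"
    and f0 :: "real^3 \<Rightarrow> real^3 \<Rightarrow> real"
    and A :: "real \<Rightarrow> real^3 \<Rightarrow> real^3"
    and F_R :: "real \<Rightarrow> real"
  assumes q: "q > 7 + sqrt 33"
    and p: "p = 4 - 8 / q"
    and F_radial: "\<forall>v. F v = F_R (norm v)"
    and F_nonneg: "\<forall>v. 0 \<le> F v"
    and F_C2: "C2_on UNIV F"
    and F_R_0: "radial_deriv (radial_deriv F_R) 0 < 0"
    and F_R_decr: "\<exists>W>0. (\<forall>u. 0 < u \<and> u < W \<longrightarrow> radial_deriv F_R u < 0) \<and> (\<forall>u\<ge>W. F_R u = 0)"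
    and f0_C1: "C1_on UNIV (\<lambda>(x, v). f0 x v)"
    and f0_v_support: "\<exists>K. compact K \<and> (\<forall>x v. v \<notin> K \<longrightarrow> f0 x v = 0)"
    and f0_nonneg: "\<forall>x v. 0 \<le> f0 x v"
    and f0_far: "\<exists>N>0. \<forall>x v. norm x > N \<longrightarrow> f0 x v = F v"
    and A_C1: "C1_on ({0..} \<times> UNIV) (\<lambda>(t, x). A t x)"
    and A_decay: "\<exists>C>0. \<forall>t\<ge>0. \<forall>x.
          norm (A t x) \<le> C * R x powr (-2) \<and>
          norm (jacobian (A t) (at x)) \<le> C * R x powr (-3) \<and>
          \<bar>trace (jacobian (A t) (at x))\<bar> = 0"
    and T: "T > 0"
  shows "\<exists>K :: real \<Rightarrow> ennreal \<Rightarrow> ennreal.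
           (\<forall>t s. s < \<infinity> \<longrightarrow> K t s < \<infinity>) \<and>
           (\<forall>f. VP_solution F A f0 T f \<and>
                (\<forall>t\<in>{0..<T}. triple_norm p q (\<lambda>(x, v). F v - f t x v) < \<infinity>) \<longrightarrow>
                (\<forall>t\<in>{0..<T}. decay_norm 6 (charge_density F f t)
                    \<le> K t (SUP \<tau>\<in>{0..t}. decay_norm p (charge_density F f \<tau>))))"

proof -
  obtain b l W1 where F_cont: "continuous_on UNIV F" and F_supp: "\<And>v. W1 \<le> norm v \<Longrightarrow> F v = 0" and W1: "0 < W1"
    and F_bound: "\<And>v. \<bar>F v\<bar> \<le> b" and F_lip: "\<And>u v. \<bar>F u - F v\<bar> \<le> l * norm (u - v)" and l: "0 \<le> l"
  proof -
    obtain W1 where W1: "W1 > 0" "\<And>u. u \<ge> W1 \<Longrightarrow> F_R u = 0" using F_R_decr by blast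
    then have supp: "F v = 0" if "W1 \<le> norm v" for v using F_radial that by simp
    have "C1_on UNIV F" using F_C2 by (rule C2_on_imp_C1_on)
    from C1_compact_support_lipschitz[OF this supp] C1_compact_support_bounded[OF this supp]
    obtain l b where "0 \<le> l" "\<And>u v. \<bar>F u - F v\<bar> \<le> l * norm (u - v)" "\<And>v. \<bar>F v\<bar> \<le> b" by blast
    moreover have "continuous_on UNIV F" using \<open>C1_on UNIV F\<close> by (rule C1_on_imp_continuous_on)
    ultimately show thesis using that supp W1(1) by blast
  qed
  obtain W2 where W2: "\<And>x v. W2 \<le> norm v \<Longrightarrow> f0 x v = 0"
  proof -
    obtain K where K: "compact K" "\<And>x v. v \<notin> K \<Longrightarrow> f0 x v = 0" using f0_v_support by blast
    obtain W2 where "\<And>v. v \<in> K \<Longrightarrow> norm v < W2" using compact_imp_bounded[OF K(1)] bounded_pos_less by metis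
    then show thesis using that[of W2] K(2) by (metis not_le)
  qed
  obtain N where N: "N > 0" "\<And>x v. N < norm x \<Longrightarrow> f0 x v = F v" using f0_far by blast
  obtain C where C: "C > 0" and A_le: "\<And>t x. 0 \<le> t \<Longrightarrow> norm (A t x) \<le> C * R x powr (-2)"
    and J_le: "\<And>t x. 0 \<le> t \<Longrightarrow> norm (jacobian (A t) (at x)) \<le> C * R x powr (-3)"
    and J_tr: "\<And>t x. 0 \<le> t \<Longrightarrow> trace (jacobian (A t) (at x)) = 0"
    using A_decay by (metis abs_eq_0)
  interpret bg: steady_background F f0 A "\<lambda>t x h. jacobian (A t) (at x) *v h" "max W1 W2" N "9 * C" l b
  proof
    show "norm (A s x) \<le> 9 * C" if "0 \<le> s" for s x
    proof -
      have "R x powr (-2) \<le> R x powr 0" using R_ge_1[of x] by (intro powr_mono) auto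
      then have "C * R x powr (-2) \<le> C * 1" using C by (intro mult_left_mono) auto
      then show ?thesis using A_le[OF that, of x] C by linarith
    qed
    show "(A s has_derivative (\<lambda>h. jacobian (A s) (at x) *v h)) (at x)" if "0 \<le> s" for s x
      using C1_on_slice_differentiable[OF A_C1, of s x] that jacobian_works by blast
    show "norm (jacobian (A s) (at x) *v h) \<le> 9 * C * R x powr - 3 * norm h" if "0 \<le> s" for s x h
    proof -
      have "norm (jacobian (A s) (at x) *v h) \<le> 9 * norm (jacobian (A s) (at x)) * norm h"
        by (rule norm_matrix_vector_le)
      also have "\<dots> \<le> 9 * (C * R x powr (-3)) * norm h"
        using J_le[OF that] by (intro mult_right_mono mult_left_mono) auto
      finally show ?thesis by simp
    qed
    show "(\<Sum>i\<in>UNIV. (jacobian (A s) (at x) *v axis i 1) $ i) = 0" if "0 \<le> s" for s x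
      using J_tr[OF that, of x] by (simp add: trace_def matrix_vector_mult_basis column_def)
  qed (use F_cont F_supp F_bound F_lip W2 N W1 C l in \<open>auto simp: less_imp_le\<close>)
  have p34: "3 < p" "p \<le> 4"
  proof -
    have "8 < q" using q real_sqrt_ge_one[of 33] by linarith
    then have "8 / q < 1" "0 \<le> 8 / q" by simp_all
    then show "3 < p" "p \<le> 4" using p by linarith+
  qed
  define bound where "bound t S = 2 * (S * (1 + bg.far S p t) ^ 6 + bg.loss S p t)
      * exp ((4 * bg.loss S p t * (1 + bg.reach S p t) ^ 6 + 1) * t)" for t S
  define K :: "real \<Rightarrow> ennreal \<Rightarrow> ennreal" where
    "K t s = (if s < \<infinity> then ennreal (bound t (enn2real s)) else \<infinity>)" for t s
  show ?thesis
  proof (intro exI[of _ K] conjI allI impI ballI)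
    show "K t s < \<infinity>" if "s < \<infinity>" for t s using that by (simp add: K_def)
  next
    fix f t
    assume f: "VP_solution F A f0 T f \<and>
        (\<forall>t\<in>{0..<T}. triple_norm p q (\<lambda>(x, v). F v - f t x v) < \<infinity>)" and t: "t \<in> {0..<T}"
    define s where "s = (SUP \<tau>\<in>{0..t}. decay_norm p (charge_density F f \<tau>))"
    show "decay_norm 6 (charge_density F f t) \<le> K t s"
    proof (cases "s < \<infinity>")
      case True
      define S where "S = enn2real s"
      have sS: "s = ennreal S" using True by (simp add: S_def)
      have S0: "0 \<le> S" by (simp add: S_def)
      have dens: "\<bar>charge_density F f \<tau> x\<bar> \<le> S * R x powr - p" if "\<tau> \<in> {0..t}" for \<tau> x
      proof -
        have "ennreal (\<bar>charge_density F f \<tau> x\<bar> * R x powr p) \<le> decay_norm p (charge_density F f \<tau>)"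
          unfolding decay_norm_def by (rule SUP_upper) simp
        also have "\<dots> \<le> s" unfolding s_def using that by (rule SUP_upper)
        finally have "\<bar>charge_density F f \<tau> x\<bar> * R x powr p \<le> S" using S0 by (simp add: sS)
        then show ?thesis by (simp add: powr_minus_divide field_simps)
      qed
      interpret bounded_solution F f0 A "\<lambda>t x h. jacobian (A t) (at x) *v h" "max W1 W2" N "9 * C" l b f t T S p
        using p34 t f dens by unfold_locales auto
      have "decay_norm 6 (charge_density F f t) \<le> ennreal (bound t S)"
        unfolding decay_norm_def
      proof (rule SUP_least)
        fix x
        have "\<bar>charge_density F f t x\<bar> * R x powr 6 \<le> bound t S"
          using density_decay[of t x] t by (simp add: bound_def powr_numeral less_imp_le)
        then show "ennreal (\<bar>charge_density F f t x\<bar> * R x powr 6) \<le> ennreal (bound t S)"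
          by (rule ennreal_leI)
      qed
      then show ?thesis using True by (simp add: K_def S_def)
    qed (simp add: K_def)
  qed
qed

end
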